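(* Let $a: [0,1] \to \mathbb{R}$ be a continuous function with $a(1)<0$ for which there exist an integer $m\ge 1$ and points $$0 = \sigma_{1} < \tau_{1} < \ldots < \sigma_{i} < \tau_{i} < \ldots < \sigma_{m} < \tau_{m} < \sigma_{m+1} = 1$$ such that - $a(r)\geq 0$ on $[\sigma_{i},\tau_{i}]$ and $a\not\equiv0$ on $[\sigma_{i},\tau_{i}]$, for $i=1,\ldots,m$; - $a(r)\leq 0$ on $[\tau_{i},\sigma_{i+1}]$ and $a\not\equiv0$ on $[\tau_{i},\sigma_{i+1}]$, for $i=1,\ldots,m$. Let $g: \mathbb{R}^+ \to \mathbb{R}$ be a locally Lipschitz continuous function such that, with $G(u):=\int_0^u g(\xi)\,d\xi$: - $g(0)=0$ and $g(u)>0$ for every $u>0$; - $\lim_{u \to 0^+} g(u)/u = 0$; - $\lim_{u \to +\infty} g(u)/u = +\infty$; - $\displaystyle\int_1^{+\infty}\frac{d\xi}{\sqrt{G(\xi)}} <+\infty$ and $\displaystyle\lim_{u \to +\infty} \int_u^{+\infty}\frac{d\xi}{\sqrt{G(\xi)-G(u)}} = 0$. Finally, assume that there exists a positive radial solution of the Dirichlet problem $$ \begin{cases} \Delta u + a(|x|) g(u) = 0, & |x| < \tau_1,\\ u(x) = 0, & |x| = \tau_1. \end{cases} $$ Then there exists $\mu^* > 0$ such that for any $\mu > \mu^*$ the problem $$ \begin{cases} \Delta u + \bigl(a^+(|x|)-\mu a^-(|x|)\bigr) g(u) = 0, & x \in B,\\ u(x) \to +\infty, & x \to \partial B, \end{cases}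 $$ has at least $2^m$ distinct positive radial solutions.
   Context: $\mathbb{R}^+=[0,+\infty)$; $N$ is a positive integer, $B := \{ x \in \mathbb{R}^N : |x| < 1\}$ is the unit ball, and the Dirichlet problem is posed on the ball of radius $\tau_1$ in $\mathbb{R}^N$. $a^+=\max(a,0)$ and $a^-=\max(-a,0)$ are the positive and negative parts of $a$. A radial solution of the blow-up problem is a classical one, i.e. $u(x)=u(r)$ with $r=|x|$, where $u$ solves $(r^{N-1}u')' + r^{N-1}(a^+(r)-\mu a^-(r))g(u) = 0$ for $0<r<1$, with $u'(0)=0$ and $\lim_{r\to 1^-}u(r)=+\infty$. Similarly, radial solutions of the Dirichlet problem are classical. Positive means $u>0$ in the open ball. *)

theory Defs
  imports "HOL-Analysis.Analysis"
begin

definition partial_deriv :: "'a::euclidean_space \<Rightarrow> ('a \<Rightarrow> real) \<Rightarrow> 'a \<Rightarrow> real" where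
  "partial_deriv b u x = deriv (\<lambda>t. u (x + t *\<^sub>R b)) 0"

text \<open>The next two notions are meant for open sets. Differentiability along the coordinate
  directions is required explicitly, since \<^const>\<open>deriv\<close> is a total function.\<close>

definition C1_on :: "'a::euclidean_space set \<Rightarrow> ('a \<Rightarrow> real) \<Rightarrow> bool" where
  "C1_on S u \<longleftrightarrow>
     (\<forall>b\<in>Basis. (\<forall>x\<in>S. (\<lambda>t::real. u (x + t *\<^sub>R b)) differentiable (at 0)) \<and>
                continuous_on S (partial_deriv b u))"

definition C2_on :: "'a::euclidean_space set \<Rightarrow> ('a \<Rightarrow> real) \<Rightarrow> bool" where
  "C2_on S u \<longleftrightarrow> C1_on S u \<and> (\<forall>b\<in>Basis. C1_on S (partial_deriv b u))"

definition laplacian :: "('a::euclidean_space \<Rightarrow> real) \<Rightarrow> 'a \<Rightarrow> real" where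
  "laplacian u x = (\<Sum>b\<in>Basis. partial_deriv b (partial_deriv b u) x)"

definition radial_on :: "'a::euclidean_space set \<Rightarrow> ('a \<Rightarrow> real) \<Rightarrow> bool" where
  "radial_on S u \<longleftrightarrow> (\<exists>v. \<forall>x\<in>S. u x = v (norm x))"

text \<open>Positive radial classical solutions of $\Delta u + q(|x|) g(u) = 0$ in $|x| < R$,
  without boundary condition. Values of \<open>u\<close> outside the ball play no role.\<close>

definition positive_radial_solution ::
    "real \<Rightarrow> (real \<Rightarrow> real) \<Rightarrow> (real \<Rightarrow> real) \<Rightarrow> ('a::euclidean_space \<Rightarrow> real) \<Rightarrow> bool" where
  "positive_radial_solution R q g u \<longleftrightarrow>
     radial_on (ball 0 R) u \<and> C2_on (ball 0 R) u \<and>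
     (\<forall>x\<in>ball 0 R. u x > 0) \<and>
     (\<forall>x\<in>ball 0 R. laplacian u x + q (norm x) * g (u x) = 0)"

definition positive_radial_Dirichlet_solution ::
    "real \<Rightarrow> (real \<Rightarrow> real) \<Rightarrow> (real \<Rightarrow> real) \<Rightarrow> ('a::euclidean_space \<Rightarrow> real) \<Rightarrow> bool" where
  "positive_radial_Dirichlet_solution R q g u \<longleftrightarrow>
     positive_radial_solution R q g u \<and>
     continuous_on (cball 0 R) u \<and> (\<forall>x\<in>sphere 0 R. u x = 0)"

definition positive_radial_blowup_solution ::
    "real \<Rightarrow> (real \<Rightarrow> real) \<Rightarrow> (real \<Rightarrow> real) \<Rightarrow> ('a::euclidean_space \<Rightarrow> real) \<Rightarrow> bool" where
  "positive_radial_blowup_solution R q g u \<longleftrightarrow>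
     positive_radial_solution R q g u \<and>
     (\<forall>y\<in>sphere 0 R. filterlim u at_top (at y within ball 0 R))"

definition primitive :: "(real \<Rightarrow> real) \<Rightarrow> real \<Rightarrow> real" where
  "primitive g u = integral {0..u} g"

definition locally_lipschitz_on :: "real set \<Rightarrow> (real \<Rightarrow> real) \<Rightarrow> bool" where
  "locally_lipschitz_on S g \<longleftrightarrow>
     (\<forall>x\<in>S. \<exists>e>0. \<exists>L. L-lipschitz_on (cball x e \<inter> S) g)"

end

theory Submission
  imports Defs
begin

text \<open>
  A radial solution is determined by its value \<open>d\<close> at the origin, so one shoots in \<open>d\<close>. On an interval
  where the weight is nonnegative the profile is concave in the flux sense, and superlinearity at
  infinity bounds every solution that stays positive there; on an interval where the weight is negative
  the flux increases, and for large \<open>\<mu>\<close> the Keller--Osserman condition makes every solution that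
  stays away from zero blow up. By superlinearity at zero, a solution whose hump on a nonnegative
  interval has a fixed small height \<open>\<delta>\<close> survives that interval and then blows up, whereas the two
  extreme data of the current parameter interval (zero or dead on one side, blowing up at the start of
  the hump on the other) give solutions that are dead by the end of the hump. Each parameter
  interval therefore contains two disjoint ones with the same property for the next hump. After \<open>m\<close>
  steps there are \<open>2 ^ m\<close> intervals, and each has an end point whose solution blows up exactly at \<open>1\<close>.
\<close>

section \<open>The truncated initial value problem\<close>

text \<open>Three obstacles shape the argument. Solutions with different data end at different
  times, so continuity in \<open>d\<close> has no common domain a priori. For this reason
  \<open>g\<close> is extended by zero to negative arguments: past its first zero a solution has
  constant flux, stays negative and exists up to 1. Dying therefore never ends a solution; only
  upward blow-up does, and it is detected by cutting the nonlinearity off at a level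
  \<open>K\<close>. Secondly, what happens before an absorption interval must be controlled
  uniformly in \<mu>. On the humps the weight is \<open>a\<close> itself and on the other intervals
  the flux only grows, so the bound \<open>M\<close> for humps and the bound \<open>- C\<close> for
  the flux after a hump are fixed before \<mu>. Thirdly, blow-up must occur neither before nor after
  1. Since \<open>a 1 < 0\<close>, the Keller--Osserman estimate holds on every short interval
  ending at 1; a datum blowing up too early would have neighbours that live until 1 although they
  are large with positive flux shortly before. Distinctness is read off at the origin, where the
  value of the solution is the datum itself.\<close>

lemma continuous_on_bounded_Icc:
  fixes k :: "real \<Rightarrow> real"
  assumes "continuous_on {a..b} k"
  obtains B where "B > 0" "\<And>x. x \<in> {a..b} \<Longrightarrow> \<bar>k x\<bar> \<le> B"
proof -
  have "bounded (k ` {a..b})" using compact_continuous_image[OF assms] compact_imp_bounded by blast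
  then obtain B where "B > 0" "\<forall>y\<in>k ` {a..b}. norm y \<le> B" unfolding bounded_pos by blast
  then show ?thesis using that by auto
qed

text \<open>With \<open>n\<close> the dimension minus one, the equation
  \<open>(r^n u')' = - r^n k\<close> with \<open>u'(0) = 0\<close> integrates to
  \<open>r^n u' = - flux n k r\<close>, and once more to \<open>u = u(0) - pot n k\<close>. The
  second formula makes sense down to the singular point 0.\<close>

definition flux :: "nat \<Rightarrow> (real \<Rightarrow> real) \<Rightarrow> real \<Rightarrow> real" where
  "flux n k r = integral {0..r} (\<lambda>x. x ^ n * k x)"

text \<open>At \<open>r = 0\<close> the integrand below is \<open>0\<close>, by \<open>x / 0 = 0\<close> or because the flux vanishes; this is also its limit.\<close>

definition pot :: "nat \<Rightarrow> (real \<Rightarrow> real) \<Rightarrow> real \<Rightarrow> real" where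
  "pot n k s = integral {0..s} (\<lambda>r. flux n k r / r ^ n)"

lemma flux_0 [simp]: "flux n k 0 = 0" by (simp add: flux_def)
lemma pot_0 [simp]: "pot n k 0 = 0" by (simp add: pot_def)

lemma flux_has_derivative:
  assumes "continuous_on {0..t} k" "x \<in> {0..t}"
  shows "(flux n k has_real_derivative x ^ n * k x) (at x within {0..t})"
  unfolding flux_def has_real_derivative_iff_has_vector_derivative
  by (rule integral_has_vector_derivative) (use assms in \<open>auto intro!: continuous_intros\<close>)

lemma flux_cong:
  assumes "\<And>x. x \<in> {0..r} \<Longrightarrow> k x = l x"
  shows "flux n k r = flux n l r"
  unfolding flux_def by (rule integral_cong) (use assms in auto)

lemma pot_cong:
  assumes "\<And>x. x \<in> {0..r} \<Longrightarrow> k x = l x"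
  shows "pot n k r = pot n l r"
  unfolding pot_def by (rule integral_cong) (use assms flux_cong[of _ k l] in auto)

lemma exp_integral:
  fixes c :: real
  assumes "c > 0" "0 \<le> r"
  shows "((\<lambda>x. exp (c * x)) has_integral (exp (c * r) - 1) / c) {0..r}"
proof -
  have "((\<lambda>x. exp (c * x)) has_integral exp (c * r) / c - exp (c * 0) / c) {0..r}"
    by (rule fundamental_theorem_of_calculus)
       (use assms in \<open>auto intro!: derivative_eq_intros simp: has_real_derivative_iff_has_vector_derivative[symmetric]\<close>)
  then show ?thesis by (simp add: diff_divide_distrib)
qed

text \<open>Inside the integral \<open>x ^ n\<close> is at most \<open>r ^ n\<close>; this factor
  cancels the denominator in \<open>pot\<close>, so the estimate is uniform up to the origin. Each
  integration of the exponential gains a factor \<open>1 / c\<close>.\<close>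

lemma flux_bound:
  assumes k: "continuous_on {0..t} k" and b: "\<And>x. x \<in> {0..t} \<Longrightarrow> \<bar>k x\<bar> \<le> B * exp (c * x)"
    and c: "c > 0" and B: "B \<ge> 0" and r: "r \<in> {0..t}"
  shows "\<bar>flux n k r\<bar> \<le> r ^ n * (B * exp (c * r) / c)"
proof -
  have k': "continuous_on {0..r} k" using k r by (auto elim: continuous_on_subset)
  have hi: "((\<lambda>x. r ^ n * B * exp (c * x)) has_integral r ^ n * B * ((exp (c * r) - 1) / c)) {0..r}"
    by (rule has_integral_mult_right) (rule exp_integral, use c r in auto)
  have "norm (integral {0..r} (\<lambda>x. x ^ n * k x)) \<le> integral {0..r} (\<lambda>x. r ^ n * B * exp (c * x))"
  proof (rule integral_norm_bound_integral)
    show "(\<lambda>x. x ^ n * k x) integrable_on {0..r}"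
      by (rule integrable_continuous_real) (intro continuous_intros k')
    show "(\<lambda>x. r ^ n * B * exp (c * x)) integrable_on {0..r}" using hi by blast
    fix x assume x: "x \<in> {0..r}"
    have "\<bar>k x\<bar> \<le> B * exp (c * x)" using b x r by auto
    moreover have "x ^ n \<le> r ^ n" using x by (intro power_mono) auto
    ultimately have "x ^ n * \<bar>k x\<bar> \<le> r ^ n * (B * exp (c * x))"
      using x by (intro mult_mono) auto
    then show "norm (x ^ n * k x) \<le> r ^ n * B * exp (c * x)"
      using x by (simp add: abs_mult mult.assoc)
  qed
  also have "\<dots> = r ^ n * B * ((exp (c * r) - 1) / c)" using hi by (rule integral_unique)
  also have "\<dots> \<le> r ^ n * B * (exp (c * r) / c)"
    using r B c by (intro mult_left_mono divide_right_mono) auto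
  finally show ?thesis by (simp add: flux_def)
qed

lemma flux_div_bound:
  assumes k: "continuous_on {0..t} k" and b: "\<And>x. x \<in> {0..t} \<Longrightarrow> \<bar>k x\<bar> \<le> B * exp (c * x)"
    and c: "c > 0" and B: "B \<ge> 0" and r: "r \<in> {0..t}"
  shows "\<bar>flux n k r / r ^ n\<bar> \<le> B * exp (c * r) / c"
proof (cases "r = 0")
  case True
  then show ?thesis using B c by simp
next
  case False
  then show ?thesis
    using flux_bound[OF assms, of n] r by (auto simp: field_simps abs_mult)
qed

lemma flux_linear_bound:
  assumes k: "continuous_on {0..t} k" and b: "\<And>x. x \<in> {0..t} \<Longrightarrow> \<bar>k x\<bar> \<le> B"
    and B: "B \<ge> 0" and r: "r \<in> {0..t}"
  shows "\<bar>flux n k r\<bar> \<le> r ^ n * (B * r)"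
proof -
  have "norm (integral {0..r} (\<lambda>x. x ^ n * k x)) \<le> integral {0..r} (\<lambda>x. r ^ n * B)"
  proof (rule integral_norm_bound_integral)
    show "(\<lambda>x. x ^ n * k x) integrable_on {0..r}"
      by (rule integrable_continuous_real) (use k r in \<open>auto intro!: continuous_intros elim: continuous_on_subset\<close>)
    fix x assume x: "x \<in> {0..r}"
    have "x ^ n \<le> r ^ n" using x by (intro power_mono) auto
    then show "norm (x ^ n * k x) \<le> r ^ n * B"
      using x r b[of x] B unfolding real_norm_def abs_mult by (intro mult_mono) auto
  qed auto
  then show ?thesis using r by (simp add: flux_def mult_ac)
qed

lemma flux_div_continuous:
  assumes k: "continuous_on {0..t} k"
  shows "continuous_on {0..t} (\<lambda>r. flux n k r / r ^ n)"
proof -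
  obtain B where B: "\<And>x. x \<in> {0..t} \<Longrightarrow> \<bar>k x\<bar> \<le> B" "B \<ge> 0"
    using continuous_on_bounded_Icc[OF k] by (metis less_imp_le)
  show ?thesis unfolding continuous_on_eq_continuous_within
  proof
    fix r assume r: "r \<in> {0..t}"
    have c: "continuous (at r within {0..t}) (flux n k)"
      using flux_has_derivative[OF k r] DERIV_continuous by blast
    show "continuous (at r within {0..t}) (\<lambda>r. flux n k r / r ^ n)"
    proof (cases "r = 0")
      case False
      then show ?thesis by (intro continuous_intros c) auto
    next
      case True
      \<comment> \<open>The flux is of order \<open>r ^ (n + 1)\<close>, so the quotient tends to 0,
        which agrees with the value that the formula takes at 0.\<close>
      have "((\<lambda>r. flux n k r / r ^ n) \<longlongrightarrow> 0) (at 0 within {0..t})"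
      proof (rule Lim_null_comparison)
        show "((\<lambda>x. B * x) \<longlongrightarrow> 0) (at 0 within {0..t})" by (auto intro!: tendsto_eq_intros)
        show "\<forall>\<^sub>F x in at 0 within {0..t}. norm (flux n k x / x ^ n) \<le> B * x"
          unfolding eventually_at_filter
        proof (rule always_eventually, intro allI impI)
          fix x assume x: "x \<noteq> 0" "x \<in> {0..t}"
          then show "norm (flux n k x / x ^ n) \<le> B * x"
            using flux_linear_bound[OF k B(1) B(2) x(2), of n] by (auto simp: field_simps abs_mult)
        qed
      qed
      then show ?thesis using True by (simp add: continuous_within)
    qed
  qed
qed

lemma pot_has_derivative:
  assumes "continuous_on {0..t} k" "x \<in> {0..t}"
  shows "(pot n k has_real_derivative flux n k x / x ^ n) (at x within {0..t})"
  unfolding pot_def has_real_derivative_iff_has_vector_derivative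
  by (rule integral_has_vector_derivative) (use assms flux_div_continuous in auto)

lemma pot_continuous:
  assumes "continuous_on {0..t} k"
  shows "continuous_on {0..t} (pot n k)"
  using pot_has_derivative[OF assms] DERIV_continuous continuous_on_eq_continuous_within by blast

lemma pot_bound:
  assumes k: "continuous_on {0..t} k" and b: "\<And>x. x \<in> {0..t} \<Longrightarrow> \<bar>k x\<bar> \<le> B * exp (c * x)"
    and c: "c > 0" and B: "B \<ge> 0" and s: "s \<in> {0..t}"
  shows "\<bar>pot n k s\<bar> \<le> B * exp (c * s) / c\<^sup>2"
proof -
  have hi: "((\<lambda>x. B / c * exp (c * x)) has_integral B / c * ((exp (c * s) - 1) / c)) {0..s}"
    by (rule has_integral_mult_right) (rule exp_integral, use c s in auto)
  have "norm (integral {0..s} (\<lambda>r. flux n k r / r ^ n)) \<le> integral {0..s} (\<lambda>x. B / c * exp (c * x))"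
  proof (rule integral_norm_bound_integral)
    show "(\<lambda>r. flux n k r / r ^ n) integrable_on {0..s}"
      by (rule integrable_continuous_real, rule continuous_on_subset[OF flux_div_continuous[OF k]])
         (use s in auto)
    show "(\<lambda>x. B / c * exp (c * x)) integrable_on {0..s}" using hi by blast
    show "norm (flux n k x / x ^ n) \<le> B / c * exp (c * x)" if "x \<in> {0..s}" for x
      using flux_div_bound[OF k b c B, of x n] that s by simp
  qed
  also have "\<dots> = B / c * ((exp (c * s) - 1) / c)" using hi by (rule integral_unique)
  also have "\<dots> \<le> B / c * (exp (c * s) / c)"
    using s B c by (intro mult_left_mono divide_right_mono) auto
  finally show ?thesis by (simp add: pot_def power2_eq_square)
qed

lemma flux_diff:
  assumes "continuous_on {0..r} k" "continuous_on {0..r} l"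
  shows "flux n (\<lambda>x. k x - l x) r = flux n k r - flux n l r"
proof -
  have "integral {0..r} (\<lambda>x. x ^ n * k x - x ^ n * l x)
        = integral {0..r} (\<lambda>x. x ^ n * k x) - integral {0..r} (\<lambda>x. x ^ n * l x)"
    by (rule integral_diff; rule integrable_continuous_real; intro continuous_intros assms)
  then show ?thesis by (simp add: flux_def right_diff_distrib)
qed

lemma pot_diff:
  assumes "continuous_on {0..s} k" "continuous_on {0..s} l"
  shows "pot n (\<lambda>x. k x - l x) s = pot n k s - pot n l s"
proof -
  have "pot n (\<lambda>x. k x - l x) s = integral {0..s} (\<lambda>r. flux n k r / r ^ n - flux n l r / r ^ n)"
    unfolding pot_def
  proof (rule integral_cong)
    fix r assume "r \<in> {0..s}"
    then have "continuous_on {0..r} k" "continuous_on {0..r} l"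
      using assms by (auto elim!: continuous_on_subset)
    then show "flux n (\<lambda>x. k x - l x) r / r ^ n = flux n k r / r ^ n - flux n l r / r ^ n"
      by (simp add: flux_diff diff_divide_distrib)
  qed
  also have "\<dots> = pot n k s - pot n l s" unfolding pot_def
    by (rule integral_diff; rule integrable_continuous_real; rule flux_div_continuous; rule assms)
  finally show ?thesis .
qed

section \<open>The Volterra equation with truncated nonlinearity\<close>

locale radial_ode =
  fixes n :: nat and q f :: "real \<Rightarrow> real"
  assumes q_cont: "continuous_on {0..1} q"
    and f_lipschitz: "\<And>K. \<exists>L. L-lipschitz_on {..K} f"
begin

abbreviation src :: "real \<Rightarrow> (real \<Rightarrow> real) \<Rightarrow> real \<Rightarrow> real" where
  "src K u \<equiv> \<lambda>x. q x * f (min (u x) K)"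

text \<open>Integral form of the problem \<open>u(0) = d\<close>, \<open>u'(0) = 0\<close>, with the
  nonlinearity frozen above the level \<open>K\<close>. As \<open>f\<close> is Lipschitz on every
  half line \<open>{..K}\<close>, the cut-off from above alone makes it globally Lipschitz, and
  solutions exist on all of \<open>[0,1]\<close>.\<close>

definition volterra :: "real \<Rightarrow> real \<Rightarrow> real \<Rightarrow> (real \<Rightarrow> real) \<Rightarrow> bool" where
  "volterra K d t u \<longleftrightarrow> continuous_on {0..t} u \<and>
     (\<forall>s\<in>{0..t}. u s = d - pot n (src K u) s)"

lemma f_trunc_lipschitz: "\<exists>L>0. \<forall>x y. \<bar>f (min x K) - f (min y K)\<bar> \<le> L * \<bar>x - y\<bar>"
proof -
  obtain L where L: "L-lipschitz_on {..K} f" using f_lipschitz by blast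
  have "\<bar>f (min x K) - f (min y K)\<bar> \<le> (max L 1) * \<bar>x - y\<bar>" for x y
  proof -
    have "\<bar>f (min x K) - f (min y K)\<bar> \<le> L * \<bar>min x K - min y K\<bar>"
      using lipschitz_onD[OF L, of "min x K" "min y K"] by (simp add: dist_real_def)
    also have "\<dots> \<le> max L 1 * \<bar>x - y\<bar>"
      using lipschitz_on_nonneg[OF L] by (intro mult_mono) auto
    finally show ?thesis .
  qed
  then show ?thesis by (intro exI[of _ "max L 1"]) auto
qed

lemma f_trunc_continuous: "continuous_on A u \<Longrightarrow> continuous_on A (\<lambda>x. f (min (u x) K))"
proof -
  assume u: "continuous_on A u"
  obtain L where L: "L-lipschitz_on {..K} f" using f_lipschitz by blast
  have "continuous_on A (f \<circ> (\<lambda>x. min (u x) K))"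
    by (rule continuous_on_compose)
       (intro continuous_intros u, rule continuous_on_subset[OF lipschitz_on_continuous_on[OF L]], auto)
  then show ?thesis by (simp add: o_def)
qed

lemma f_continuous: "continuous_on A f"
proof -
  have "isCont f x" for x
  proof -
    obtain L where L: "L-lipschitz_on {..x+1} f" using f_lipschitz by blast
    then have "continuous_on {..x+1} f" by (rule lipschitz_on_continuous_on)
    then have "continuous_on {..<x+1} f" by (rule continuous_on_subset) auto
    then show ?thesis by (rule continuous_on_interior) (simp add: interior_open)
  qed
  then show ?thesis by (simp add: continuous_at_imp_continuous_on)
qed

lemma q_bound: "\<exists>Q>0. \<forall>x\<in>{0..1}. \<bar>q x\<bar> \<le> Q"
  using continuous_on_bounded_Icc[OF q_cont] by metis

text \<open>In the norm weighted by \<open>exp (- c * s)\<close> with large \<open>c\<close> the integral operator halves distances.\<close>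

definition halving_rate :: "real \<Rightarrow> real \<Rightarrow> bool" where
  "halving_rate K c \<longleftrightarrow> (\<forall>t u v m. t \<le> 1 \<longrightarrow> continuous_on {0..t} u \<longrightarrow> continuous_on {0..t} v \<longrightarrow> m \<ge> 0 \<longrightarrow>
     (\<forall>s\<in>{0..t}. \<bar>u s - v s\<bar> \<le> m * exp (c * s)) \<longrightarrow>
     (\<forall>s\<in>{0..t}. \<bar>pot n (src K u) s - pot n (src K v) s\<bar>
        \<le> m / 2 * exp (c * s)))"

lemma halving_rate_exists: "\<exists>c>0. halving_rate K c"
proof -
  obtain Q where Q: "Q > 0" "\<And>x. x \<in> {0..1} \<Longrightarrow> \<bar>q x\<bar> \<le> Q" using q_bound by blast
  obtain L where L: "L > 0" "\<And>x y. \<bar>f (min x K) - f (min y K)\<bar> \<le> L * \<bar>x - y\<bar>"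
    using f_trunc_lipschitz by blast
  \<comment> \<open>Two integrations turn the Lipschitz factor \<open>Q * L\<close> into
    \<open>Q * L / c\<^sup>2\<close>, so \<open>c\<^sup>2 \<ge> 2 * Q * L\<close> is what makes it
    at most 1/2.\<close>
  define c where "c = 2 * Q * L + 1"
  have c: "c > 0" "c \<ge> 1" and cQL: "2 * Q * L \<le> c\<^sup>2" using Q(1) L(1)
    by (auto simp: c_def power2_eq_square add_pos_pos algebra_simps intro!: add_nonneg_nonneg)
  show ?thesis unfolding halving_rate_def
  proof (intro exI[of _ c] conjI c(1) allI impI ballI)
    fix t s m :: real and u v :: "real \<Rightarrow> real"
    assume t: "t \<le> 1" and u: "continuous_on {0..t} u" and v: "continuous_on {0..t} v"
      and m: "m \<ge> 0" and uv: "\<forall>s\<in>{0..t}. \<bar>u s - v s\<bar> \<le> m * exp (c * s)" and s: "s \<in> {0..t}"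
    have q: "continuous_on {0..t} q" using q_cont t by (auto elim: continuous_on_subset)
    let ?k = "\<lambda>x. q x * f (min (u x) K)" and ?l = "\<lambda>x. q x * f (min (v x) K)"
    have k: "continuous_on {0..t} ?k" and l: "continuous_on {0..t} ?l"
      by (intro continuous_intros q f_trunc_continuous u v)+
    have "\<bar>pot n (\<lambda>x. ?k x - ?l x) s\<bar> \<le> (Q * L * m) * exp (c * s) / c\<^sup>2"
    proof (rule pot_bound[OF _ _ c(1) _ s])
      show "continuous_on {0..t} (\<lambda>x. ?k x - ?l x)" by (intro continuous_intros k l)
      fix x assume x: "x \<in> {0..t}"
      have "\<bar>?k x - ?l x\<bar> = \<bar>q x\<bar> * \<bar>f (min (u x) K) - f (min (v x) K)\<bar>"
        by (simp add: abs_mult[symmetric] right_diff_distrib)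
      also have "\<dots> \<le> Q * (L * (m * exp (c * x)))"
      proof (rule mult_mono)
        show "\<bar>q x\<bar> \<le> Q" using Q x t by auto
        have "\<bar>u x - v x\<bar> \<le> m * exp (c * x)" using uv x by auto
        then show "\<bar>f (min (u x) K) - f (min (v x) K)\<bar> \<le> L * (m * exp (c * x))"
          using L order_trans[OF L(2) mult_left_mono] by (meson less_imp_le)
      qed (use Q in auto)
      finally show "\<bar>?k x - ?l x\<bar> \<le> (Q * L * m) * exp (c * x)" by (simp add: mult_ac)
    qed (use Q L m in auto)
    also have "pot n (\<lambda>x. ?k x - ?l x) s = pot n ?k s - pot n ?l s"
      by (rule pot_diff) (use k l s in \<open>auto elim: continuous_on_subset\<close>)
    also have "(Q * L * m) * exp (c * s) / c\<^sup>2 \<le> m / 2 * exp (c * s)"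
    proof -
      have "2 * Q * L * m * exp (c * s) \<le> c\<^sup>2 * m * exp (c * s)"
        by (intro mult_right_mono cQL m) auto
      then show ?thesis using c by (simp add: field_simps)
    qed
    finally show "\<bar>pot n ?k s - pot n ?l s\<bar> \<le> m / 2 * exp (c * s)" by simp
  qed
qed

lemma halving_rateD:
  assumes "halving_rate K c" "t \<le> 1" "continuous_on {0..t} u" "continuous_on {0..t} v" "m \<ge> 0"
    and "\<And>s. s \<in> {0..t} \<Longrightarrow> \<bar>u s - v s\<bar> \<le> m * exp (c * s)" "s \<in> {0..t}"
  shows "\<bar>pot n (src K u) s - pot n (src K v) s\<bar>
    \<le> m / 2 * exp (c * s)"
  using assms unfolding halving_rate_def by blast

text \<open>If \<open>m\<close> is the maximum of the weighted difference, the halving property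
  gives \<open>m \<le> \<bar>d - e\<bar> + m / 2\<close>. The resulting constant depends on
  \<open>K\<close> only, neither on \<open>t\<close> nor on the data; with \<open>d = e\<close> this
  is uniqueness.\<close>

lemma volterra_dependence:
  "\<exists>C>0. \<forall>t u v d e. t \<le> 1 \<longrightarrow> volterra K d t u \<longrightarrow> volterra K e t v \<longrightarrow>
     (\<forall>s\<in>{0..t}. \<bar>u s - v s\<bar> \<le> C * \<bar>d - e\<bar>)"
proof -
  obtain c where c: "c > 0" and C: "halving_rate K c" using halving_rate_exists by blast
  show ?thesis
  proof (intro exI[of _ "2 * exp c"] conjI allI impI ballI)
    fix t d e s :: real and u v
    assume t: "t \<le> 1" and u: "volterra K d t u" and v: "volterra K e t v" and s: "s \<in> {0..t}"
    have uc: "continuous_on {0..t} u" and vc: "continuous_on {0..t} v"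
      using u v by (auto simp: volterra_def)
    have "\<exists>x\<in>{0..t}. \<forall>y\<in>{0..t}. \<bar>u y - v y\<bar> * exp (- c * y) \<le> \<bar>u x - v x\<bar> * exp (- c * x)"
      by (rule continuous_attains_sup) (use s in \<open>auto intro!: continuous_intros uc vc\<close>)
    then obtain x where x: "x \<in> {0..t}"
      and mx: "\<And>y. y \<in> {0..t} \<Longrightarrow> \<bar>u y - v y\<bar> * exp (- c * y) \<le> \<bar>u x - v x\<bar> * exp (- c * x)" by blast
    define m where "m = \<bar>u x - v x\<bar> * exp (- c * x)"
    have m: "\<bar>u y - v y\<bar> \<le> m * exp (c * y)" if "y \<in> {0..t}" for y
      using mult_right_mono[OF mx[OF that], of "exp (c * y)"]
      by (simp add: m_def mult.assoc mult_exp_exp)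
    have m0: "m \<ge> 0" by (simp add: m_def)
    have "u x - v x = (d - e) - (pot n (src K u) x - pot n (src K v) x)"
      using u v x by (simp add: volterra_def)
    then have "\<bar>u x - v x\<bar> \<le> \<bar>d - e\<bar> + m / 2 * exp (c * x)"
      using halving_rateD[OF C t uc vc m0 m x] by linarith
    then have "\<bar>u x - v x\<bar> * exp (- c * x) \<le> (\<bar>d - e\<bar> + m / 2 * exp (c * x)) * exp (- c * x)"
      by (rule mult_right_mono) auto
    then have "m \<le> \<bar>d - e\<bar> * exp (- c * x) + m / 2"
      by (simp add: m_def distrib_right mult.assoc mult_exp_exp)
    moreover have "\<bar>d - e\<bar> * exp (- c * x) \<le> \<bar>d - e\<bar> * 1"
      using c x by (intro mult_left_mono) auto
    ultimately have "m \<le> 2 * \<bar>d - e\<bar>" by simp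
    then have "m * exp (c * s) \<le> 2 * \<bar>d - e\<bar> * exp (c * 1)"
      using c s t m0 by (intro mult_mono) auto
    then show "\<bar>u s - v s\<bar> \<le> 2 * exp c * \<bar>d - e\<bar>" using m[OF s] by (simp add: mult_ac)
  qed auto
qed

text \<open>Banach's fixed point theorem for the unknown \<open>w = exp (- c * x) * u\<close>: the
  plain supremum distance of \<open>w\<close> is the weighted distance of \<open>u\<close>, so the
  operator contracts with factor 1/2. The type of bounded continuous functions lives on the whole
  line, hence the clamp \<open>cl\<close> onto \<open>[0,1]\<close>.\<close>

lemma volterra_exists: "\<exists>u. volterra K d 1 u"
proof -
  obtain c where c: "c > 0" and C: "halving_rate K c" using halving_rate_exists by blast
  define cl :: "real \<Rightarrow> real" where "cl t = max 0 (min 1 t)" for t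
  have cl: "cl t \<in> {0..1}" for t by (auto simp: cl_def)
  have clc: "continuous_on UNIV cl" unfolding cl_def by (intro continuous_intros)
  have cl_id: "cl t = t" if "t \<in> {0..1}" for t using that by (auto simp: cl_def)
  define un where "un w x = exp (c * x) * apply_bcontfun w x" for w :: "real \<Rightarrow>\<^sub>C real" and x :: real
  have un_cont: "continuous_on A (un w)" for w A
    unfolding un_def
    by (intro continuous_intros continuous_on_subset[OF continuous_on_apply_bcontfun subset_UNIV])
  let ?P = "\<lambda>w. pot n (src K (un w))"
  define R where "R w s = exp (- c * s) * (d - ?P w s)" for w s
  have Rc: "continuous_on {0..1} (R w)" for w
    unfolding R_def by (intro continuous_intros pot_continuous q_cont f_trunc_continuous un_cont)
  define T where "T w = Bcontfun (\<lambda>t. R w (cl t))" for w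
  have R_bc: "(\<lambda>t. R w (cl t)) \<in> bcontfun" for w
  proof -
    have "continuous_on UNIV (R w \<circ> cl)"
      by (rule continuous_on_compose[OF clc], rule continuous_on_subset[OF Rc]) (use cl in auto)
    moreover have "bounded (R w ` {0..1})"
      using compact_continuous_image[OF Rc] compact_imp_bounded by blast
    then have "bounded (range (\<lambda>t. R w (cl t)))"
      by (rule bounded_subset) (use cl in auto)
    ultimately show ?thesis by (simp add: bcontfun_def o_def)
  qed
  have T: "apply_bcontfun (T w) t = R w (cl t)" for w t
    unfolding T_def using Bcontfun_inverse[OF R_bc] by metis
  have "\<exists>!w. T w = w"
  proof (rule banach_fix_type)
    show "\<forall>w. \<forall>z. dist (T w) (T z) \<le> (1/2) * dist w z"
    proof (intro allI dist_bound)
      fix w z t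
      let ?s = "cl t"
      have "\<bar>?P w ?s - ?P z ?s\<bar> \<le> dist w z / 2 * exp (c * ?s)"
      proof (rule halving_rateD[OF C, of 1])
        fix s :: real
        have "\<bar>un w s - un z s\<bar> = exp (c * s) * dist (apply_bcontfun w s) (apply_bcontfun z s)"
          by (simp add: un_def dist_real_def right_diff_distrib[symmetric] abs_mult)
        also have "\<dots> \<le> exp (c * s) * dist w z" by (intro mult_left_mono dist_bounded) auto
        finally show "\<bar>un w s - un z s\<bar> \<le> dist w z * exp (c * s)" by (simp add: mult.commute)
      qed (use un_cont cl in auto)
      then have "exp (- c * ?s) * \<bar>?P w ?s - ?P z ?s\<bar> \<le> exp (- c * ?s) * (dist w z / 2 * exp (c * ?s))"
        by (rule mult_left_mono) auto
      also have "\<dots> = (exp (- c * ?s) * exp (c * ?s)) * (dist w z / 2)" by (simp add: mult_ac)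
      also have "\<dots> = dist w z / 2" by (simp add: mult_exp_exp)
      also have "exp (- c * ?s) * \<bar>?P w ?s - ?P z ?s\<bar> = \<bar>exp (- c * ?s) * (?P w ?s - ?P z ?s)\<bar>"
        by (simp add: abs_mult)
      also have "exp (- c * ?s) * (?P w ?s - ?P z ?s) = R z ?s - R w ?s"
        by (simp add: R_def algebra_simps)
      finally show "dist (apply_bcontfun (T w) t) (apply_bcontfun (T z) t) \<le> 1 / 2 * dist w z"
        by (simp add: T dist_real_def abs_minus_commute)
    qed
  qed auto
  then obtain w where w: "T w = w" by blast
  have "volterra K d 1 (un w)"
    unfolding volterra_def
  proof (intro conjI un_cont ballI)
    fix s :: real assume s: "s \<in> {0..1}"
    have "apply_bcontfun w s = R w s" using T[of w s] w cl_id[OF s] by simp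
    then have "un w s = exp (c * s) * (exp (- c * s) * (d - ?P w s))" by (simp add: un_def R_def)
    then show "un w s = d - ?P w s" by (simp add: mult.assoc[symmetric] mult_exp_exp)
  qed
  then show ?thesis by blast
qed

section \<open>From truncated to genuine solutions\<close>

definition truncated :: "real \<Rightarrow> real \<Rightarrow> real \<Rightarrow> real" where
  "truncated K d = (SOME u. volterra K d 1 u)"

lemma volterra_truncated: "volterra K d 1 (truncated K d)"
  unfolding truncated_def using volterra_exists by (rule someI_ex)

lemma volterra_subset: "volterra K d t u \<Longrightarrow> s \<le> t \<Longrightarrow> volterra K d s u"
  by (auto simp: volterra_def elim: continuous_on_subset)

lemma volterra_change_level:
  assumes "volterra K d t u" "\<And>s. s \<in> {0..t} \<Longrightarrow> u s \<le> K" "\<And>s. s \<in> {0..t} \<Longrightarrow> u s \<le> M"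
  shows "volterra M d t u"
proof -
  have "pot n (src K u) s = pot n (src M u) s" if "s \<in> {0..t}" for s
    by (rule pot_cong) (use assms that in \<open>auto simp: min_absorb1\<close>)
  then show ?thesis using assms by (auto simp: volterra_def)
qed

lemma volterra_unique:
  assumes "volterra K d t u" "volterra K d t v" "t \<le> 1" "s \<in> {0..t}"
  shows "u s = v s"
  using volterra_dependence[of K] assms by fastforce

text \<open>\<open>existing t\<close> is the set of data \<open>d\<close> whose untruncated solution \<open>U d\<close> exists on \<open>[0, t]\<close>: a truncated
  solution that stays below its level solves the original problem. Outside this set \<open>U d t\<close> is junk.\<close>

definition existing :: "real \<Rightarrow> real set" where
  "existing t = {d. \<exists>K. \<forall>s\<in>{0..t}. truncated K d s < K}"

definition U :: "real \<Rightarrow> real \<Rightarrow> real" where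
  "U d t = truncated (SOME K. \<forall>s\<in>{0..t}. truncated K d s < K) d t"

definition Y :: "real \<Rightarrow> real \<Rightarrow> real" where
  "Y d t = - flux n (\<lambda>x. q x * f (U d x)) t"

text \<open>The level picked in \<open>U d s\<close> varies with \<open>s\<close>. Two admissible
  levels give solutions of one equation at the larger level, which coincide by uniqueness; so the
  values \<open>U d s\<close> fit together to a single function.\<close>

lemma U_eq_truncated:
  assumes K: "\<And>s. s \<in> {0..t} \<Longrightarrow> truncated K d s < K" and t: "t \<le> 1" and s: "s \<in> {0..t}"
  shows "U d s = truncated K d s"
proof -
  let ?P = "\<lambda>K. \<forall>r\<in>{0..s}. truncated K d r < K"
  define M where "M = (SOME K. ?P K)"
  have "?P K" using K s by auto
  then have M: "?P M" unfolding M_def by (rule someI)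
  have "volterra (max K M) d s (truncated K d)" "volterra (max K M) d s (truncated M d)"
    by (rule volterra_change_level[OF volterra_subset[OF volterra_truncated]]; use K M s t in force)+
  then have "truncated K d s = truncated M d s"
    by (rule volterra_unique) (use s t in auto)
  then show ?thesis by (simp add: U_def M_def)
qed

lemma existing_mono: "d \<in> existing t \<Longrightarrow> s \<le> t \<Longrightarrow> d \<in> existing s"
  unfolding existing_def by force

text \<open>A continuous solution on a compact interval is bounded, so a cut-off above its bound
  does not touch it. This is how explicitly known solutions, the zero one and the Dirichlet profile,
  are identified with \<open>U d\<close>.\<close>

lemma existingI:
  assumes u: "continuous_on {0..t} u" and eq: "\<And>s. s \<in> {0..t} \<Longrightarrow> u s = d - pot n (\<lambda>x. q x * f (u x)) s"
    and t: "t \<le> 1"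
  shows "d \<in> existing t" "s \<in> {0..t} \<Longrightarrow> U d s = u s"
proof -
  obtain B where B: "\<And>x. x \<in> {0..t} \<Longrightarrow> \<bar>u x\<bar> \<le> B"
    using continuous_on_bounded_Icc[OF u] by metis
  have "volterra (B+1) d t u" unfolding volterra_def
  proof (intro conjI u ballI)
    fix s assume s: "s \<in> {0..t}"
    have "pot n (\<lambda>x. q x * f (u x)) s = pot n (\<lambda>x. q x * f (min (u x) (B + 1))) s"
    proof (rule pot_cong)
      fix x assume "x \<in> {0..s}"
      then show "q x * f (u x) = q x * f (min (u x) (B + 1))"
        using B[of x] s by (simp add: min_absorb1)
    qed
    then show "u s = d - pot n (\<lambda>x. q x * f (min (u x) (B + 1))) s" using eq[OF s] by simp
  qed
  then have e: "truncated (B+1) d s = u s" if "s \<in> {0..t}" for s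
    using volterra_unique[OF volterra_subset[OF volterra_truncated t]] t that by blast
  then have l: "truncated (B+1) d s < B+1" if "s \<in> {0..t}" for s using B that by force
  then show "d \<in> existing t" unfolding existing_def by blast
  show "U d s = u s" if "s \<in> {0..t}" using U_eq_truncated[OF l t that] e[OF that] by simp
qed

lemma existing_volterra:
  assumes d: "d \<in> existing t" and t: "t \<le> 1"
  obtains K where "volterra K d t (U d)" "\<And>s. s \<in> {0..t} \<Longrightarrow> U d s = truncated K d s"
    "\<And>s. s \<in> {0..t} \<Longrightarrow> U d s < K"
proof -
  obtain K where K: "\<And>s. s \<in> {0..t} \<Longrightarrow> truncated K d s < K"
    using d unfolding existing_def by blast
  have e: "U d s = truncated K d s" if "s \<in> {0..t}" for s by (rule U_eq_truncated[OF K t that])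
  have "volterra K d t (truncated K d)" using volterra_subset[OF volterra_truncated t] .
  moreover have "pot n (\<lambda>x. q x * f (min (truncated K d x) K)) s = pot n (\<lambda>x. q x * f (min (U d x) K)) s"
    if "s \<in> {0..t}" for s by (rule pot_cong) (use e that in auto)
  ultimately have "volterra K d t (U d)"
    unfolding volterra_def using e by (auto cong: continuous_on_cong_simp)
  then show ?thesis using that e K by metis
qed

lemma U_continuous: "d \<in> existing t \<Longrightarrow> t \<le> 1 \<Longrightarrow> continuous_on {0..t} (U d)"
  by (erule existing_volterra) (auto simp: volterra_def)

lemma U_eq:
  assumes d: "d \<in> existing t" and t: "t \<le> 1" and s: "s \<in> {0..t}"
  shows "U d s = d - pot n (\<lambda>x. q x * f (U d x)) s"
proof -
  obtain K where K: "volterra K d t (U d)" "\<And>s. s \<in> {0..t} \<Longrightarrow> U d s < K"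
    using existing_volterra[OF d t] by metis
  have "pot n (\<lambda>x. q x * f (min (U d x) K)) s = pot n (\<lambda>x. q x * f (U d x)) s"
    by (rule pot_cong) (use K(2) s in \<open>auto simp: min_absorb1 less_imp_le\<close>)
  then show ?thesis using K(1) s by (auto simp: volterra_def)
qed

lemma U_0: "d \<in> existing t \<Longrightarrow> t \<in> {0..1} \<Longrightarrow> U d 0 = d"
  using U_eq[of d t 0] by simp

lemma Y_0 [simp]: "Y d 0 = 0" by (simp add: Y_def)

lemma source_continuous:
  assumes d: "d \<in> existing t" and t: "t \<le> 1"
  shows "continuous_on {0..t} (\<lambda>x. q x * f (U d x))"
proof (intro continuous_intros)
  show "continuous_on {0..t} q" using q_cont t by (auto elim: continuous_on_subset)
  show "continuous_on {0..t} (\<lambda>x. f (U d x))"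
    using continuous_on_compose[OF U_continuous[OF d t] f_continuous] by (simp add: o_def)
qed

lemma Y_deriv:
  assumes d: "d \<in> existing t" and t: "t \<le> 1" and r: "r \<in> {0..t}"
  shows "(Y d has_real_derivative - (r ^ n * (q r * f (U d r)))) (at r within {0..t})"
  unfolding Y_def by (intro DERIV_minus flux_has_derivative source_continuous[OF d t] r)

lemma U_deriv:
  assumes d: "d \<in> existing t" and t: "t \<le> 1" and r: "r \<in> {0..t}"
  shows "(U d has_real_derivative Y d r / r ^ n) (at r within {0..t})"
proof -
  let ?k = "\<lambda>x. q x * f (U d x)"
  have "((\<lambda>s. d - pot n ?k s) has_real_derivative 0 - flux n ?k r / r ^ n) (at r within {0..t})"
    by (intro DERIV_diff DERIV_const pot_has_derivative source_continuous[OF d t] r)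
  then have "((\<lambda>s. d - pot n ?k s) has_real_derivative Y d r / r ^ n) (at r within {0..t})"
    by (simp add: Y_def)
  then show ?thesis
    by (rule has_field_derivative_transform_within[where d=1]) (use U_eq[OF d t] r in auto)
qed

text \<open>By compactness \<open>U d\<close> stays a positive distance below its level
  \<open>K\<close>; the Lipschitz dependence of truncated solutions keeps nearby data below
  \<open>K\<close> too, and these are then genuine.\<close>

lemma existing_nearby:
  assumes d: "d \<in> existing t" and t: "t \<in> {0..1}" and e: "e > 0"
  shows "\<exists>h>0. \<forall>d'. \<bar>d' - d\<bar> < h \<longrightarrow> d' \<in> existing t \<and> (\<forall>s\<in>{0..t}. \<bar>U d' s - U d s\<bar> < e)"
proof -
  have t1: "t \<le> 1" using t by auto
  obtain K where K: "\<And>s. s \<in> {0..t} \<Longrightarrow> U d s = truncated K d s" "\<And>s. s \<in> {0..t} \<Longrightarrow> U d s < K"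
    "volterra K d t (U d)"
    using existing_volterra[OF d t1] by metis
  have "\<exists>x\<in>{0..t}. \<forall>y\<in>{0..t}. U d y \<le> U d x"
    by (rule continuous_attains_sup[OF _ _ U_continuous[OF d t1]]) (use t in auto)
  then obtain x where x: "x \<in> {0..t}" "\<And>y. y \<in> {0..t} \<Longrightarrow> U d y \<le> U d x" by blast
  define r where "r = min e (K - U d x)"
  have r: "r > 0" using e K(2)[OF x(1)] by (simp add: r_def)
  obtain C where C: "C > 0" "\<And>t u v d e s. t \<le> 1 \<Longrightarrow> volterra K d t u \<Longrightarrow> volterra K e t v \<Longrightarrow>
     s\<in>{0..t} \<Longrightarrow> \<bar>u s - v s\<bar> \<le> C * \<bar>d - e\<bar>" using volterra_dependence[of K] by blast
  show ?thesis
  proof (intro exI[of _ "r / C"] conjI allI impI)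
    show "r / C > 0" using r C by simp
    fix d' assume d': "\<bar>d' - d\<bar> < r / C"
    have cl: "\<bar>truncated K d' s - U d s\<bar> < r" if "s \<in> {0..t}" for s
    proof -
      have "\<bar>truncated K d' s - U d s\<bar> \<le> C * \<bar>d' - d\<bar>"
        by (rule C(2)[OF t1 volterra_subset[OF volterra_truncated t1] K(3) that])
      also have "\<dots> < r" using d' C by (simp add: field_simps)
      finally show ?thesis .
    qed
    have lt: "truncated K d' s < K" if "s \<in> {0..t}" for s
      using cl[OF that] x(2)[OF that] unfolding r_def by linarith
    then show "d' \<in> existing t" unfolding existing_def by blast
    show "\<forall>s\<in>{0..t}. \<bar>U d' s - U d s\<bar> < e"
      using U_eq_truncated[OF lt t1] cl by (auto simp: r_def)
  qed
qed

text \<open>A datum without solution up to \<open>t\<close> has, for every level, a truncated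
  solution that reaches it. Up to the first time when \<open>K\<close> is reached the cut-off is
  inactive, so there the genuine solution takes the value \<open>K\<close>.\<close>

lemma blowup_reaches:
  assumes d: "d \<notin> existing t" and t: "t \<in> {0..1}" and K: "K > d"
  shows "\<exists>s\<in>{0..t}. d \<in> existing s \<and> U d s = K"
proof -
  let ?u = "truncated K d"
  have v: "volterra K d t ?u" using volterra_subset[OF volterra_truncated] t by auto
  then have uc: "continuous_on {0..t} ?u" by (simp add: volterra_def)
  have u0: "?u 0 = d" using v t by (auto simp: volterra_def)
  obtain s0 where s0: "s0 \<in> {0..t}" "?u s0 \<ge> K" using d by (force simp: existing_def not_less)
  define A where "A = {0..t} \<inter> ?u -` {K..}"
  have "closed A" unfolding A_def by (intro continuous_closed_preimage uc) auto
  then have cA: "compact A" using compact_Int_closed[of "{0..t}" A] by (auto simp: A_def Int_assoc[symmetric])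
  have "A \<noteq> {}" using s0 by (auto simp: A_def)
  from compact_attains_inf[OF cA this] obtain s where s: "s \<in> A" "\<And>r. r \<in> A \<Longrightarrow> s \<le> r" by blast
  have sK: "?u s \<ge> K" "s \<in> {0..t}" using s by (auto simp: A_def)
  have lt: "?u r < K" if "r \<in> {0..<s}" for r using s(2)[of r] that sK by (force simp: A_def)
  have eqK: "?u s = K"
  proof -
    have "\<exists>x\<ge>0. x \<le> s \<and> ?u x = K"
      by (rule IVT') (use u0 K sK uc in \<open>auto elim: continuous_on_subset\<close>)
    then obtain x where "0 \<le> x" "x \<le> s" "?u x = K" by blast
    then show ?thesis using lt[of x] by (cases "x = s") auto
  qed
  have le: "?u r \<le> K" if "r \<in> {0..s}" for r using lt[of r] eqK that by (cases "r = s") auto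
  have s1: "s \<le> 1" using sK t by auto
  \<comment> \<open>The value \<open>K\<close> is attained at \<open>s\<close>, while
    \<open>existing\<close> demands a strict inequality; the level is therefore raised by
    one.\<close>
  have "volterra (K + 1) d s ?u"
    by (rule volterra_change_level[OF volterra_subset[OF v]]) (use le sK in force)+
  then have e: "truncated (K+1) d r = ?u r" if "r \<in> {0..s}" for r
    using volterra_unique[OF volterra_subset[OF volterra_truncated s1]] s1 that by blast
  then have l: "truncated (K+1) d r < K+1" if "r \<in> {0..s}" for r using le[OF that] that by auto
  then have "d \<in> existing s" unfolding existing_def by blast
  moreover have "U d s = K" using U_eq_truncated[OF l s1, of s] e[of s] eqK sK by auto
  ultimately show ?thesis using sK by blast
qed

end

section \<open>Absorption and the Keller--Osserman condition\<close>

lemma deriv_ge_imp_diff_ge: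
  fixes \<phi> :: "real \<Rightarrow> real"
  assumes ab: "a \<le> b"
    and d: "\<And>x. x \<in> {a..b} \<Longrightarrow> (\<phi> has_real_derivative \<phi>' x) (at x within {a..b})"
    and c: "\<And>x. x \<in> {a<..<b} \<Longrightarrow> c \<le> \<phi>' x"
  shows "c * (b - a) \<le> \<phi> b - \<phi> a"
proof (cases "a = b")
  case False
  with ab have ab: "a < b" by simp
  have "\<exists>x\<in>{a<..<b}. \<phi> b - \<phi> a = (*) (\<phi>' x) (b - a)"
    by (rule mvt_simple[OF ab]) (use d in \<open>simp add: has_field_derivative_def\<close>)
  then show ?thesis using c ab by (auto intro!: mult_right_mono)
qed auto

lemma deriv_le_imp_diff_le:
  fixes \<phi> :: "real \<Rightarrow> real"
  assumes ab: "a \<le> b"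
    and d: "\<And>x. x \<in> {a..b} \<Longrightarrow> (\<phi> has_real_derivative \<phi>' x) (at x within {a..b})"
    and c: "\<And>x. x \<in> {a<..<b} \<Longrightarrow> \<phi>' x \<le> c"
  shows "\<phi> b - \<phi> a \<le> c * (b - a)"
  using deriv_ge_imp_diff_ge[OF ab, of "\<lambda>x. - \<phi> x" "\<lambda>x. - \<phi>' x" "- c"] d c
  by (force intro: DERIV_minus)

text \<open>The point where \<open>a\<close> is positive may be an end point; the subinterval is
  placed next to it on the side where there is room. Strict inclusion at both ends leaves the
  margins that \<open>a_priori_bound\<close> needs.\<close>

lemma continuous_pos_subinterval:
  fixes a :: "real \<Rightarrow> real"
  assumes ac: "continuous_on {x..z} a" and xz: "x < z"
    and a0: "\<And>r. r \<in> {x..z} \<Longrightarrow> a r \<ge> 0" and ex: "\<exists>r\<in>{x..z}. a r \<noteq> 0"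
  obtains p p' \<eta> where "x < p" "p < p'" "p' < z" "\<eta> > 0" "\<And>r. r \<in> {p..p'} \<Longrightarrow> a r \<ge> \<eta>"
proof -
  obtain r0 where r0: "r0 \<in> {x..z}" "a r0 > 0" using a0 ex by force
  from ac[unfolded continuous_on_iff] r0 obtain e where e: "e > 0"
    "\<And>r. r \<in> {x..z} \<Longrightarrow> dist r r0 < e \<Longrightarrow> dist (a r) (a r0) < a r0 / 2" by (metis half_gt_zero)
  have near: "a r \<ge> a r0 / 2" if "r \<in> {x..z}" "\<bar>r - r0\<bar> < e" for r
    using e(2)[of r] that unfolding dist_real_def by linarith
  show ?thesis
  proof (cases "r0 < z")
    case True
    define h where "h = min e (z - r0) / 4"
    have h: "h > 0" "4 * h \<le> e" "4 * h \<le> z - r0" using e True by (auto simp: h_def)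
    show ?thesis
      by (rule that[of "r0 + h" "r0 + 2 * h" "a r0 / 2"]) (use h r0 near in auto)
  next
    case False
    define h where "h = min e (z - x) / 4"
    have h: "h > 0" "4 * h \<le> e" "4 * h \<le> z - x" using e xz by (auto simp: h_def)
    show ?thesis
      by (rule that[of "z - 2 * h" "z - h" "a r0 / 2"]) (use h r0 near False in auto)
  qed
qed

text \<open>Here \<open>y\<close> is the flux \<open>r^n u'\<close>. The system mentions no initial
  datum, so the estimates built on it hold on any interval and with constants common to all
  solutions.\<close>

definition ode_on :: "nat \<Rightarrow> (real \<Rightarrow> real) \<Rightarrow> (real \<Rightarrow> real) \<Rightarrow> real \<Rightarrow> real \<Rightarrow>
    (real \<Rightarrow> real) \<Rightarrow> (real \<Rightarrow> real) \<Rightarrow> bool" where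
  "ode_on n q f a b u y \<longleftrightarrow> (\<forall>r\<in>{a..b}.
     (u has_real_derivative y r / r ^ n) (at r within {a..b}) \<and>
     (y has_real_derivative - (r ^ n * (q r * f (u r)))) (at r within {a..b}))"

lemma ode_on_subset:
  assumes "ode_on n q f a b u y" "a \<le> c" "d \<le> b"
  shows "ode_on n q f c d u y"
  unfolding ode_on_def
proof
  fix r assume "r \<in> {c..d}"
  moreover have "{c..d} \<subseteq> {a..b}" using assms by auto
  ultimately show "(u has_real_derivative y r / r ^ n) (at r within {c..d}) \<and>
     (y has_real_derivative - (r ^ n * (q r * f (u r)))) (at r within {c..d})"
    using assms(1) unfolding ode_on_def by (meson DERIV_subset subsetD)
qed

lemma ode_on_cong:
  assumes "ode_on n q f a b u y" "\<And>r. r \<in> {a..b} \<Longrightarrow> q r = p r"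
  shows "ode_on n p f a b u y"
  using assms by (simp add: ode_on_def)

lemma ode_on_continuous:
  assumes "ode_on n q f a b u y"
  shows "continuous_on {a..b} u" "continuous_on {a..b} y"
  using assms unfolding ode_on_def continuous_on_eq_continuous_within by (blast intro: DERIV_continuous)+

text \<open>The slope is bounded only at interior points, which spares \<open>r = 0\<close>, where
  \<open>y r / r ^ n\<close> need not be meaningful.\<close>

lemma ode_u_ge:
  assumes o: "ode_on n q f a b u y" and r: "a \<le> r" "r \<le> s" "s \<le> b"
    and c: "\<And>x. x \<in> {r<..<s} \<Longrightarrow> c \<le> y x / x ^ n"
  shows "c * (s - r) \<le> u s - u r"
  by (rule deriv_ge_imp_diff_ge[OF r(2) _ c])
     (use ode_on_subset[OF o r(1,3)] in \<open>auto simp: ode_on_def\<close>)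

lemma ode_u_le:
  assumes o: "ode_on n q f a b u y" and r: "a \<le> r" "r \<le> s" "s \<le> b"
    and c: "\<And>x. x \<in> {r<..<s} \<Longrightarrow> y x / x ^ n \<le> c"
  shows "u s - u r \<le> c * (s - r)"
  by (rule deriv_le_imp_diff_le[OF r(2) _ c])
     (use ode_on_subset[OF o r(1,3)] in \<open>auto simp: ode_on_def\<close>)

lemma ode_y_ge:
  assumes o: "ode_on n q f a b u y" and r: "a \<le> r" "r \<le> s" "s \<le> b"
    and c: "\<And>x. x \<in> {r<..<s} \<Longrightarrow> c \<le> - (x ^ n * (q x * f (u x)))"
  shows "c * (s - r) \<le> y s - y r"
  by (rule deriv_ge_imp_diff_ge[OF r(2) _ c])
     (use ode_on_subset[OF o r(1,3)] in \<open>auto simp: ode_on_def\<close>)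

lemma ode_y_le:
  assumes o: "ode_on n q f a b u y" and r: "a \<le> r" "r \<le> s" "s \<le> b"
    and c: "\<And>x. x \<in> {r<..<s} \<Longrightarrow> - (x ^ n * (q x * f (u x))) \<le> c"
  shows "y s - y r \<le> c * (s - r)"
  by (rule deriv_le_imp_diff_le[OF r(2) _ c])
     (use ode_on_subset[OF o r(1,3)] in \<open>auto simp: ode_on_def\<close>)

lemma div_power_ge:
  fixes y c x :: real
  assumes "c \<le> y" "0 \<le> c" "0 < x" "x \<le> 1"
  shows "c \<le> y / x ^ n"
proof -
  have "c * x ^ n \<le> c * 1" using assms by (intro mult_left_mono power_le_one) auto
  then show ?thesis using assms by (simp add: pos_le_divide_eq)
qed

lemma div_power_le:
  fixes y c x :: real
  assumes "y \<le> c" "c \<le> 0" "0 < x" "x \<le> 1"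
  shows "y / x ^ n \<le> c"
  using div_power_ge[of "- c" "- y" x n] assms by simp

section \<open>Growth of the nonlinearity and the Keller--Osserman estimate\<close>

locale superlinear =
  fixes n :: nat and f :: "real \<Rightarrow> real"
  assumes f_nonpos: "\<And>x. x \<le> 0 \<Longrightarrow> f x = 0"
    and f_pos: "\<And>x. x > 0 \<Longrightarrow> f x > 0"
    and f_cont: "continuous_on UNIV f"
    and f_lim_0: "((\<lambda>u. f u / u) \<longlongrightarrow> 0) (at_right 0)"
    and f_lim_inf: "filterlim (\<lambda>u. f u / u) at_top at_top"
    and f_ko: "((\<lambda>u. \<integral>\<^sup>+ \<xi>\<in>{u<..}. ennreal (1 / sqrt (integral {0..\<xi>} f - integral {0..u} f)) \<partial>lborel)
         \<longlongrightarrow> 0) at_top"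
begin

lemma f_nonneg: "f x \<ge> 0"
  using f_nonpos[of x] f_pos[of x] by (cases "x \<le> 0") auto

lemma f_ge_linear: "\<exists>R>0. \<forall>x\<ge>R. f x \<ge> \<Lambda> * x"
proof -
  from filterlim_at_top[THEN iffD1, OF f_lim_inf, rule_format, of \<Lambda>]
  obtain R where R: "\<And>x. x \<ge> R \<Longrightarrow> f x / x \<ge> \<Lambda>" by (auto simp: eventually_at_top_linorder)
  show ?thesis
  proof (intro exI[of _ "max R 1"] conjI allI impI)
    fix x assume x: "max R 1 \<le> x"
    then show "f x \<ge> \<Lambda> * x" using R[of x] by (auto simp: pos_le_divide_eq)
  qed auto
qed

lemma f_lower_bound:
  assumes "\<delta> > 0"
  shows "\<exists>c>0. \<forall>x\<ge>\<delta>. f x \<ge> c"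
proof -
  obtain R where R: "R > 0" "\<And>x. x \<ge> R \<Longrightarrow> f x \<ge> 1 * x" using f_ge_linear[of 1] by blast
  have "\<exists>x\<in>{\<delta>..max R \<delta>}. \<forall>y\<in>{\<delta>..max R \<delta>}. f x \<le> f y"
    by (rule continuous_attains_inf) (auto intro: continuous_on_subset[OF f_cont])
  then obtain x where x: "x \<ge> \<delta>" "\<And>y. y \<in> {\<delta>..max R \<delta>} \<Longrightarrow> f x \<le> f y" by auto
  show ?thesis
  proof (intro exI[of _ "min (f x) R"] conjI allI impI)
    show "min (f x) R > 0" using f_pos[of x] x(1) assms R by auto
    fix y assume "y \<ge> \<delta>"
    then show "f y \<ge> min (f x) R" using x(2)[of y] R(2)[of y] by (cases "y \<le> max R \<delta>") (auto simp: min_le_iff_disj max_def split: if_splits)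
  qed
qed

lemma f_upper_bound: "\<exists>c>0. \<forall>x\<le>M. f x \<le> c"
proof -
  obtain B where B: "B > 0" "\<And>x. x \<in> {0..M} \<Longrightarrow> \<bar>f x\<bar> \<le> B"
    using continuous_on_bounded_Icc[OF continuous_on_subset[OF f_cont]] by (metis subset_UNIV)
  show ?thesis
  proof (intro exI[of _ B] conjI allI impI B(1))
    fix x assume "x \<le> M"
    then show "f x \<le> B" using B(2)[of x] f_nonpos[of x] B(1) by (cases "x \<le> 0") auto
  qed
qed

lemma f_small:
  assumes "\<kappa> > 0"
  shows "\<exists>\<delta>>0. \<forall>x. 0 \<le> x \<longrightarrow> x \<le> \<delta> \<longrightarrow> f x \<le> \<kappa> * x"
proof -
  have "\<forall>\<^sub>F x in at_right 0. f x / x < \<kappa>"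
    using order_tendstoD(2)[OF f_lim_0] assms by simp
  then obtain b where b: "b > 0" "\<And>x. 0 < x \<Longrightarrow> x < b \<Longrightarrow> f x / x < \<kappa>"
    unfolding eventually_at_right_field by auto
  show ?thesis
  proof (intro exI[of _ "b/2"] conjI allI impI)
    fix x assume x: "0 \<le> x" "x \<le> b / 2"
    show "f x \<le> \<kappa> * x"
    proof (cases "x = 0")
      case True then show ?thesis using f_nonpos[of 0] by simp
    next
      case False
      then have "f x / x < \<kappa>" using b x by auto
      then show ?thesis using False x by (simp add: field_simps)
    qed
  qed (use b in auto)
qed

abbreviation G :: "real \<Rightarrow> real" where "G x \<equiv> integral {0..x} f"

lemma G_deriv:
  assumes "x > 0"
  shows "(G has_real_derivative f x) (at x)"
proof -
  have "(G has_real_derivative f x) (at x within {0..x+1})"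
    unfolding has_real_derivative_iff_has_vector_derivative
    by (rule integral_has_vector_derivative) (use assms in \<open>auto intro: continuous_on_subset[OF f_cont]\<close>)
  then have "(G has_real_derivative f x) (at x within {0<..<x+1})"
    by (rule DERIV_subset) auto
  then show ?thesis using assms at_within_open[of x "{0<..<x+1}"] by simp
qed

lemma G_strict_mono:
  assumes "0 < x" "x < z"
  shows "G x < G z"
proof (rule DERIV_pos_imp_increasing[OF assms(2)])
  fix t assume "x \<le> t" "t \<le> z"
  then have "t > 0" using assms by simp
  then show "\<exists>y. (G has_real_derivative y) (at t) \<and> 0 < y" using G_deriv f_pos by blast
qed

lemma y_mono_of_nonpos:
  assumes o: "ode_on n q f a b u y" and a: "0 \<le> a" and q: "\<And>r. r \<in> {a..b} \<Longrightarrow> q r \<le> 0"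
    and r: "a \<le> r" "r \<le> s" "s \<le> b"
  shows "y r \<le> y s"
proof -
  have "0 * (s - r) \<le> y s - y r"
  proof (rule ode_y_ge[OF o r])
    fix x assume "x \<in> {r<..<s}"
    then have "q x \<le> 0" "x \<ge> 0" using q r a by auto
    then show "0 \<le> - (x ^ n * (q x * f (u x)))"
      using f_nonneg[of "u x"] by (simp add: mult_nonneg_nonpos mult_nonpos_nonneg)
  qed
  then show ?thesis by simp
qed

lemma y_antimono_of_nonneg:
  assumes o: "ode_on n q f a b u y" and a: "0 \<le> a" and q: "\<And>r. r \<in> {a..b} \<Longrightarrow> q r \<ge> 0"
    and r: "a \<le> r" "r \<le> s" "s \<le> b"
  shows "y s \<le> y r"
proof -
  have "y s - y r \<le> 0 * (s - r)"
  proof (rule ode_y_le[OF o r])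
    fix x assume "x \<in> {r<..<s}"
    then have "q x \<ge> 0" "x \<ge> 0" using q r a by auto
    then show "- (x ^ n * (q x * f (u x))) \<le> 0"
      using f_nonneg[of "u x"] by simp
  qed
  then show ?thesis by simp
qed

text \<open>Energy method: with \<open>c = \<eta> * p^(2n)\<close> the quantity
  \<open>y\<^sup>2 / 2 - c * G u\<close> is nondecreasing, hence
  \<open>u' \<ge> y \<ge> sqrt (2 * c * (G u - G (u p)))\<close>. Separating variables bounds the
  length of the interval by the Keller--Osserman integral from \<open>u p\<close>.\<close>

lemma keller_osserman_energy:
  assumes o: "ode_on n q f p p' u y" and p: "0 < p" "p < p'" "p' \<le> 1" and \<eta>: "\<eta> > 0"
    and q: "\<And>r. r \<in> {p..p'} \<Longrightarrow> q r \<le> - \<eta>" and u0: "u p > 0" and y0: "y p \<ge> 0"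
  shows "ennreal (sqrt (2 * (\<eta> * (p ^ n * p ^ n))) * ((p' - p) / 2))
     \<le> (\<integral>\<^sup>+ \<xi>\<in>{u p<..}. ennreal (1 / sqrt (G \<xi> - G (u p))) \<partial>lborel)"
proof -
  define c where "c = \<eta> * (p ^ n * p ^ n)"
  have c: "c > 0" using \<eta> p by (simp add: c_def)
  \<comment> \<open>The integrand \<open>1 / sqrt (G \<xi> - G (u p))\<close> is singular at
    \<open>u p\<close>. Starting at the midpoint, where \<open>u\<close> already exceeds
    \<open>u p\<close>, keeps it continuous and costs only a factor 2.\<close>
  define m where "m = (p + p') / 2"
  have m: "p < m" "m < p'" "p' - m = (p' - p) / 2" using p by (auto simp: m_def field_simps)
  have pn: "p ^ n > 0" using p by simp
  have q0: "q r \<le> 0" if "r \<in> {p..p'}" for r using q[OF that] \<eta> by simp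
  have y_mono: "y r \<le> y s" if "p \<le> r" "r \<le> s" "s \<le> p'" for r s
    by (rule y_mono_of_nonpos[OF o _ q0 that]) (use p in auto)
  have y_nn: "y r \<ge> 0" if "r \<in> {p..p'}" for r using y_mono[of p r] y0 that by auto
  have u_mono: "u r \<le> u s" if "p \<le> r" "r \<le> s" "s \<le> p'" for r s
    using ode_u_ge[OF o that, of 0] y_nn that p by auto
  have u_pos: "u r \<ge> u p" if "r \<in> {p..p'}" for r using u_mono[of p r] that by auto
  have flux: "\<eta> * p ^ n * f (u r) \<le> - (r ^ n * (q r * f (u r)))" if r: "r \<in> {p..p'}" for r
  proof -
    have "p ^ n * \<eta> \<le> r ^ n * (- q r)"
      using q[OF r] r p \<eta> by (intro mult_mono power_mono) auto
    then have "p ^ n * \<eta> * f (u r) \<le> r ^ n * (- q r) * f (u r)"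
      by (rule mult_right_mono) (rule f_nonneg)
    then show ?thesis by (simp add: mult_ac)
  qed
  have energy: "2 * c * (G (u r) - G (u p)) \<le> (y r)\<^sup>2" if r: "r \<in> {p..p'}" for r
  proof -
    let ?E = "\<lambda>r. (y r)\<^sup>2 / 2 - c * G (u r)"
    have "0 * (r - p) \<le> ?E r - ?E p"
    proof (rule deriv_ge_imp_diff_ge)
      fix x assume x: "x \<in> {p..r}"
      have xx: "x \<in> {p..p'}" using x r by auto
      have d: "(u has_real_derivative y x / x ^ n) (at x within {p..r})"
        "(y has_real_derivative - (x ^ n * (q x * f (u x)))) (at x within {p..r})"
        using ode_on_subset[OF o, of p r] r x by (auto simp: ode_on_def)
      have "(G has_real_derivative f (u x)) (at (u x))" using G_deriv u_pos[OF xx] u0 by simp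
      note dG = DERIV_chain2[OF this d(1)]
      show "(?E has_real_derivative y x * (- (x ^ n * (q x * f (u x)))) - c * (f (u x) * (y x / x ^ n)))
        (at x within {p..r})"
        by (rule derivative_eq_intros d dG refl | simp)+
    next
      fix x assume x: "x \<in> {p<..<r}"
      then have xx: "x \<in> {p..p'}" using r by auto
      have xn: "p ^ n \<le> x ^ n" "x ^ n > 0" using x p by (auto intro!: power_mono)
      have "c / x ^ n \<le> \<eta> * p ^ n"
        using xn pn \<eta> by (simp add: c_def pos_divide_le_eq mult_left_mono)
      then have "(c / x ^ n) * f (u x) \<le> \<eta> * p ^ n * f (u x)" by (rule mult_right_mono) (rule f_nonneg)
      also have "\<dots> \<le> - (x ^ n * (q x * f (u x)))" by (rule flux[OF xx])
      finally have "y x * ((c / x ^ n) * f (u x)) \<le> y x * (- (x ^ n * (q x * f (u x))))"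
        by (rule mult_left_mono) (rule y_nn[OF xx])
      then show "0 \<le> y x * (- (x ^ n * (q x * f (u x)))) - c * (f (u x) * (y x / x ^ n))"
        by (simp add: mult_ac)
    qed (use r in auto)
    then have "c * (G (u r) - G (u p)) * 2 \<le> (y r)\<^sup>2 - (y p)\<^sup>2" by (simp add: field_simps)
    then show ?thesis by (simp add: mult_ac) (smt (verit) zero_le_power2)
  qed
  obtain f0 where f0: "f0 > 0" "\<And>x. x \<ge> u p \<Longrightarrow> f x \<ge> f0" using f_lower_bound[OF u0] by blast
  \<comment> \<open>Since \<open>y p = 0\<close> is allowed, the flux is first shown to be positive
    at an intermediate point \<open>r1\<close>, and only then \<open>u\<close> to grow
    strictly.\<close>
  have um: "u p < u m"
  proof -
    define r1 where "r1 = (p + m) / 2"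
    have r1: "p < r1" "r1 < m" using m by (auto simp: r1_def)
    have "\<eta> * p ^ n * f0 * (r1 - p) \<le> y r1 - y p"
    proof (rule ode_y_ge[OF o])
      fix x assume "x \<in> {p<..<r1}"
      then have xx: "x \<in> {p..p'}" using r1 m by auto
      have "\<eta> * p ^ n * f0 \<le> \<eta> * p ^ n * f (u x)"
        using f0(2)[OF u_pos[OF xx]] \<eta> pn by (intro mult_left_mono) auto
      then show "\<eta> * p ^ n * f0 \<le> - (x ^ n * (q x * f (u x)))" using flux[OF xx] by simp
    qed (use r1 m in auto)
    moreover have "\<eta> * p ^ n * f0 * (r1 - p) > 0" using \<eta> pn f0 r1 by simp
    ultimately have y1: "y r1 > 0" using y0 by linarith
    have "y r1 * (m - r1) \<le> u m - u r1"
    proof (rule ode_u_ge[OF o])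
      fix x assume x: "x \<in> {r1<..<m}"
      show "y r1 \<le> y x / x ^ n"
        by (rule div_power_ge) (use x r1 m p y1 y_mono[of r1 x] in auto)
    qed (use r1 m in auto)
    moreover have "y r1 * (m - r1) > 0" using y1 r1 by simp
    ultimately show ?thesis using u_mono[of p r1] r1 m by auto
  qed
  define \<phi> where "\<phi> x = 1 / sqrt (G x - G (u p))" for x
  have Gp: "G x - G (u p) > 0" if "x \<ge> u m" for x using G_strict_mono[OF u0, of x] um that by simp
  have \<phi>c: "continuous_on {u m..u p'} \<phi>"
  proof -
    have "continuous_on {u m..u p'} G"
      by (rule DERIV_continuous_on[where D=f]) (use G_deriv um u0 in \<open>auto intro: has_field_derivative_at_within\<close>)
    then show ?thesis unfolding \<phi>_def by (intro continuous_intros) (use Gp in force)+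
  qed
  have ump: "u m \<le> u p'" using u_mono[of m p'] m by auto
  have img: "u ` {m..p'} \<subseteq> {u m..u p'}" using u_mono m by auto
  define F where "F v = integral {u m..v} \<phi>" for v
  have "sqrt (2 * c) * (p' - m) \<le> F (u p') - F (u m)"
  proof (rule deriv_ge_imp_diff_ge[where \<phi>="\<lambda>r. F (u r)"])
    fix x assume x: "x \<in> {m..p'}"
    have d: "(u has_real_derivative y x / x ^ n) (at x within {m..p'})"
      using ode_on_subset[OF o, of m p'] m x by (auto simp: ode_on_def)
    have "(F has_real_derivative \<phi> (u x)) (at (u x) within {u m..u p'})"
      unfolding F_def has_real_derivative_iff_has_vector_derivative
      by (rule integral_has_vector_derivative[OF \<phi>c]) (use img x in blast)
    then have "(F has_real_derivative \<phi> (u x)) (at (u x) within u ` {m..p'})"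
      using img by (rule DERIV_subset)
    from DERIV_image_chain[OF this d]
    show "((\<lambda>r. F (u r)) has_real_derivative \<phi> (u x) * (y x / x ^ n)) (at x within {m..p'})"
      by (simp add: o_def)
  next
    fix x assume x: "x \<in> {m<..<p'}"
    then have xx: "x \<in> {p..p'}" using m by auto
    have gp: "G (u x) - G (u p) > 0" using Gp u_mono[of m x] x m by auto
    have "sqrt (2 * c * (G (u x) - G (u p))) \<le> y x"
      using energy[OF xx] y_nn[OF xx] by (simp add: real_le_lsqrt)
    also have "y x \<le> y x / x ^ n" by (rule div_power_ge) (use xx p y_nn[OF xx] in auto)
    finally have "sqrt (2 * c) * sqrt (G (u x) - G (u p)) \<le> y x / x ^ n"
      by (simp add: real_sqrt_mult)
    then have "sqrt (2 * c) \<le> (y x / x ^ n) / sqrt (G (u x) - G (u p))"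
      using gp by (subst pos_le_divide_eq) auto
    then show "sqrt (2 * c) \<le> \<phi> (u x) * (y x / x ^ n)"
      unfolding \<phi>_def by (simp add: mult.commute)
  qed (use m in auto)
  then have F: "sqrt (2 * c) * ((p' - p) / 2) \<le> integral {u m..u p'} \<phi>"
    using m by (simp add: F_def)
  have "\<phi> integrable_on {u m..u p'}" by (rule integrable_continuous_real[OF \<phi>c])
  then have hi: "(\<phi> has_integral integral {u m..u p'} \<phi>) {u m..u p'}" by (rule integrable_integral)
  have "ennreal (sqrt (2 * c) * ((p' - p) / 2)) \<le> ennreal (integral {u m..u p'} \<phi>)"
    using F by (rule ennreal_leI)
  also have "\<dots> = (\<integral>\<^sup>+ x\<in>{u m..u p'}. ennreal (\<phi> x) \<partial>lborel)"
    by (rule nn_integral_has_integral_lebesgue'[OF _ hi, symmetric]) (use Gp in \<open>force simp: \<phi>_def\<close>)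
  also have "\<dots> \<le> (\<integral>\<^sup>+ \<xi>\<in>{u p<..}. ennreal (\<phi> \<xi>) \<partial>lborel)"
    by (rule nn_integral_mono) (use um in \<open>auto simp: indicator_def\<close>)
  finally show ?thesis by (simp add: \<phi>_def c_def)
qed

text \<open>Read in contrapositive form: a solution that is large at \<open>p\<close> with
  nonnegative flux cannot live up to \<open>p'\<close>, because the integral in
  \<open>keller_osserman_energy\<close> tends to 0. The weight enters only through
  \<open>q \<le> - \<eta>\<close>, so one \<open>K\<close> serves all \<mu> at once.\<close>

lemma keller_osserman_blowup:
  assumes p: "0 < p" "p < p'" "p' \<le> 1" and \<eta>: "\<eta> > 0"
  shows "\<exists>K>0. \<forall>q u y. ode_on n q f p p' u y \<longrightarrow> (\<forall>r\<in>{p..p'}. q r \<le> - \<eta>) \<longrightarrow> u p \<ge> K \<longrightarrow> y p < 0"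
proof -
  let ?I = "\<lambda>u. (\<integral>\<^sup>+ \<xi>\<in>{u<..}. ennreal (1 / sqrt (G \<xi> - G u)) \<partial>lborel)"
  let ?\<epsilon> = "sqrt (2 * (\<eta> * (p ^ n * p ^ n))) * ((p' - p) / 2)"
  have "?\<epsilon> > 0" using p \<eta> by simp
  then have "\<forall>\<^sub>F u in at_top. ?I u < ennreal ?\<epsilon>"
    using order_tendstoD(2)[OF f_ko, of "ennreal ?\<epsilon>"] by simp
  then obtain K where K: "\<And>u. u \<ge> K \<Longrightarrow> ?I u < ennreal ?\<epsilon>"
    by (auto simp: eventually_at_top_linorder)
  show ?thesis
  proof (intro exI[of _ "max K 1"] conjI allI impI)
    fix q u y
    assume *: "ode_on n q f p p' u y" "\<forall>r\<in>{p..p'}. q r \<le> - \<eta>" "max K 1 \<le> u p"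
    show "y p < 0"
    proof (rule ccontr)
      assume "\<not> y p < 0"
      then have "ennreal ?\<epsilon> \<le> ?I (u p)"
        by (intro keller_osserman_energy[OF *(1) p \<eta>]) (use * in auto)
      then show False using K[of "u p"] * by auto
    qed
  qed auto
qed

end

section \<open>A priori bound, absorption and small humps\<close>

lemma first_zero:
  fixes u :: "real \<Rightarrow> real"
  assumes uc: "continuous_on {a..b} u" and ua: "u a > 0" and c: "c \<in> {a..b}" "u c \<le> 0"
  obtains z where "z \<in> {a<..c}" "u z = 0" "\<And>x. x \<in> {a..<z} \<Longrightarrow> u x > 0"
proof -
  define A where "A = {a..b} \<inter> u -` {..0}"
  have "closed A" unfolding A_def by (intro continuous_closed_preimage uc) auto
  moreover have "bounded A" by (rule bounded_subset[of "{a..b}"]) (auto simp: A_def)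
  ultimately have cA: "compact A" by (simp add: compact_eq_bounded_closed)
  have cin: "c \<in> A" using c by (auto simp: A_def)
  then have "A \<noteq> {}" by auto
  from compact_attains_inf[OF cA this] obtain z where z: "z \<in> A" "\<And>r. r \<in> A \<Longrightarrow> z \<le> r" by blast
  have zc: "z \<le> c" using z(2)[OF cin] .
  have z1: "z \<in> {a..b}" "u z \<le> 0" using z(1) by (auto simp: A_def)
  have pos: "u x > 0" if "x \<in> {a..<z}" for x using z(2)[of x] that z1 by (force simp: A_def)
  have za: "z \<noteq> a" using ua z1 by auto
  have "\<exists>x\<ge>a. x \<le> z \<and> u x = 0"
    by (rule IVT2') (use ua z1 uc in \<open>auto elim: continuous_on_subset\<close>)
  then obtain x where x: "a \<le> x" "x \<le> z" "u x = 0" by blast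
  then have "x = z" using pos[of x] by (cases "x = z") auto
  then show ?thesis using that[of z] x za z1 zc pos by auto
qed

context superlinear
begin

text \<open>Concavity in the flux sense keeps \<open>u\<close> above a fixed fraction of its maximum
  on an inner interval \<open>[p,p']\<close>. If the maximum is large, superlinearity makes the flux
  drop there so much that it is steep at \<open>p\<close> or at \<open>p'\<close>; following that
  slope across the margin forces \<open>u\<close> to be nonpositive at \<sigma> or \<tau>.\<close>

lemma a_priori_bound:
  assumes st: "0 < \<sigma>" "\<sigma> < \<tau>" "\<tau> \<le> 1" and ac: "continuous_on {\<sigma>..\<tau>} a"
    and a0: "\<And>r. r \<in> {\<sigma>..\<tau>} \<Longrightarrow> a r \<ge> 0" and ex: "\<exists>r\<in>{\<sigma>..\<tau>}. a r \<noteq> 0"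
  shows "\<exists>M>0. \<forall>u y. ode_on n a f \<sigma> \<tau> u y \<longrightarrow> (\<forall>r\<in>{\<sigma>..\<tau>}. u r > 0) \<longrightarrow> (\<forall>r\<in>{\<sigma>..\<tau>}. u r \<le> M)"
proof -
  obtain p p' \<eta> where p: "\<sigma> < p" "p < p'" "p' < \<tau>" and \<eta>: "\<eta> > 0"
    and a\<eta>: "\<And>r. r \<in> {p..p'} \<Longrightarrow> a r \<ge> \<eta>"
    using continuous_pos_subinterval[OF ac st(2) a0 ex] by blast
  define h where "h = min (\<tau> - p') (p - \<sigma>)"
  have h: "h > 0" "h \<le> \<tau> - p'" "h \<le> p - \<sigma>" using p by (auto simp: h_def)
  define c where "c = 1 + 1 / (\<sigma> ^ n * h)"
  have sn: "\<sigma> ^ n > 0" "p ^ n > 0" using st p by auto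
  have c: "c \<ge> 1" using sn h by (simp add: c_def)
  \<comment> \<open>Chosen so that the drop of the flux over \<open>[p,p']\<close> is exactly
    \<open>2 * D\<close> with \<open>D = u t0 / h\<close>; one of the two end fluxes is then at
    least \<open>D\<close> in absolute value, and \<open>D * h\<close> is the whole maximum.\<close>
  define \<Lambda> where "\<Lambda> = 2 * c / (\<eta> * p ^ n * (p' - p) * h)"
  have \<Lambda>: "\<Lambda> > 0" using c \<eta> sn p h by (simp add: \<Lambda>_def)
  obtain R where R: "R > 0" "\<And>x. x \<ge> R \<Longrightarrow> f x \<ge> \<Lambda> * x" using f_ge_linear[of \<Lambda>] by blast
  show ?thesis
  proof (intro exI[of _ "c * R"] conjI allI impI)
    show "c * R > 0" using c R by simp
    fix u y assume o: "ode_on n a f \<sigma> \<tau> u y" and upos: "\<forall>r\<in>{\<sigma>..\<tau>}. u r > 0"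
    have y_anti: "y s \<le> y r" if "\<sigma> \<le> r" "r \<le> s" "s \<le> \<tau>" for r s
      by (rule y_antimono_of_nonneg[OF o _ a0 that]) (use st in auto)
    have "\<exists>x\<in>{\<sigma>..\<tau>}. \<forall>z\<in>{\<sigma>..\<tau>}. u z \<le> u x"
      by (rule continuous_attains_sup[OF _ _ ode_on_continuous(1)[OF o]]) (use st in auto)
    then obtain t0 where t0: "t0 \<in> {\<sigma>..\<tau>}" and mx: "\<And>z. z \<in> {\<sigma>..\<tau>} \<Longrightarrow> u z \<le> u t0" by blast
    have ut0: "u t0 > 0" using upos t0 by auto
    have slope: "y x / x ^ n \<le> k / \<sigma> ^ n" if "y x \<le> k" "k \<ge> 0" "x \<ge> \<sigma>" for x k
    proof -
      have "y x / x ^ n \<le> k / x ^ n" using that st by (intro divide_right_mono) auto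
      also have "\<dots> \<le> k / \<sigma> ^ n" using that st sn by (intro divide_left_mono power_mono mult_pos_pos) auto
      finally show ?thesis .
    qed
    have slope': "y x / x ^ n \<ge> - k / \<sigma> ^ n" if "y x \<ge> - k" "k \<ge> 0" "x \<ge> \<sigma>" for x k
    proof -
      have "- k / \<sigma> ^ n \<le> - k / x ^ n" using that st sn by (simp, intro divide_left_mono power_mono mult_pos_pos) auto
      also have "\<dots> \<le> y x / x ^ n" using that st by (intro divide_right_mono) auto
      finally show ?thesis .
    qed
    \<comment> \<open>If the flux at \<open>t\<close> shows that \<open>u\<close> does not fall on
      the way to \<open>t\<close>, seen from \<open>t0\<close>, then \<open>u t0 \<le> u t\<close>.
      Otherwise the fall continues beyond \<open>t\<close> up to the far end, where \<open>u\<close>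
      is still positive, so \<open>\<bar>y t\<bar> * h \<le> u t\<close>; back towards
      \<open>t0\<close> the slope is at most \<open>\<bar>y t\<bar> / \<sigma> ^ n\<close>. This is
      the origin of \<open>c\<close>.\<close>
    have concave: "u t0 \<le> c * u t" if t: "t \<in> {p..p'}" for t
    proof -
      have tt: "\<sigma> \<le> t" "t \<le> \<tau>" and ut: "u t > 0" using t p upos by auto
      have fin: ?thesis if k: "0 \<le> k" "k * h \<le> u t" "u t0 \<le> u t + k / \<sigma> ^ n" for k
      proof -
        have "k \<le> u t / h" using k h by (simp add: pos_le_divide_eq)
        then have "k / \<sigma> ^ n \<le> u t / h / \<sigma> ^ n" using sn by (intro divide_right_mono) auto
        then show ?thesis using k(3) by (simp add: c_def algebra_simps)
      qed
      have le1: "k / \<sigma> ^ n * x \<le> k / \<sigma> ^ n" if "0 \<le> k" "x \<le> 1" for k x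
        using mult_left_mono[of x 1 "k / \<sigma> ^ n"] that sn by simp
      have triv: ?thesis if "u t0 \<le> u t" using that mult_right_mono[OF c less_imp_le[OF ut]] by linarith
      show ?thesis
      proof (cases "t0 \<le> t")
        case True
        show ?thesis
        proof (cases "y t \<ge> 0")
          case yt: True
          have "0 * (t - t0) \<le> u t - u t0"
          proof (rule ode_u_ge[OF o])
            fix x assume x: "x \<in> {t0<..<t}"
            then have "y x \<ge> 0" using y_anti[of x t] yt tt t0 by auto
            then show "0 \<le> y x / x ^ n" using x t0 st by simp
          qed (use True t0 tt in auto)
          then show ?thesis using triv by simp
        next
          case yt: False
          have "u \<tau> - u t \<le> y t * (\<tau> - t)"
          proof (rule ode_u_le[OF o])
            fix x assume x: "x \<in> {t<..<\<tau>}"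
            show "y x / x ^ n \<le> y t"
              by (rule div_power_le) (use y_anti[of t x] x yt tt st in auto)
          qed (use tt in auto)
          moreover have "u \<tau> > 0" using upos st by auto
          ultimately have "- y t * (\<tau> - t) \<le> u t" by simp
          moreover have "- y t * h \<le> - y t * (\<tau> - t)" using yt h t by (intro mult_left_mono) auto
          ultimately have 1: "- y t * h \<le> u t" by simp
          have "- (- y t) / \<sigma> ^ n * (t - t0) \<le> u t - u t0"
          proof (rule ode_u_ge[OF o])
            fix x assume x: "x \<in> {t0<..<t}"
            show "- (- y t) / \<sigma> ^ n \<le> y x / x ^ n"
              by (rule slope') (use y_anti[of x t] x yt tt t0 in auto)
          qed (use True t0 tt in auto)
          then have "u t0 \<le> u t + (- y t) / \<sigma> ^ n * (t - t0)" by simp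
          also have "\<dots> \<le> u t + (- y t) / \<sigma> ^ n"
            using le1[of "- y t" "t - t0"] yt t0 tt st by simp
          finally show ?thesis using fin[of "- y t"] 1 yt by simp
        qed
      next
        case False
        show ?thesis
        proof (cases "y t \<le> 0")
          case yt: True
          have "u t0 - u t \<le> 0 * (t0 - t)"
          proof (rule ode_u_le[OF o])
            fix x assume x: "x \<in> {t<..<t0}"
            then have "y x \<le> 0" using y_anti[of t x] yt tt t0 by auto
            then show "y x / x ^ n \<le> 0" using x tt st by (simp add: divide_nonpos_nonneg)
          qed (use False t0 tt in auto)
          then show ?thesis using triv by simp
        next
          case yt: False
          have "y t * (t - \<sigma>) \<le> u t - u \<sigma>"
          proof (rule ode_u_ge[OF o])
            fix x assume x: "x \<in> {\<sigma><..<t}"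
            show "y t \<le> y x / x ^ n"
              by (rule div_power_ge) (use y_anti[of x t] x yt tt st in auto)
          qed (use tt in auto)
          moreover have "u \<sigma> > 0" using upos st by auto
          ultimately have "y t * (t - \<sigma>) \<le> u t" by simp
          moreover have "y t * h \<le> y t * (t - \<sigma>)" using yt h t by (intro mult_left_mono) auto
          ultimately have 1: "y t * h \<le> u t" by simp
          have "u t0 - u t \<le> y t / \<sigma> ^ n * (t0 - t)"
          proof (rule ode_u_le[OF o])
            fix x assume x: "x \<in> {t<..<t0}"
            show "y x / x ^ n \<le> y t / \<sigma> ^ n"
              by (rule slope) (use y_anti[of t x] x yt tt t0 in auto)
          qed (use False t0 tt in auto)
          then have "u t0 \<le> u t + y t / \<sigma> ^ n * (t0 - t)" by simp
          also have "\<dots> \<le> u t + y t / \<sigma> ^ n"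
            using le1[of "y t" "t0 - t"] yt t0 tt st by simp
          finally show ?thesis using fin[of "y t"] 1 yt by simp
        qed
      qed
    qed
    have "u t0 \<le> c * R"
    proof (rule ccontr)
      assume big: "\<not> u t0 \<le> c * R"
      have uR: "u t \<ge> R" "u t \<ge> u t0 / c" if t: "t \<in> {p..p'}" for t
      proof -
        have "c * R < c * u t" using big concave[OF t] by linarith
        then show "u t \<ge> R" using c by simp
        show "u t \<ge> u t0 / c" using concave[OF t] c by (simp add: pos_divide_le_eq mult.commute)
      qed
      define D where "D = u t0 / h"
      have D: "D > 0" using ut0 h by (simp add: D_def)
      have "y p' - y p \<le> - (p ^ n * (\<eta> * (\<Lambda> * (u t0 / c)))) * (p' - p)"
      proof (rule ode_y_le[OF o])
        fix x assume x: "x \<in> {p<..<p'}"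
        have "\<Lambda> * (u t0 / c) \<le> \<Lambda> * u x" using uR(2)[of x] x \<Lambda> by (intro mult_left_mono) auto
        also have "\<dots> \<le> f (u x)" using R(2)[of "u x"] uR(1)[of x] x by auto
        finally have "p ^ n * (\<eta> * (\<Lambda> * (u t0 / c))) \<le> x ^ n * (a x * f (u x))"
          using a\<eta>[of x] x \<eta> \<Lambda> c ut0 st p by (intro mult_mono power_mono) (auto intro!: mult_nonneg_nonneg)
        then show "- (x ^ n * (a x * f (u x))) \<le> - (p ^ n * (\<eta> * (\<Lambda> * (u t0 / c))))" by simp
      qed (use p in auto)
      also have "- (p ^ n * (\<eta> * (\<Lambda> * (u t0 / c)))) * (p' - p) = - 2 * D"
      proof -
        define l where "l = p' - p"
        have "l > 0" using p by (simp add: l_def)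
        then show ?thesis unfolding \<Lambda>_def D_def l_def[symmetric]
          using c \<eta> sn h p(1) st by (simp add: field_simps)
      qed
      finally have "y p \<ge> D \<or> y p' \<le> - D" by linarith
      then show False
      proof
        assume yp: "y p \<ge> D"
        have "D * (p - \<sigma>) \<le> u p - u \<sigma>"
        proof (rule ode_u_ge[OF o])
          fix x assume x: "x \<in> {\<sigma><..<p}"
          show "D \<le> y x / x ^ n"
            by (rule div_power_ge) (use y_anti[of x p] x yp D p st in auto)
        qed (use p in auto)
        moreover have "D * h \<le> D * (p - \<sigma>)" using D h by (intro mult_left_mono) auto
        moreover have "D * h = u t0" using h by (simp add: D_def)
        ultimately show False using mx[of p] upos[rule_format, of \<sigma>] p st by auto
      next
        assume yp: "y p' \<le> - D"
        have "u \<tau> - u p' \<le> - D * (\<tau> - p')"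
        proof (rule ode_u_le[OF o])
          fix x assume x: "x \<in> {p'<..<\<tau>}"
          show "y x / x ^ n \<le> - D"
            by (rule div_power_le) (use y_anti[of p' x] x yp D p st in auto)
        qed (use p in auto)
        moreover have "D * h \<le> D * (\<tau> - p')" using D h by (intro mult_left_mono) auto
        moreover have "D * h = u t0" using h by (simp add: D_def)
        ultimately show False using mx[of p'] upos[rule_format, of \<tau>] p st by auto
      qed
    qed
    then show "\<forall>r\<in>{\<sigma>..\<tau>}. u r \<le> c * R" using mx by fastforce
  qed
qed

text \<open>A region where \<open>- a \<ge> \<eta>\<close> is cut into thirds. If \<open>u\<close>
  stayed above \<delta>, the flux would rise on the first third to \<open>K / h\<close>, then
  \<open>u\<close> on the second to \<open>K\<close>, and on the last the Keller--Osserman estimate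
  would be violated. Of the past only the bound \<open>- C\<close> on the entering flux
  matters.\<close>

lemma absorption_blowup:
  assumes st: "0 < \<tau>" "\<tau> < \<sigma>" "\<sigma> \<le> 1" and ac: "continuous_on {\<tau>..\<sigma>} a"
    and a0: "\<And>r. r \<in> {\<tau>..\<sigma>} \<Longrightarrow> a r \<le> 0" and ex: "\<exists>r\<in>{\<tau>..\<sigma>}. a r \<noteq> 0"
    and \<delta>: "\<delta> > 0" and C: "C \<ge> 0"
  shows "\<exists>\<mu>0>0. \<forall>\<mu>\<ge>\<mu>0. \<forall>u y. ode_on n (\<lambda>r. \<mu> * a r) f \<tau> \<sigma> u y \<longrightarrow> y \<tau> \<ge> - C \<longrightarrow>
           (\<exists>r\<in>{\<tau>..\<sigma>}. u r < \<delta>)"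
proof -
  obtain p p' \<eta> where p: "\<tau> < p" "p < p'" "p' < \<sigma>" and \<eta>: "\<eta> > 0"
    and a\<eta>: "\<And>r. r \<in> {p..p'} \<Longrightarrow> - a r \<ge> \<eta>"
    using continuous_pos_subinterval[OF continuous_on_minus[OF ac] st(2)] a0 ex by auto
  define h where "h = (p' - p) / 3"
  have "3 * h = p' - p" by (simp add: h_def)
  then have h: "h > 0" "p + 3 * h = p'" using p by simp_all
  obtain K where K: "K > 0" "\<And>q u y. ode_on n q f (p + 2 * h) p' u y \<Longrightarrow>
      (\<And>r. r \<in> {p + 2 * h..p'} \<Longrightarrow> q r \<le> - \<eta>) \<Longrightarrow> u (p + 2 * h) \<ge> K \<Longrightarrow> y (p + 2 * h) < 0"
    using keller_osserman_blowup[of "p + 2 * h" p' \<eta>] p h st \<eta> by auto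
  obtain f0 where f0: "f0 > 0" "\<And>x. x \<ge> \<delta> \<Longrightarrow> f x \<ge> f0" using f_lower_bound[OF \<delta>] by blast
  define B where "B = p ^ n * \<eta> * f0 * h"
  have B: "B > 0" using p st \<eta> f0 h by (simp add: B_def)
  \<comment> \<open>The first third contributes at least \<open>\<mu> * B\<close> to the flux, which
    must make up for \<open>- C\<close> and still leave \<open>K / h\<close>. The bound 1 ensures
    \<open>\<mu> * a \<le> - \<eta>\<close>, so that \<open>K\<close> applies to every such
    \<mu>.\<close>
  define \<mu>0 where "\<mu>0 = max 1 ((C + K / h) / B)"
  show ?thesis
  proof (intro exI[of _ \<mu>0] conjI allI impI)
    show "\<mu>0 > 0" by (simp add: \<mu>0_def)
    fix \<mu> u y assume \<mu>: "\<mu>0 \<le> \<mu>" and o: "ode_on n (\<lambda>r. \<mu> * a r) f \<tau> \<sigma> u y" and y\<tau>: "- C \<le> y \<tau>"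
    have \<mu>1: "\<mu> \<ge> 1" and "(C + K / h) / B \<le> \<mu>" using \<mu> by (auto simp: \<mu>0_def)
    then have \<mu>B: "C + K / h \<le> \<mu> * B" using B by (simp add: pos_divide_le_eq)
    show "\<exists>r\<in>{\<tau>..\<sigma>}. u r < \<delta>"
    proof (rule ccontr)
      assume "\<not> ?thesis"
      then have ud: "u r \<ge> \<delta>" if "r \<in> {\<tau>..\<sigma>}" for r using that by force
      have y_mono: "y r \<le> y s" if "\<tau> \<le> r" "r \<le> s" "s \<le> \<sigma>" for r s
        by (rule y_mono_of_nonpos[OF o _ _ that]) (use st a0 \<mu>1 in \<open>auto intro!: mult_nonneg_nonpos\<close>)
      have "\<mu> * (p ^ n * \<eta> * f0) * ((p + h) - p) \<le> y (p + h) - y p"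
      proof (rule ode_y_ge[OF o])
        fix x assume x: "x \<in> {p<..<p + h}"
        have "p ^ n * \<eta> * f0 \<le> x ^ n * (- a x) * f (u x)"
          using x p h st \<eta> f0(1) f0(2)[OF ud[of x]] a\<eta>[of x]
          by (intro mult_mono power_mono) (auto intro!: mult_nonneg_nonpos)
        then have "\<mu> * (p ^ n * \<eta> * f0) \<le> \<mu> * (x ^ n * (- a x) * f (u x))"
          using \<mu>1 by (intro mult_left_mono) auto
        then show "\<mu> * (p ^ n * \<eta> * f0) \<le> - (x ^ n * (\<mu> * a x * f (u x)))" by (simp add: mult_ac)
      qed (use p h in auto)
      moreover have "\<mu> * (p ^ n * \<eta> * f0) * ((p + h) - p) = \<mu> * B" by (simp add: B_def mult_ac)
      moreover have "y p \<ge> - C" using y_mono[of \<tau> p] y\<tau> p by simp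
      ultimately have y1: "y (p + h) \<ge> K / h" using \<mu>B by linarith
      have Kh: "K / h > 0" using K h by simp
      have "K / h * ((p + 2 * h) - (p + h)) \<le> u (p + 2 * h) - u (p + h)"
      proof (rule ode_u_ge[OF o])
        fix x assume x: "x \<in> {p + h<..<p + 2 * h}"
        show "K / h \<le> y x / x ^ n"
          by (rule div_power_ge) (use y_mono[of "p + h" x] y1 Kh x p h st in auto)
      qed (use p h in auto)
      moreover have "K / h * ((p + 2 * h) - (p + h)) = K" using h by simp
      moreover have "u (p + h) \<ge> \<delta>" using ud[of "p + h"] p h by auto
      ultimately have u2: "u (p + 2 * h) \<ge> K" using \<delta> by linarith
      have "y (p + 2 * h) < 0"
      proof (rule K(2)[OF ode_on_subset[OF o] _ u2])
        fix r assume r: "r \<in> {p + 2 * h..p'}"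
        then have "\<eta> \<le> - a r" using a\<eta>[of r] h by auto
        also have "\<dots> \<le> \<mu> * (- a r)" using \<mu>1 \<eta> calculation mult_right_mono[of 1 \<mu> "- a r"] by simp
        finally show "\<mu> * a r \<le> - \<eta>" by simp
      qed (use p h in auto)
      moreover have "y (p + 2 * h) \<ge> y (p + h)" using y_mono[of "p + h" "p + 2 * h"] p h by auto
      ultimately show False using y1 Kh by linarith
    qed
  qed
qed

text \<open>A nonpositive flux at the right end is nonpositive on the whole interval, the flux being
  nondecreasing. So \<open>u\<close> does not increase, and the smallness found somewhere persists
  up to \<sigma>.\<close>

lemma absorption_small:
  assumes st: "0 < \<tau>" "\<tau> < \<sigma>" "\<sigma> \<le> 1" and ac: "continuous_on {\<tau>..\<sigma>} a"
    and a0: "\<And>r. r \<in> {\<tau>..\<sigma>} \<Longrightarrow> a r \<le> 0" and ex: "\<exists>r\<in>{\<tau>..\<sigma>}. a r \<noteq> 0"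
    and \<delta>: "\<delta> > 0" and C: "C \<ge> 0"
  shows "\<exists>\<mu>0>0. \<forall>\<mu>\<ge>\<mu>0. \<forall>u y. ode_on n (\<lambda>r. \<mu> * a r) f \<tau> \<sigma> u y \<longrightarrow> y \<tau> \<ge> - C \<longrightarrow>
           y \<sigma> \<le> 0 \<longrightarrow> u \<sigma> < \<delta>"
proof -
  obtain \<mu>0 where \<mu>0: "\<mu>0 > 0" "\<And>\<mu> u y. \<mu> \<ge> \<mu>0 \<Longrightarrow> ode_on n (\<lambda>r. \<mu> * a r) f \<tau> \<sigma> u y \<Longrightarrow>
     y \<tau> \<ge> - C \<Longrightarrow> \<exists>r\<in>{\<tau>..\<sigma>}. u r < \<delta>"
    using absorption_blowup[OF assms] by blast
  show ?thesis
  proof (intro exI[of _ \<mu>0] conjI allI impI \<mu>0(1))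
    fix \<mu> u y assume \<mu>: "\<mu>0 \<le> \<mu>" and o: "ode_on n (\<lambda>r. \<mu> * a r) f \<tau> \<sigma> u y"
      and y: "- C \<le> y \<tau>" "y \<sigma> \<le> 0"
    obtain r where r: "r \<in> {\<tau>..\<sigma>}" "u r < \<delta>" using \<mu>0(2)[OF \<mu> o y(1)] by blast
    have "u \<sigma> - u r \<le> 0 * (\<sigma> - r)"
    proof (rule ode_u_le[OF o])
      fix x assume x: "x \<in> {r<..<\<sigma>}"
      have "y x \<le> y \<sigma>"
        by (rule y_mono_of_nonpos[OF o]) (use x r st a0 \<mu> \<mu>0 in \<open>auto intro!: mult_nonneg_nonpos\<close>)
      then show "y x / x ^ n \<le> 0" using y x r st by (simp add: divide_nonpos_nonneg)
    qed (use r in auto)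
    then show "u \<sigma> < \<delta>" using r by simp
  qed
qed

text \<open>No sign of the weight is assumed. At the first zero \<open>z\<close> the flux is
  strictly negative: otherwise \<open>f u \<le> u\<close> near 0 would, by a uniqueness argument on
  a short interval, force \<open>u\<close> to vanish before \<open>z\<close>. Afterwards
  \<open>f u = 0\<close> as long as \<open>u < 0\<close>, so the flux keeps its negative value and
  \<open>u\<close> cannot return.\<close>

lemma negative_after_zero:
  assumes o: "ode_on n q f 0 t u y" and t: "t \<le> 1" and Q: "\<And>r. r \<in> {0..t} \<Longrightarrow> \<bar>q r\<bar> \<le> Q"
    and u0: "u 0 > 0" and s: "s \<in> {0..t}" "u s \<le> 0" and r: "r \<in> {s<..t}"
  shows "u r < 0"
proof -
  have uc: "continuous_on {0..t} u" and yc: "continuous_on {0..t} y" using ode_on_continuous[OF o] by auto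
  obtain z where z: "z \<in> {0<..s}" "u z = 0" and pos: "\<And>x. x \<in> {0..<z} \<Longrightarrow> u x > 0"
    using first_zero[OF uc u0 s] by metis
  have zt: "z \<in> {0..t}" using z s by auto
  have Q0: "Q \<ge> 0" using Q[OF s(1)] by linarith
  have yz: "y z < 0"
  proof (rule ccontr)
    assume yz: "\<not> y z < 0"
    obtain \<delta> where \<delta>: "\<delta> > 0" "\<And>x. 0 \<le> x \<Longrightarrow> x \<le> \<delta> \<Longrightarrow> f x \<le> 1 * x" using f_small[of 1] by auto
    obtain k where k: "k > 0" "\<And>x. x \<in> {0..t} \<Longrightarrow> dist x z < k \<Longrightarrow> dist (u x) (u z) < \<delta>"
      using uc[unfolded continuous_on_iff] zt \<delta>(1) by metis
    \<comment> \<open>The condition \<open>Q * h * h < (z / 2) ^ n\<close> makes the integral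
      operator contract on \<open>[z - h, z]\<close>; the bound \<open>z / 2\<close> keeps the
      interval away from the singular origin.\<close>
    define h where "h = Min {k / 2, z / 2, (z / 2) ^ n / (Q + 1), 1}"
    have "h > 0" using k z Q0 by (simp add: h_def)
    moreover have "h \<le> k / 2" "h \<le> z / 2" "h \<le> (z / 2) ^ n / (Q + 1)" "h \<le> 1"
      unfolding h_def by (intro Min_le; simp)+
    ultimately have h: "h > 0" "h < k" "h \<le> z / 2" "h \<le> (z / 2) ^ n / (Q + 1)" "h \<le> 1"
      using k by simp_all
    have small: "Q * h * h < (z / 2) ^ n"
    proof -
      have "Q * h * h \<le> Q * h * 1" using h Q0 by (intro mult_left_mono) auto
      also have "\<dots> < (Q + 1) * h" using h by (simp add: algebra_simps)
      also have "\<dots> \<le> (z / 2) ^ n" using h Q0 by (simp add: pos_le_divide_eq mult.commute)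
      finally show ?thesis .
    qed
    have "\<exists>x\<in>{z - h..z}. \<forall>w\<in>{z - h..z}. u w \<le> u x"
      by (rule continuous_attains_sup[OF _ _ continuous_on_subset[OF uc]]) (use h z zt in auto)
    then obtain x where x: "x \<in> {z - h..z}" and mx: "\<And>w. w \<in> {z - h..z} \<Longrightarrow> u w \<le> u x" by blast
    have ux: "u x > 0" using mx[of "z - h"] pos[of "z - h"] h z by auto
    have flo: "f (u w) \<le> u x" if w: "w \<in> {z - h..z}" for w
    proof -
      have wt: "w \<in> {0..t}" using w h z zt by auto
      have "\<bar>u w\<bar> < \<delta>" using k(2)[OF wt] w h z by (simp add: dist_real_def)
      moreover have "u w \<ge> 0" using pos[of w] w z wt by (cases "w = z") auto
      ultimately have "f (u w) \<le> 1 * u w" using \<delta>(2)[of "u w"] by simp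
      then show ?thesis using mx[OF w] by simp
    qed
    have yl: "y w \<ge> - (Q * u x) * h" if w: "w \<in> {z - h..z}" for w
    proof -
      have "y z - y w \<le> Q * u x * (z - w)"
      proof (rule ode_y_le[OF o])
        fix v assume v: "v \<in> {w<..<z}"
        then have vt: "v \<in> {0..t}" and vh: "v \<in> {z - h..z}" using w h z zt by auto
        have "- (v ^ n * (q v * f (u v))) \<le> \<bar>v ^ n * (q v * f (u v))\<bar>" by linarith
        also have "\<dots> = v ^ n * (\<bar>q v\<bar> * f (u v))" using vt f_nonneg by (simp add: abs_mult)
        also have "\<dots> \<le> 1 * (Q * u x)"
          using vt t flo[OF vh] Q[OF vt] f_nonneg Q0 ux
          by (intro mult_mono power_le_one) (auto intro!: mult_nonneg_nonneg)
        finally show "- (v ^ n * (q v * f (u v))) \<le> Q * u x" by simp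
      qed (use w h z zt in auto)
      also have "\<dots> \<le> Q * u x * h" using w Q0 ux by (intro mult_left_mono) auto
      finally show ?thesis using yz by (simp)
    qed
    have "- (Q * u x * h) / (z / 2) ^ n * (z - x) \<le> u z - u x"
    proof (rule ode_u_ge[OF o])
      fix w assume w: "w \<in> {x<..<z}"
      then have wh: "w \<in> {z - h..z}" using x by auto
      have wz: "w \<ge> z / 2" using wh h by auto
      then have w0: "w > 0" using z by auto
      have "(z / 2) ^ n \<le> w ^ n" using wz z by (intro power_mono) auto
      then have "(Q * u x * h) / w ^ n \<le> (Q * u x * h) / (z / 2) ^ n"
        using w0 z Q0 ux h by (intro divide_left_mono mult_pos_pos) auto
      moreover have "- (Q * u x * h) / w ^ n \<le> y w / w ^ n"
        using yl[OF wh] w0 by (intro divide_right_mono) auto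
      ultimately show "- (Q * u x * h) / (z / 2) ^ n \<le> y w / w ^ n" by simp
    qed (use x h z zt in auto)
    then have "u x \<le> Q * u x * h / (z / 2) ^ n * (z - x)" using z by simp
    also have "\<dots> \<le> Q * u x * h / (z / 2) ^ n * h"
      using x z Q0 ux h by (intro mult_left_mono) auto
    also have "\<dots> = (Q * h * h / (z / 2) ^ n) * u x" by simp
    also have "\<dots> < 1 * u x"
      using small z ux by (intro mult_strict_right_mono) (auto simp: pos_divide_less_eq)
    finally show False by simp
  qed
  obtain k where k: "k > 0" "\<And>x. x \<in> {0..t} \<Longrightarrow> dist x z < k \<Longrightarrow> dist (y x) (y z) < - y z"
    using yc[unfolded continuous_on_iff] zt yz by (metis neg_0_less_iff_less)
  have near: "u x < 0" if x: "z < x" "x < z + k" "x \<le> t" for x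
  proof -
    obtain x' where x': "z < x'" "x' < x" using dense x by blast
    have yneg: "y w < 0" if "w \<in> {z..x}" for w
      using k(2)[of w] that x zt by (auto simp: dist_real_def)
    have "\<exists>v\<in>{z<..<x}. u x - u z = (*) (y v / v ^ n) (x - z)"
    proof (rule mvt_simple[OF x(1)])
      fix v assume "z \<le> v" "v \<le> x"
      then show "(u has_derivative (*) (y v / v ^ n)) (at v within {z..x})"
        using ode_on_subset[OF o, of z x] zt x by (simp add: ode_on_def has_field_derivative_def)
    qed
    then obtain v where v: "v \<in> {z<..<x}" "u x - u z = (y v / v ^ n) * (x - z)" by auto
    have "v > 0" using v z by auto
    then have "y v / v ^ n < 0" using yneg[of v] v by (simp add: divide_neg_pos)
    then show ?thesis using mult_neg_pos[of "y v / v ^ n" "x - z"] v z x by simp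
  qed
  show ?thesis
  proof (rule ccontr)
    assume ur: "\<not> u r < 0"
    have rz: "z < r" "r \<le> t" using r z by auto
    have rk: "r \<ge> z + k" using near[of r] ur rz by (cases "r < z + k") auto
    define x1 where "x1 = z + k / 2"
    have x1: "z < x1" "x1 < z + k" "x1 < r" using k rk by (auto simp: x1_def)
    have ux1: "u x1 < 0" using near[of x1] x1 rz by auto
    have "continuous_on {x1..r} (\<lambda>x. - u x)"
      by (intro continuous_intros continuous_on_subset[OF uc]) (use x1 rz zt in auto)
    from first_zero[OF this, of r] ux1 ur x1 obtain w where
      w: "w \<in> {x1<..r}" "u w = 0" "\<And>x. x \<in> {x1..<w} \<Longrightarrow> u x < 0" by auto
    have neg: "u x < 0" if "x \<in> {z<..<w}" for x
      using near[of x] w(3)[of x] that x1 w(1) rz by (cases "x < x1") auto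
    have yconst: "y x \<le> y z" if "x \<in> {z..w}" for x
    proof -
      have "y x - y z \<le> 0 * (x - z)"
      proof (rule ode_y_le[OF o])
        fix v assume "v \<in> {z<..<x}"
        then have "u v < 0" using neg[of v] that by auto
        then show "- (v ^ n * (q v * f (u v))) \<le> 0" using f_nonpos[of "u v"] by simp
      qed (use that w rz zt in auto)
      then show ?thesis by simp
    qed
    have "u w - u z \<le> y z * (w - z)"
    proof (rule ode_u_le[OF o])
      fix x assume x: "x \<in> {z<..<w}"
      show "y x / x ^ n \<le> y z"
        by (rule div_power_le) (use x yconst[of x] yz zt w rz t in auto)
    qed (use w x1 zt rz in auto)
    moreover have "y z * (w - z) < 0" using yz w x1 by (intro mult_neg_pos) auto
    ultimately show False using w z by simp
  qed
qed

text \<open>Over a hump of height \<open>e\<close> the flux loses at most \<rho> times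
  \<open>e / 4\<close>. The factor \<rho> pays for the later division by \<open>x ^ n\<close>, which
  is at least \<rho> beyond \<tau>. So the slope is everywhere at least \<open>- e / 4\<close>, and
  on a length of at most 1 the solution falls by at most a quarter of its height. Near the origin
  the flux carries its own factor \<open>x ^ n\<close>; this is the first alternative in
  \<open>init\<close>.\<close>

lemma small_hump:
  assumes o: "ode_on n q f \<sigma> b u y" and st: "0 \<le> \<sigma>" "\<sigma> < \<tau>" "\<tau> \<le> b" "b \<le> 1"
    and q1: "\<And>r. r \<in> {\<sigma>..\<tau>} \<Longrightarrow> 0 \<le> q r \<and> q r \<le> A" and q2: "\<And>r. r \<in> {\<tau>..b} \<Longrightarrow> q r \<le> 0"
    and e: "\<And>r. r \<in> {\<sigma>..\<tau>} \<Longrightarrow> u r \<le> e" "e > 0" and fe: "\<And>x. x \<le> e \<Longrightarrow> A * f x \<le> \<rho> * e / 4"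
    and \<rho>: "0 < \<rho>" "\<rho> \<le> \<tau> ^ n" and init: "(\<sigma> = 0 \<and> y 0 = 0) \<or> (y \<sigma> \<ge> 0 \<and> \<rho> \<le> \<sigma> ^ n)"
    and rs: "\<sigma> \<le> r" "r \<le> s" "s \<le> b"
  shows "u s \<ge> u r - e / 4" "y \<tau> \<ge> - e / 4"
proof -
  have \<rho>1: "\<rho> \<le> 1" using \<rho> st power_le_one[of \<tau> n] by linarith
  have flux: "x ^ n * (q x * f (u x)) \<le> x ^ n * (\<rho> * e / 4)" if x: "x \<in> {\<sigma>..\<tau>}" for x
  proof -
    have "q x * f (u x) \<le> A * f (u x)" using q1[OF x] f_nonneg by (intro mult_right_mono) auto
    also have "\<dots> \<le> \<rho> * e / 4" using fe[OF e(1)[OF x]] .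
    finally show ?thesis using x st by (intro mult_left_mono) auto
  qed
  have y1: "y x \<ge> y \<sigma> - x ^ n * (\<rho> * e / 4)" if x: "x \<in> {\<sigma>..\<tau>}" for x
  proof -
    have "- (x ^ n * (\<rho> * e / 4)) * (x - \<sigma>) \<le> y x - y \<sigma>"
    proof (rule ode_y_ge[OF o])
      fix v assume v: "v \<in> {\<sigma><..<x}"
      have "v ^ n * (q v * f (u v)) \<le> v ^ n * (\<rho> * e / 4)" using flux[of v] v x by auto
      also have "\<dots> \<le> x ^ n * (\<rho> * e / 4)" using v st \<rho> e by (intro mult_right_mono power_mono) auto
      finally show "- (x ^ n * (\<rho> * e / 4)) \<le> - (v ^ n * (q v * f (u v)))" by simp
    qed (use x st in auto)
    moreover have "x ^ n * (\<rho> * e / 4) * (x - \<sigma>) \<le> x ^ n * (\<rho> * e / 4) * 1"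
      using x st \<rho> e by (intro mult_left_mono) auto
    ultimately show ?thesis by simp
  qed
  have ys: "y \<sigma> \<ge> 0" using init by auto
  have y_mono: "y v \<le> y w" if "\<tau> \<le> v" "v \<le> w" "w \<le> b" for v w
    by (rule y_mono_of_nonpos[OF ode_on_subset[OF o, of \<tau> b] _ q2]) (use st that in auto)
  have t1: "\<tau> ^ n \<le> 1" using st by (intro power_le_one) auto
  have re: "0 \<le> \<rho> * e / 4" using \<rho> e by simp
  have yt: "y \<tau> \<ge> - (\<rho> * e / 4)"
  proof -
    have "\<tau> ^ n * (\<rho> * e / 4) \<le> 1 * (\<rho> * e / 4)" using t1 re by (rule mult_right_mono)
    then show ?thesis using y1[of \<tau>] ys st by simp
  qed
  have re1: "\<rho> * e / 4 \<le> e / 4" using mult_right_mono[OF \<rho>1, of "e / 4"] e by simp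
  then show "y \<tau> \<ge> - e / 4" using yt by simp
  have slope: "y x / x ^ n \<ge> - (e / 4)" if x: "x \<in> {\<sigma><..<b}" for x
  proof -
    have x0: "x > 0" "x ^ n > 0" "x ^ n \<le> 1" using x st by (auto intro!: power_le_one)
    have big: "- (e / 4) * x ^ n \<le> y x" if "y x \<ge> - (\<rho> * e / 4)" "\<rho> \<le> x ^ n"
    proof -
      have "\<rho> * (e / 4) \<le> x ^ n * (e / 4)" using that e by (intro mult_right_mono) auto
      then show ?thesis using that by (simp add: mult.commute)
    qed
    have "- (e / 4) * x ^ n \<le> y x"
    proof (cases "x \<le> \<tau>")
      case True
      show ?thesis
        using init
      proof
        assume "\<sigma> = 0 \<and> y 0 = 0"
        then have "y x \<ge> - (x ^ n * (\<rho> * e / 4))" using y1[of x] x True by auto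
        moreover have "x ^ n * (\<rho> * e / 4) \<le> x ^ n * (e / 4)" using re1 x0 by (intro mult_left_mono) auto
        ultimately show ?thesis by (simp add: mult.commute)
      next
        assume *: "0 \<le> y \<sigma> \<and> \<rho> \<le> \<sigma> ^ n"
        have "\<sigma> ^ n \<le> x ^ n" using x st by (intro power_mono) auto
        moreover have "x ^ n * (\<rho> * e / 4) \<le> 1 * (\<rho> * e / 4)" using x0 re by (intro mult_right_mono) auto
        ultimately show ?thesis using big y1[of x] x True * by auto
      qed
    next
      case False
      have "\<tau> ^ n \<le> x ^ n" using False st by (intro power_mono) auto
      then show ?thesis using big y_mono[of \<tau> x] yt False x \<rho> by auto
    qed
    then show ?thesis using x0 by (simp add: pos_le_divide_eq)
  qed
  have "- (e / 4) * (s - r) \<le> u s - u r"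
    by (rule ode_u_ge[OF o rs]) (use slope rs in auto)
  moreover have "(e / 4) * (s - r) \<le> (e / 4) * 1" using rs st e by (intro mult_left_mono) auto
  ultimately show "u s \<ge> u r - e / 4" by simp
qed

end

section \<open>Shooting\<close>

lemma open_segment_near:
  fixes p e h :: real
  assumes pe: "p \<noteq> e" and h: "h > 0"
  shows "\<exists>d\<in>open_segment p e. \<bar>d - p\<bar> < h"
proof -
  define v where "v = min (1/2) (h / (2 * \<bar>e - p\<bar>))"
  have v: "0 < v" "v < 1" "v \<le> h / (2 * \<bar>e - p\<bar>)" using h pe by (auto simp: v_def)
  define d where "d = (1 - v) *\<^sub>R p + v *\<^sub>R e"
  have "d - p = v * (e - p)" by (simp add: d_def algebra_simps)
  then have "\<bar>d - p\<bar> = v * \<bar>e - p\<bar>" using v by (simp add: abs_mult)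
  also have "\<dots> \<le> h / (2 * \<bar>e - p\<bar>) * \<bar>e - p\<bar>" using v by (intro mult_right_mono) auto
  also have "\<dots> < h" using pe h by simp
  finally have "\<bar>d - p\<bar> < h" .
  moreover have "d \<in> open_segment p e" unfolding in_segment d_def using v pe by blast
  ultimately show ?thesis by blast
qed

context radial_ode
begin

lemma existing_ode:
  assumes "d \<in> existing t" "t \<le> 1"
  shows "ode_on n q f 0 t (U d) (Y d)"
  using U_deriv[OF assms] Y_deriv[OF assms] by (auto simp: ode_on_def)

lemma existing_0: "d \<in> existing 0"
proof (rule ccontr)
  assume "d \<notin> existing 0"
  then obtain s where s: "s \<in> {0..0}" "d \<in> existing s" using blowup_reaches[of d 0 "d + 1"] by auto
  with \<open>d \<notin> existing 0\<close> show False by auto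
qed

lemma open_existing:
  assumes "t \<in> {0..1}"
  shows "open (existing t)"
  unfolding open_dist
proof
  fix d assume "d \<in> existing t"
  from existing_nearby[OF this assms, of 1] show "\<exists>e>0. \<forall>y. dist y d < e \<longrightarrow> y \<in> existing t"
    by (auto simp: dist_real_def)
qed

lemma U_continuous_in_d:
  assumes t: "t \<in> {0..1}"
  shows "continuous_on (existing t) (\<lambda>d. U d t)"
  unfolding continuous_on_iff
proof (intro ballI allI impI)
  fix d e :: real assume d: "d \<in> existing t" and e: "e > 0"
  from existing_nearby[OF d t e] t
  show "\<exists>h>0. \<forall>x\<in>existing t. dist x d < h \<longrightarrow> dist (U x t) (U d t) < e"
    by (force simp: dist_real_def)
qed

definition hump :: "real \<Rightarrow> real \<Rightarrow> real \<Rightarrow> real" where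
  "hump a b d = (SUP r\<in>{a..b}. U d r)"

lemma hump_attained:
  assumes d: "d \<in> existing b" and ab: "0 \<le> a" "a \<le> b" "b \<le> 1"
  obtains r where "r \<in> {a..b}" "hump a b d = U d r" "\<And>s. s \<in> {a..b} \<Longrightarrow> U d s \<le> U d r"
proof -
  have "continuous_on {a..b} (U d)" using U_continuous[OF d ab(3)] ab by (auto elim: continuous_on_subset)
  then have "\<exists>x\<in>{a..b}. \<forall>y\<in>{a..b}. U d y \<le> U d x"
    by (intro continuous_attains_sup) (use ab in auto)
  then obtain x where x: "x \<in> {a..b}" "\<And>s. s \<in> {a..b} \<Longrightarrow> U d s \<le> U d x" by blast
  have "hump a b d = U d x" unfolding hump_def by (rule cSup_eq_maximum) (use x in auto)
  then show ?thesis using that x by blast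
qed

lemma hump_continuous:
  assumes ab: "0 \<le> a" "a \<le> b" "b \<le> 1"
  shows "continuous_on (existing b) (hump a b)"
  unfolding continuous_on_iff
proof (intro ballI allI impI)
  fix d e :: real assume d: "d \<in> existing b" and e: "e > 0"
  from existing_nearby[OF d _ e] ab obtain h where h: "h > 0"
    "\<And>d'. \<bar>d' - d\<bar> < h \<Longrightarrow> d' \<in> existing b \<and> (\<forall>s\<in>{0..b}. \<bar>U d' s - U d s\<bar> < e)" by auto
  show "\<exists>h>0. \<forall>x\<in>existing b. dist x d < h \<longrightarrow> dist (hump a b x) (hump a b d) < e"
  proof (intro exI[of _ h] conjI ballI impI h(1))
    fix x assume x: "x \<in> existing b" "dist x d < h"
    obtain r where r: "r \<in> {a..b}" "hump a b d = U d r" "\<And>s. s \<in> {a..b} \<Longrightarrow> U d s \<le> U d r"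
      using hump_attained[OF d ab] by metis
    obtain v where v: "v \<in> {a..b}" "hump a b x = U x v" "\<And>s. s \<in> {a..b} \<Longrightarrow> U x s \<le> U x v"
      using hump_attained[OF x(1) ab] by metis
    have "\<bar>U x r - U d r\<bar> < e" "\<bar>U x v - U d v\<bar> < e"
      using h(2)[of x] x r v ab by (auto simp: dist_real_def)
    then show "dist (hump a b x) (hump a b d) < e"
      using r(2) r(3)[of v] v(2) v(3)[of r] r(1) v(1) unfolding dist_real_def by (smt (verit))
  qed
qed

end

section \<open>Evolution across humps and absorption intervals\<close>

lemma interlaced_mono:
  fixes \<sigma> \<tau> :: "nat \<Rightarrow> real"
  assumes "\<And>i. i \<in> {1..m} \<Longrightarrow> \<sigma> i < \<tau> i \<and> \<tau> i < \<sigma> (i + 1)" "1 \<le> i" "i \<le> j" "j \<le> m + 1"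
  shows "\<sigma> i \<le> \<sigma> j"
  using assms(3,4)
proof (induction rule: dec_induct)
  case (step k)
  then show ?case using assms(1)[of k] assms(2) by auto
qed auto

text \<open>\<open>D\<close> is the value at the origin of the given Dirichlet solution; \<open>M\<close> and \<open>C\<close> bound the humps and the
  fluxes of surviving solutions, independently of \<open>\<mu>\<close>.\<close>

locale shooting = superlinear n f + radial_ode n q f for n q f +
  fixes \<sigma> \<tau> :: "nat \<Rightarrow> real" and m :: nat and A M C \<rho> \<delta> D :: real
  assumes m_ge: "m \<ge> 1" and sigma_first: "\<sigma> 1 = 0" and sigma_last: "\<sigma> (m + 1) = 1"
    and ordered: "\<And>i. i \<in> {1..m} \<Longrightarrow> \<sigma> i < \<tau> i \<and> \<tau> i < \<sigma> (i + 1)"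
    and q_pos: "\<And>i r. i \<in> {1..m} \<Longrightarrow> r \<in> {\<sigma> i..\<tau> i} \<Longrightarrow> 0 \<le> q r \<and> q r \<le> A"
    and q_neg: "\<And>i r. i \<in> {1..m} \<Longrightarrow> r \<in> {\<tau> i..\<sigma> (i + 1)} \<Longrightarrow> q r \<le> 0"
    and bound: "\<And>i u y r. i \<in> {2..m} \<Longrightarrow> ode_on n q f (\<sigma> i) (\<tau> i) u y \<Longrightarrow>
       (\<And>r. r \<in> {\<sigma> i..\<tau> i} \<Longrightarrow> u r > 0) \<Longrightarrow> r \<in> {\<sigma> i..\<tau> i} \<Longrightarrow> u r \<le> M"
    and C_bound: "\<And>x. x \<le> M \<Longrightarrow> real m * (A * f x) \<le> C" and A_nn: "A \<ge> 0"
    and D_pos: "0 < D" "D \<le> M" and \<delta>_pos: "0 < \<delta>" "\<delta> < D" "\<delta> \<le> C"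
    and \<rho>_pos: "0 < \<rho>" "\<rho> \<le> \<tau> 1 ^ n"
    and small: "\<And>x e. x \<le> e \<Longrightarrow> 0 < e \<Longrightarrow> e \<le> \<delta> \<Longrightarrow> A * f x \<le> \<rho> * e / 4"
    and absorb: "\<And>i u y. i \<in> {1..m} \<Longrightarrow> ode_on n q f (\<tau> i) (\<sigma> (i + 1)) u y \<Longrightarrow> y (\<tau> i) \<ge> - C \<Longrightarrow>
       \<exists>r\<in>{\<tau> i..\<sigma> (i + 1)}. u r < \<delta> / 4"
    and absorb_small: "\<And>i u y. i \<in> {1..m} \<Longrightarrow> ode_on n q f (\<tau> i) (\<sigma> (i + 1)) u y \<Longrightarrow>
       y (\<tau> i) \<ge> - C \<Longrightarrow> y (\<sigma> (i + 1)) \<le> 0 \<Longrightarrow> u (\<sigma> (i + 1)) < \<delta> / 2"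
    and explode: "\<And>t. t < 1 \<Longrightarrow> \<exists>p K. t < p \<and> 0 < p \<and> p < 1 \<and>
       (\<forall>u y. ode_on n q f p 1 u y \<longrightarrow> u p \<ge> K \<longrightarrow> y p < 0)"
    and dirichlet: "D \<in> existing (\<tau> 1) \<Longrightarrow> U D (\<tau> 1) \<le> 0"
begin

lemmas sigma_mono = interlaced_mono[where \<sigma> = \<sigma> and \<tau> = \<tau> and m = m, OF ordered]

lemma order_facts:
  assumes "i \<in> {1..m}"
  shows "0 \<le> \<sigma> i" "\<sigma> i < \<tau> i" "0 < \<tau> i" "\<tau> i < \<sigma> (i + 1)" "\<sigma> (i + 1) \<le> 1" "\<tau> i < 1"
  using sigma_mono[of 1 i] sigma_mono[of "i+1" "m+1"] ordered[OF assms] sigma_first sigma_last assms by auto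

lemma sigma_ge_tau1: "i \<in> {2..m + 1} \<Longrightarrow> \<tau> 1 < \<sigma> i"
  using sigma_mono[of 2 i] ordered[of 1] m_ge by (auto simp: numeral_2_eq_2)

lemma negative_afterwards:
  assumes "d > 0" "d \<in> existing t" "t \<in> {0..1}" "s \<in> {0..t}" "U d s \<le> 0" "r \<in> {s<..t}"
  shows "U d r < 0"
proof -
  obtain Q where "\<And>r. r \<in> {0..1} \<Longrightarrow> \<bar>q r\<bar> \<le> Q" using q_bound by blast
  then show ?thesis
    using negative_after_zero[OF existing_ode[OF assms(2)], of Q s r] assms U_0[OF assms(2)] by auto
qed

lemma positive_before:
  assumes "d > 0" "d \<in> existing t" "t \<in> {0..1}" "U d t > 0" "s \<in> {0..t}"
  shows "U d s > 0"
proof (rule ccontr)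
  assume "\<not> U d s > 0"
  then have "s \<noteq> t" using assms(4) by auto
  then show False using negative_afterwards[OF assms(1-3,5), of t] assms \<open>\<not> U d s > 0\<close> by auto
qed

lemma zero_solution: "t \<in> {0..1} \<Longrightarrow> 0 \<in> existing t" "t \<in> {0..1} \<Longrightarrow> U 0 t = 0"
proof -
  have p0: "0 = 0 - pot n (\<lambda>x. q x * f 0) s" for s
    by (simp add: f_nonpos pot_def flux_def)
  show "0 \<in> existing t" if "t \<in> {0..1}"
    by (rule existingI(1)[of _ "\<lambda>_. 0"]) (use p0 that in auto)
  show "U 0 t = 0" if "t \<in> {0..1}"
    by (rule existingI(2)[of 1 "\<lambda>_. 0"]) (use p0 that in auto)
qed

text \<open>Past a zero the solution is negative, hence never reaches a high level; but
  \<open>blowup_reaches\<close> would provide such a level if the solution did not exist up to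
  \<open>t\<close>.\<close>

lemma extend_dead:
  assumes d: "d > 0" "d \<in> existing s" "s \<in> {0..1}" "U d s \<le> 0" and t: "t \<in> {0..1}"
  shows "d \<in> existing t"
proof (rule ccontr)
  assume n: "d \<notin> existing t"
  obtain B where B: "B > 0" "\<And>x. x \<in> {0..s} \<Longrightarrow> \<bar>U d x\<bar> \<le> B"
    using continuous_on_bounded_Icc[OF U_continuous[OF d(2)]] d(3) by (metis atLeastAtMost_iff)
  obtain r where r: "r \<in> {0..t}" "d \<in> existing r" "U d r = B + d + 1"
    using blowup_reaches[OF n t, of "B + d + 1"] B by auto
  have "s < r" using B(2)[of r] r d by (cases "r \<le> s") auto
  then show False using negative_afterwards[OF d(1) r(2) _ _ d(4), of r] r t d B by auto
qed

text \<open>Starting from zero flux, the profile decreases on the first hump. The datum thus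
  replaces the a priori bound, which is available only away from the origin.\<close>

lemma first_hump_le:
  assumes d: "d \<in> existing t" "t \<in> {0..\<tau> 1}" and r: "r \<in> {0..t}"
  shows "U d r \<le> d"
proof -
  have t1: "t \<le> 1" using d order_facts[of 1] m_ge by auto
  have o: "ode_on n q f 0 t (U d) (Y d)" by (rule existing_ode[OF d(1) t1])
  have "U d r - U d 0 \<le> 0 * (r - 0)"
  proof (rule ode_u_le[OF o])
    fix x assume x: "x \<in> {0<..<r}"
    have "Y d x \<le> Y d 0"
    proof (rule y_antimono_of_nonneg[OF o])
      fix v assume "v \<in> {0..t}"
      then show "q v \<ge> 0" using q_pos[of 1 v] d sigma_first m_ge by auto
    qed (use x r in auto)
    then show "Y d x / x ^ n \<le> 0" using x by (simp add: divide_nonpos_nonneg)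
  qed (use r in auto)
  then show ?thesis using U_0[OF d(1)] d t1 by auto
qed

text \<open>On a hump the flux does not increase, so the slope stays bounded by its initial positive
  part: blow-up can occur only where the weight is nonpositive.\<close>

lemma extend_hump:
  assumes i: "i \<in> {1..m}" and d: "d \<in> existing (\<sigma> i)"
  shows "d \<in> existing (\<tau> i)"
proof (rule ccontr)
  assume nt: "d \<notin> existing (\<tau> i)"
  note of = order_facts[OF i]
  obtain B where B: "B > 0" "\<And>x. x \<in> {0..\<sigma> i} \<Longrightarrow> \<bar>U d x\<bar> \<le> B"
    using continuous_on_bounded_Icc[OF U_continuous[OF d]] of by auto
  define k where "k = max (Y d (\<sigma> i)) 0"
  \<comment> \<open>For \<open>i = 1\<close> the interval starts at the origin. There the flux is 0,
    so \<open>k = 0\<close> and \<open>k / \<sigma> i ^ n\<close> is 0 even if the denominator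
    vanishes.\<close>
  have k0: "k \<ge> 0" "i = 1 \<Longrightarrow> k = 0" using sigma_first by (auto simp: k_def)
  have kk: "k / \<sigma> i ^ n \<ge> 0" using k0 of by simp
  have "d < B + k / \<sigma> i ^ n + \<bar>d\<bar> + 1" using B(1) kk by linarith
  then obtain s where s: "s \<in> {0..\<tau> i}" "d \<in> existing s" "U d s = B + k / \<sigma> i ^ n + \<bar>d\<bar> + 1"
    using blowup_reaches[OF nt, of "B + k / \<sigma> i ^ n + \<bar>d\<bar> + 1"] of by auto
  have s\<sigma>: "\<sigma> i < s" using B(2)[of s] s kk by (cases "s \<le> \<sigma> i") auto
  have s1: "s \<le> 1" using s of by auto
  have o: "ode_on n q f (\<sigma> i) s (U d) (Y d)"
    by (rule ode_on_subset[OF existing_ode[OF s(2) s1]]) (use of in auto)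
  have "U d s - U d (\<sigma> i) \<le> k / \<sigma> i ^ n * (s - \<sigma> i)"
  proof (rule ode_u_le[OF o])
    fix x assume x: "x \<in> {\<sigma> i<..<s}"
    have "Y d x \<le> Y d (\<sigma> i)"
      by (rule y_antimono_of_nonneg[OF o]) (use x of s q_pos[OF i] in auto)
    then have "Y d x \<le> k" by (simp add: k_def)
    show "Y d x / x ^ n \<le> k / \<sigma> i ^ n"
    proof (cases "i = 1")
      case True
      then show ?thesis using k0 \<open>Y d x \<le> k\<close> x of by (simp add: divide_nonpos_nonneg)
    next
      case False
      then have sp: "\<sigma> i > 0" using sigma_ge_tau1[of i] i order_facts[of 1] m_ge by auto
      have "Y d x / x ^ n \<le> k / x ^ n" using x sp \<open>Y d x \<le> k\<close> by (intro divide_right_mono) auto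
      also have "\<dots> \<le> k / \<sigma> i ^ n"
        using x sp k0 by (intro divide_left_mono power_mono mult_pos_pos) auto
      finally show ?thesis .
    qed
  qed (use s\<sigma> in auto)
  also have "\<dots> \<le> k / \<sigma> i ^ n * 1" using kk s1 of by (intro mult_left_mono) auto
  finally show False using s(3) B(2)[of "\<sigma> i"] of by auto
qed

text \<open>Each hump lowers the flux by at most \<open>A\<close> times the maximum of
  \<open>f\<close> up to \<open>M\<close>, and each absorption interval raises it. Summing over at
  most \<open>m\<close> humps gives a bound in which \<mu> does not occur.\<close>

lemma alive_flux_bound:
  assumes i: "i \<in> {1..m}" and d: "0 < d" "d \<le> D" "d \<in> existing (\<tau> i)" and al: "U d (\<tau> i) > 0"
  shows "Y d (\<tau> i) \<ge> - C"
proof -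
  \<comment> \<open>No monotonicity of \<open>f\<close> is available, so the hypothesis
    \<open>C_bound\<close> is applied at a maximizer on \<open>[0,M]\<close>.\<close>
  obtain x0 where x0: "x0 \<le> M" "\<And>x. x \<le> M \<Longrightarrow> f x \<le> f x0"
  proof -
    have "\<exists>x\<in>{0..M}. \<forall>y\<in>{0..M}. f y \<le> f x"
      by (rule continuous_attains_sup) (use D_pos in \<open>auto intro: continuous_on_subset[OF f_cont]\<close>)
    then obtain x where x: "x \<in> {0..M}" "\<And>y. y \<in> {0..M} \<Longrightarrow> f y \<le> f x" by blast
    have "f y \<le> f x" if "y \<le> M" for y
      using x(2)[of y] f_nonpos[of y] f_nonneg[of x] that by (cases "y \<le> 0") auto
    then show ?thesis using that x by auto
  qed
  have AF: "A * f x0 \<ge> 0" using A_nn f_nonneg by simp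
  note ofi = order_facts[OF i]
  have o: "ode_on n q f 0 (\<tau> i) (U d) (Y d)" by (rule existing_ode[OF d(3)]) (use ofi in auto)
  have pos: "U d r > 0" if "r \<in> {0..\<tau> i}" for r
    by (rule positive_before[OF d(1,3) _ al that]) (use ofi in auto)
  have hump: "Y d (\<tau> j) \<ge> Y d (\<sigma> j) - A * f x0"
    if j: "j \<in> {1..m}" "\<tau> j \<le> \<tau> i" and le: "\<And>r. r \<in> {\<sigma> j..\<tau> j} \<Longrightarrow> U d r \<le> M" for j
  proof -
    note ofj = order_facts[OF j(1)]
    have "- (A * f x0) * (\<tau> j - \<sigma> j) \<le> Y d (\<tau> j) - Y d (\<sigma> j)"
    proof (rule ode_y_ge[OF o])
      fix x assume x: "x \<in> {\<sigma> j<..<\<tau> j}"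
      have "x ^ n * (q x * f (U d x)) \<le> 1 * (A * f x0)"
        using x ofj q_pos[OF j(1), of x] x0(2)[OF le[of x]] f_nonneg A_nn
        by (intro mult_mono power_le_one mult_nonneg_nonneg) auto
      then show "- (A * f x0) \<le> - (x ^ n * (q x * f (U d x)))" by simp
    qed (use ofj j in auto)
    moreover have "A * f x0 * (\<tau> j - \<sigma> j) \<le> A * f x0 * 1"
      using ofj AF by (intro mult_left_mono) auto
    ultimately show ?thesis by simp
  qed
  have "\<tau> j \<le> \<tau> i \<and> Y d (\<tau> j) \<ge> - real j * (A * f x0)" if "1 \<le> j" "j \<le> i" for j
    using that
  proof (induction rule: dec_induct)
    case base
    have 1: "\<tau> 1 \<le> \<tau> i"
      using sigma_ge_tau1[of i] ofi i by (cases "i = 1") auto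
    have "d \<in> existing (\<tau> 1)" using existing_mono[OF d(3) 1] .
    then have "U d r \<le> M" if "r \<in> {\<sigma> 1..\<tau> 1}" for r
      using first_hump_le[of d "\<tau> 1" r] that sigma_first d D_pos order_facts[of 1] m_ge by auto
    from hump[of 1, OF _ 1 this] show ?case using 1 m_ge sigma_first by simp
  next
    case (step j)
    have jm: "j \<in> {1..m}" "Suc j \<in> {2..m}" using step i by auto
    note ofj = order_facts[OF jm(1)]
    have ofs: "0 \<le> \<sigma> (Suc j)" "\<sigma> (Suc j) < \<tau> (Suc j)" using order_facts[of "Suc j"] jm by auto
    have le: "\<tau> (Suc j) \<le> \<tau> i"
    proof (cases "Suc j = i")
      case False
      then have "\<sigma> (Suc j + 1) \<le> \<sigma> i" using sigma_mono[of "Suc j + 1" i] step i by auto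
      then show ?thesis using order_facts[of "Suc j"] jm ofi by auto
    qed auto
    have o': "ode_on n q f (\<sigma> (Suc j)) (\<tau> (Suc j)) (U d) (Y d)"
      by (rule ode_on_subset[OF o]) (use ofs le in auto)
    have "U d r \<le> M" if "r \<in> {\<sigma> (Suc j)..\<tau> (Suc j)}" for r
      by (rule bound[OF jm(2) o' _ that]) (use pos ofs le in auto)
    from hump[of "Suc j", OF _ le this] jm
    have 1: "Y d (\<tau> (Suc j)) \<ge> Y d (\<sigma> (Suc j)) - A * f x0" by auto
    have "ode_on n q f (\<tau> j) (\<sigma> (j + 1)) (U d) (Y d)"
      by (rule ode_on_subset[OF o]) (use ofj ofs le in auto)
    then have "Y d (\<tau> j) \<le> Y d (\<sigma> (j + 1))"
      by (rule y_mono_of_nonpos) (use ofj q_neg[OF jm(1)] in auto)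
    then show ?case using 1 step le by (simp add: algebra_simps)
  qed
  then have "Y d (\<tau> i) \<ge> - real i * (A * f x0)" using i by auto
  moreover have "real i * (A * f x0) \<le> real m * (A * f x0)"
    using i AF by (intro mult_right_mono) auto
  ultimately show ?thesis using C_bound[OF x0(1)] by linarith
qed

text \<open>To exceed its value at the start of the absorption interval, the solution must have
  positive flux at \<open>s\<close>; since the flux is nondecreasing there, the rise goes
  on.\<close>

lemma rising:
  assumes i: "i \<in> {1..m}" and d: "d \<in> existing t" and s: "\<tau> i \<le> s" "s \<le> t" "t \<le> \<sigma> (i + 1)"
    and less: "U d (\<tau> i) < U d s"
  shows "U d s \<le> U d t" "Y d t > 0"
proof -
  note of = order_facts[OF i]
  have o: "ode_on n q f (\<tau> i) t (U d) (Y d)"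
    by (rule ode_on_subset[OF existing_ode[OF d]]) (use of s in auto)
  have mono: "Y d v \<le> Y d w" if "\<tau> i \<le> v" "v \<le> w" "w \<le> t" for v w
    by (rule y_mono_of_nonpos[OF o _ _ that]) (use of s q_neg[OF i] in auto)
  have ys: "Y d s > 0"
  proof (rule ccontr)
    assume "\<not> Y d s > 0"
    have "U d s - U d (\<tau> i) \<le> 0 * (s - \<tau> i)"
    proof (rule ode_u_le[OF o])
      fix x assume x: "x \<in> {\<tau> i<..<s}"
      then have "Y d x \<le> 0" using mono[of x s] \<open>\<not> Y d s > 0\<close> s by auto
      then show "Y d x / x ^ n \<le> 0" using x of by (simp add: divide_nonpos_nonneg)
    qed (use s in auto)
    then show False using less by simp
  qed
  then show "Y d t > 0" using mono[of s t] s by simp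
  have "0 * (t - s) \<le> U d t - U d s"
  proof (rule ode_u_ge[OF o])
    fix x assume x: "x \<in> {s<..<t}"
    then have "Y d x \<ge> 0" using mono[of s x] ys s by auto
    then show "0 \<le> Y d x / x ^ n" using x of s by simp
  qed (use s in auto)
  then show "U d s \<le> U d t" by simp
qed

text \<open>The exploding solution reaches a high level at some \<open>s\<close> before
  \<open>t\<close>. Neighbours follow it up to \<open>s\<close>, so they have risen above their
  value at the end of the hump, and \<open>rising\<close> carries the height on to \<open>t\<close>
  if they still exist.\<close>

lemma large_near_blowup:
  assumes i: "i \<in> {1..m}" and p: "p \<in> existing (\<tau> i)" "p \<notin> existing t"
    and t: "\<tau> i < t" "t \<le> \<sigma> (i + 1)"
  shows "\<exists>h>0. \<forall>d. \<bar>d - p\<bar> < h \<longrightarrow> d \<in> existing t \<longrightarrow> U d t \<ge> K \<and> Y d t > 0"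
proof -
  note of = order_facts[OF i]
  have t01: "t \<in> {0..1}" using t of by auto
  obtain B where B: "B > 0" "\<And>x. x \<in> {0..\<tau> i} \<Longrightarrow> \<bar>U p x\<bar> \<le> B"
    using continuous_on_bounded_Icc[OF U_continuous[OF p(1)]] of by auto
  \<comment> \<open>The 2 absorbs the errors, each below 1, of the neighbour at the end of the hump
    and at \<open>s\<close>; the term \<open>\<bar>p\<bar>\<close> makes the level exceed the
    datum.\<close>
  define K' where "K' = max K B + \<bar>p\<bar> + 2"
  have "p < K'" using B(1) unfolding K'_def by linarith
  then obtain s where s: "s \<in> {0..t}" "p \<in> existing s" "U p s = K'"
    using blowup_reaches[OF p(2) t01, of K'] by auto
  have s\<tau>: "\<tau> i < s" using B(2)[of s] s by (cases "s \<le> \<tau> i") (auto simp: K'_def)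
  have "s \<in> {0..1}" using s t01 by auto
  from existing_nearby[OF s(2) this, of 1] obtain h where h: "h > 0"
    "\<And>d. \<bar>d - p\<bar> < h \<Longrightarrow> d \<in> existing s \<and> (\<forall>r\<in>{0..s}. \<bar>U d r - U p r\<bar> < 1)" by auto
  show ?thesis
  proof (intro exI[of _ h] conjI allI impI h(1))
    fix d assume d: "\<bar>d - p\<bar> < h" "d \<in> existing t"
    have 1: "\<bar>U d (\<tau> i) - U p (\<tau> i)\<bar> < 1" "\<bar>U d s - U p s\<bar> < 1" using h(2)[OF d(1)] s s\<tau> of by auto
    have "U p (\<tau> i) \<le> B" using B(2)[of "\<tau> i"] of by auto
    then have less: "U d (\<tau> i) < U d s" and big: "U d s \<ge> K"
      using 1 s(3) by (auto simp: K'_def)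
    have st: "\<tau> i \<le> s" "s \<le> t" using s s\<tau> by auto
    show "U d t \<ge> K" using rising(1)[OF i d(2) st t(2) less] big by simp
    show "Y d t > 0" by (rule rising(2)[OF i d(2) st t(2) less])
  qed
qed

text \<open>Let \<open>e\<close> be the height. By \<open>small_hump\<close> a survivor would stay
  above \<open>3 * e / 4\<close>, hence above \<open>\<delta> / 4\<close>, until the end of the
  absorption interval, against \<open>absorb\<close>. The flux entering the hump must be nonnegative
  for this: otherwise the maximum sits at the start of the hump, where \<open>absorb_small\<close>
  has pushed the value below \<open>\<delta> / 2\<close>.\<close>

lemma hump_blowup:
  assumes i: "i \<in> {1..m}" and d: "0 < d" "d \<le> D" "d \<in> existing (\<tau> i)"
    and h: "hump (\<sigma> i) (\<tau> i) d \<in> {\<delta>/2..\<delta>}" and al: "i \<ge> 2 \<Longrightarrow> U d (\<sigma> i) > 0"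
  shows "d \<notin> existing (\<sigma> (i + 1))"
proof
  assume ex: "d \<in> existing (\<sigma> (i + 1))"
  note of = order_facts[OF i]
  define e where "e = hump (\<sigma> i) (\<tau> i) d"
  have e: "\<delta>/2 \<le> e" "e \<le> \<delta>" "e > 0" using h \<delta>_pos by (auto simp: e_def)
  have o: "ode_on n q f 0 (\<sigma> (i + 1)) (U d) (Y d)" by (rule existing_ode[OF ex]) (use of in auto)
  have o\<sigma>: "ode_on n q f (\<sigma> i) (\<sigma> (i + 1)) (U d) (Y d)" by (rule ode_on_subset[OF o]) (use of in auto)
  obtain r where r: "r \<in> {\<sigma> i..\<tau> i}" "e = U d r" "\<And>s. s \<in> {\<sigma> i..\<tau> i} \<Longrightarrow> U d s \<le> e"
    using hump_attained[OF d(3), of "\<sigma> i"] of unfolding e_def by (metis less_imp_le)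
  have init: "(\<sigma> i = 0 \<and> Y d 0 = 0) \<or> (Y d (\<sigma> i) \<ge> 0 \<and> \<rho> \<le> \<sigma> i ^ n)"
  proof (cases "i = 1")
    case True
    then show ?thesis using sigma_first by simp
  next
    case False
    then have i2: "i \<ge> 2" using i by auto
    define j where "j = i - 1"
    have j: "j \<in> {1..m}" "j + 1 = i" using i i2 by (auto simp: j_def)
    note ofj = order_facts[OF j(1)]
    have "\<tau> 1 < \<sigma> i" using sigma_ge_tau1[of i] i i2 by auto
    then have "\<tau> 1 ^ n \<le> \<sigma> i ^ n" using order_facts[of 1] m_ge by (intro power_mono) auto
    then have "\<rho> \<le> \<sigma> i ^ n" using \<rho>_pos by simp
    moreover have "Y d (\<sigma> i) \<ge> 0"
    proof (rule ccontr)
      assume yneg: "\<not> Y d (\<sigma> i) \<ge> 0"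
      have "U d r - U d (\<sigma> i) \<le> 0 * (r - \<sigma> i)"
      proof (rule ode_u_le[OF o\<sigma>])
        fix x assume x: "x \<in> {\<sigma> i<..<r}"
        have "ode_on n q f (\<sigma> i) (\<tau> i) (U d) (Y d)" by (rule ode_on_subset[OF o\<sigma>]) (use of in auto)
        then have "Y d x \<le> Y d (\<sigma> i)"
          by (rule y_antimono_of_nonneg) (use x r of q_pos[OF i] in auto)
        then show "Y d x / x ^ n \<le> 0" using x yneg of by (simp add: divide_nonpos_nonneg)
      qed (use r of in auto)
      then have big: "U d (\<sigma> i) \<ge> \<delta> / 2" using r e by simp
      have ex\<sigma>: "d \<in> existing (\<sigma> i)" using existing_mono[OF ex] of by auto
      have "U d (\<tau> j) > 0"
        by (rule positive_before[OF d(1) ex\<sigma> _ al[OF i2]]) (use of ofj j in auto)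
      moreover have "d \<in> existing (\<tau> j)" using existing_mono[OF ex\<sigma>] ofj j by auto
      ultimately have yj: "Y d (\<tau> j) \<ge> - C" using alive_flux_bound[OF j(1) d(1,2)] by simp
      have "ode_on n q f (\<tau> j) (\<sigma> (j + 1)) (U d) (Y d)"
        by (rule ode_on_subset[OF o]) (use ofj of j in auto)
      then have "U d (\<sigma> (j + 1)) < \<delta> / 2" by (rule absorb_small[OF j(1), where y = "Y d"]) (use yneg yj j in auto)
      then show False using big j by simp
    qed
    ultimately show ?thesis by simp
  qed
  have "\<tau> 1 \<le> \<tau> i" using sigma_ge_tau1[of i] i of by (cases "i = 1") auto
  then have "\<tau> 1 ^ n \<le> \<tau> i ^ n" using order_facts[of 1] m_ge by (intro power_mono) auto
  then have \<rho>i: "\<rho> \<le> \<tau> i ^ n" using \<rho>_pos by simp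
  have hump: "U d s \<ge> U d r - e / 4" "Y d (\<tau> i) \<ge> - e / 4" if "r \<le> s" "s \<le> \<sigma> (i + 1)" for s
    by (rule small_hump[OF o\<sigma> _ _ _ _ q_pos[OF i] q_neg[OF i] r(3) e(3) small[OF _ e(3,2)] \<rho>_pos(1) \<rho>i init];
        use of r that in auto)+
  have "Y d (\<tau> i) \<ge> - C" using hump(2)[of "\<tau> i"] r of e \<delta>_pos by auto
  moreover have "ode_on n q f (\<tau> i) (\<sigma> (i + 1)) (U d) (Y d)"
    by (rule ode_on_subset[OF o\<sigma>]) (use of in auto)
  ultimately obtain s where s: "s \<in> {\<tau> i..\<sigma> (i + 1)}" "U d s < \<delta> / 4" using absorb[OF i] by blast
  then show False using hump(1)[of s] r e by auto
qed

section \<open>Gates: the parameter intervals and their subdivision\<close>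

text \<open>The pair lists the exploding end first, the dying end second. Segments are used instead
  of ordered intervals because \<open>p\<close> may lie on either side of \<open>e\<close>.\<close>

definition gate :: "nat \<Rightarrow> real \<Rightarrow> real \<Rightarrow> bool" where
  "gate i p e \<longleftrightarrow> p \<in> existing (\<tau> i) \<and> p \<notin> existing (\<sigma> (i + 1)) \<and>
     e \<in> existing (\<sigma> (i + 1)) \<and> U e (\<sigma> (i + 1)) = 0 \<and>
     (\<forall>d\<in>open_segment p e. d \<in> existing (\<sigma> (i + 1)) \<and> U d (\<sigma> (i + 1)) > 0)"

lemma existing_gate:
  assumes "i \<in> {1..m}" "gate i p e" "d \<in> closed_segment p e" "d \<noteq> p"
  shows "d \<in> existing (\<sigma> (i + 1))"
proof -
  have "d = e \<or> d \<in> open_segment p e" using assms by (auto simp: open_segment_def)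
  then show ?thesis
    using assms(2) by (auto simp: gate_def)
qed

text \<open>Walking from \<open>\<gamma>\<close> to \<open>e'\<close>, take the last datum whose solution has blown up by time \<open>\<sigma> (i + 1)\<close> and
  then the first one whose solution vanishes there.\<close>

lemma gate_exists:
  assumes i: "i \<in> {1..m}" and \<gamma>: "\<gamma> \<notin> existing (\<sigma> (i + 1))"
    and e': "e' \<in> existing (\<sigma> (i + 1))" "U e' (\<sigma> (i + 1)) \<le> 0"
    and seg: "closed_segment \<gamma> e' \<subseteq> existing (\<tau> i)"
  shows "\<exists>p e. gate i p e \<and> p \<in> closed_segment \<gamma> e' \<and> e \<in> closed_segment \<gamma> e'"
proof -
  note of = order_facts[OF i]
  define T where "T = \<sigma> (i + 1)"
  have T: "T \<in> {0..1}" "\<tau> i < T" using of by (auto simp: T_def)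
  define x where "x s = \<gamma> + s * (e' - \<gamma>)" for s
  have x01: "x 0 = \<gamma>" "x 1 = e'" by (auto simp: x_def)
  have xseg: "x s \<in> closed_segment \<gamma> e'" if "s \<in> {0..1}" for s
    unfolding in_segment using that by (intro exI[of _ s]) (auto simp: x_def algebra_simps)
  have xc: "continuous_on S x" for S unfolding x_def by (intro continuous_intros)
  define B where "B = {0..1} \<inter> x -` (- existing T)"
  have "closed B" unfolding B_def
    using open_existing[OF T(1)] by (intro continuous_closed_preimage xc) (auto simp: closed_Compl)
  moreover have "bounded B" by (rule bounded_subset[of "{0..1}"]) (auto simp: B_def)
  ultimately have cB: "compact B" by (simp add: compact_eq_bounded_closed)
  have "0 \<in> B" using \<gamma> x01 by (auto simp: B_def T_def)
  then have "B \<noteq> {}" by auto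
  from compact_attains_sup[OF cB this] obtain s1 where s1: "s1 \<in> B" "\<And>s. s \<in> B \<Longrightarrow> s \<le> s1" by blast
  have s1': "s1 \<in> {0..1}" "x s1 \<notin> existing T" using s1(1) by (auto simp: B_def)
  have "s1 \<noteq> 1" using s1' e' x01 by (auto simp: T_def)
  then have s11: "s1 < 1" using s1' by auto
  have after: "x s \<in> existing T" if "s \<in> {s1<..1}" for s
    using s1(2)[of s] that s1' by (force simp: B_def)
  have ptau: "x s1 \<in> existing (\<tau> i)" using seg xseg[OF s1'(1)] by auto
  \<comment> \<open>Just after \<open>s1\<close> the value at \<open>T\<close> is at least 1. The
    first zero can therefore be sought on \<open>[s1 + k, 1]\<close>, a compact set of parameters
    that avoids the blow-up and on which the value depends continuously on \<open>s\<close>.\<close>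
  obtain h where h: "h > 0" "\<And>d. \<bar>d - x s1\<bar> < h \<Longrightarrow> d \<in> existing T \<Longrightarrow> U d T \<ge> 1"
    using large_near_blowup[OF i ptau s1'(2) T(2), of 1] T_def by auto
  obtain k' where k': "k' > 0" "\<And>s. \<bar>s - s1\<bar> < k' \<Longrightarrow> \<bar>x s - x s1\<bar> < h"
    using xc[of UNIV] h(1) unfolding continuous_on_iff dist_real_def by blast
  define k where "k = min ((1 - s1) / 2) (k' / 2)"
  have k: "k > 0" "k < k'" using s11 k' by (auto simp: k_def)
  have k1: "k \<le> (1 - s1) / 2" unfolding k_def by (rule min.cobounded1)
  have k2: "s1 + k < 1" using k1 s11 by argo
  have near: "U (x s) T \<ge> 1" if s: "s \<in> {s1<..s1 + k}" for s
  proof (rule h(2))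
    show "\<bar>x s - x s1\<bar> < h" by (rule k'(2)) (use s k in auto)
    show "x s \<in> existing T" by (rule after) (use s k2 in auto)
  qed
  define \<phi> where "\<phi> s = U (x s) T" for s
  have "continuous_on {s1 + k..1} \<phi>"
    unfolding \<phi>_def by (rule continuous_on_compose2[OF U_continuous_in_d[OF T(1)] xc]) (use after k in auto)
  moreover have "\<phi> (s1 + k) > 0" using near[of "s1 + k"] k by (auto simp: \<phi>_def)
  moreover have "\<phi> 1 \<le> 0" using e' x01 by (simp add: \<phi>_def T_def)
  ultimately obtain s2 where s2: "s2 \<in> {s1 + k<..1}" "\<phi> s2 = 0" "\<And>s. s \<in> {s1 + k..<s2} \<Longrightarrow> \<phi> s > 0"
    using first_zero[of "s1 + k" 1 \<phi> 1] k2 by auto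
  have "gate i (x s1) (x s2)"
    unfolding gate_def T_def[symmetric]
  proof (intro conjI ballI ptau s1'(2))
    show "x s2 \<in> existing T" by (rule after) (use s2 k in auto)
    show "U (x s2) T = 0" using s2 by (simp add: \<phi>_def)
    fix d assume "d \<in> open_segment (x s1) (x s2)"
    then obtain v where v: "0 < v" "v < 1" "d = (1 - v) *\<^sub>R x s1 + v *\<^sub>R x s2"
      unfolding in_segment by blast
    define s where "s = s1 + v * (s2 - s1)"
    have ds: "d = x s" unfolding v(3) s_def x_def by (simp add: algebra_simps)
    have "v * (s2 - s1) > 0" "v * (s2 - s1) < 1 * (s2 - s1)"
      using v s2 k by (auto intro!: mult_strict_right_mono)
    then have ss: "s1 < s" "s < s2" by (auto simp: s_def)
    show "d \<in> existing T" unfolding ds by (rule after) (use ss s2 in auto)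
    show "U d T > 0"
      using near[of s] s2(3)[of s] ss by (cases "s \<le> s1 + k") (auto simp: ds \<phi>_def)
  qed
  moreover have "s2 \<in> {0..1}" using s2 s1' k by auto
  ultimately show ?thesis using xseg s1'(1) by blast
qed

definition final :: "real \<Rightarrow> bool" where
  "final d \<longleftrightarrow> d \<notin> existing 1 \<and> (\<forall>t<1. d \<in> existing t)"

text \<open>Were \<open>p\<close> to blow up before 1, then at some \<open>r\<close> close to 1 the
  data of the gate near \<open>p\<close> would be large with positive flux. They live until 1, which
  contradicts \<open>explode\<close>.\<close>

lemma gate_last_final:
  assumes g: "gate m p e"
  shows "final p"
proof -
  have m: "m \<in> {1..m}" using m_ge by auto
  note of = order_facts[OF m]
  have p: "p \<in> existing (\<tau> m)" "p \<notin> existing 1" using g sigma_last by (auto simp: gate_def)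
  have "p \<in> existing t" if t: "t < 1" for t
  proof (rule ccontr)
    assume pt: "p \<notin> existing t"
    obtain r K where r: "max t (\<tau> m) < r" "0 < r" "r < 1"
      and K: "\<And>u y. ode_on n q f r 1 u y \<Longrightarrow> u r \<ge> K \<Longrightarrow> y r < 0"
      using explode[of "max t (\<tau> m)"] t of by auto
    have pr: "p \<notin> existing r" using existing_mono[of p r t] pt r by auto
    have "\<tau> m < r" "r \<le> \<sigma> (m + 1)" using r sigma_last by auto
    from large_near_blowup[OF m p(1) pr this, of K] obtain h where h: "h > 0"
      "\<And>d. \<bar>d - p\<bar> < h \<Longrightarrow> d \<in> existing r \<Longrightarrow> U d r \<ge> K \<and> Y d r > 0" by blast
    have "p \<noteq> e" using g by (auto simp: gate_def)
    then obtain d where "d \<in> open_segment p e" and dp: "\<bar>d - p\<bar> < h"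
      using open_segment_near[OF _ h(1)] by blast
    then have d1: "d \<in> existing 1" using g sigma_last by (auto simp: gate_def)
    have dr: "d \<in> existing r" using existing_mono[OF d1] r by auto
    have "ode_on n q f r 1 (U d) (Y d)"
      by (rule ode_on_subset[OF existing_ode[OF d1]]) (use r in auto)
    then have "Y d r < 0" by (rule K) (use h(2)[OF dp dr] in auto)
    then show False using h(2)[OF dp dr] by auto
  qed
  then show ?thesis using p by (simp add: final_def)
qed

lemma dead_after_hump:
  assumes i: "i \<in> {1..m}" and d: "0 \<le> d" "d \<in> existing t" "t \<in> {0..\<tau> i}" "U d t \<le> 0"
  shows "d \<in> existing (\<sigma> (i + 1))" "U d (\<sigma> (i + 1)) \<le> 0"
proof -
  note of = order_facts[OF i]
  have T: "\<sigma> (i + 1) \<in> {0..1}" "t \<in> {0..1}" using of d by auto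
  show *: "d \<in> existing (\<sigma> (i + 1))"
    using extend_dead[OF _ d(2) T(2) d(4) T(1)] zero_solution(1)[OF T(1)] d(1) by (cases "d = 0") auto
  show "U d (\<sigma> (i + 1)) \<le> 0"
    using negative_afterwards[OF _ * T(1) _ d(4)] zero_solution(2)[OF T(1)] d of
    by (cases "d = 0") (auto simp: less_imp_le)
qed

lemma existing_first: "d \<in> existing (\<tau> 1)"
  using extend_hump[of 1 d] existing_0 sigma_first m_ge by auto

text \<open>Data with hump heights \<open>\<delta>\<close> and \<open>\<delta> / 2\<close> blow up too early, which separates two new gates.\<close>

lemma two_gates:
  fixes x :: "real \<Rightarrow> real"
  assumes i: "i \<in> {1..m}" and x: "continuous_on {0..1} x"
    and lin: "\<And>a b. {a..b} \<subseteq> {0..1} \<Longrightarrow> a \<le> b \<Longrightarrow> closed_segment (x a) (x b) = x ` {a..b}"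
    and inj: "inj_on x {0..1}"
    and xr: "\<And>s. s \<in> {0..1} \<Longrightarrow> 0 \<le> x s \<and> x s \<le> D \<and> x s \<in> existing (\<tau> i) \<and>
       (i \<ge> 2 \<longrightarrow> s < 1 \<longrightarrow> U (x s) (\<sigma> i) > 0)"
    and h0: "hump (\<sigma> i) (\<tau> i) (x 0) > \<delta>" and h1: "hump (\<sigma> i) (\<tau> i) (x 1) \<le> 0"
    and d0: "U (x 0) (\<tau> i) \<le> 0" and d1: "U (x 1) (\<tau> i) \<le> 0"
  shows "\<exists>p1 e1 p2 e2. gate i p1 e1 \<and> gate i p2 e2 \<and> closed_segment p1 e1 \<subseteq> x ` {0..1} \<and>
    closed_segment p2 e2 \<subseteq> x ` {0..1} \<and> closed_segment p1 e1 \<inter> closed_segment p2 e2 = {}"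
proof -
  note of = order_facts[OF i]
  define \<phi> where "\<phi> s = hump (\<sigma> i) (\<tau> i) (x s)" for s
  have \<phi>c: "continuous_on {0..1} \<phi>"
    unfolding \<phi>_def by (rule continuous_on_compose2[OF hump_continuous x]) (use of xr in auto)
  have "\<exists>s\<ge>0. s \<le> 1 \<and> \<phi> s = \<delta>"
    by (rule IVT2') (use h0 h1 \<delta>_pos \<phi>c in \<open>auto simp: \<phi>_def\<close>)
  then obtain s1 where s1: "0 \<le> s1" "s1 \<le> 1" "\<phi> s1 = \<delta>" by blast
  have "\<exists>s\<ge>s1. s \<le> 1 \<and> \<phi> s = \<delta> / 2"
    by (rule IVT2') (use h1 s1 \<delta>_pos in \<open>auto simp: \<phi>_def[symmetric] intro: continuous_on_subset[OF \<phi>c]\<close>)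
  then obtain s2 where s2: "s1 \<le> s2" "s2 \<le> 1" "\<phi> s2 = \<delta> / 2" by blast
  have s12: "s1 < s2" using s1 s2 \<delta>_pos by (cases "s1 = s2") auto
  have s21: "s2 < 1" using s2 h1 \<delta>_pos by (cases "s2 = 1") (auto simp: \<phi>_def)
  \<comment> \<open>The parameter 1 is excluded because in later stages the corresponding datum
    already vanishes at the start of the hump.\<close>
  have nonex: "x s \<notin> existing (\<sigma> (i + 1))" if "s \<in> {0..<1}" "\<phi> s \<in> {\<delta>/2..\<delta>}" for s
  proof (rule hump_blowup[OF i])
    have xs: "0 \<le> x s" "x s \<le> D" "x s \<in> existing (\<tau> i)" using xr[of s] that by auto
    have "x s \<noteq> 0"
    proof
      assume "x s = 0"
      obtain r where "r \<in> {\<sigma> i..\<tau> i}" "hump (\<sigma> i) (\<tau> i) (x s) = U (x s) r"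
        using hump_attained[OF xs(3), of "\<sigma> i"] of by (metis less_imp_le)
      then show False using zero_solution(2)[of r] \<open>x s = 0\<close> that \<delta>_pos of by (auto simp: \<phi>_def)
    qed
    then show "0 < x s" using xs by auto
    show "x s \<le> D" "x s \<in> existing (\<tau> i)" using xs by auto
    show "hump (\<sigma> i) (\<tau> i) (x s) \<in> {\<delta> / 2..\<delta>}" using that by (simp add: \<phi>_def)
    show "U (x s) (\<sigma> i) > 0" if "2 \<le> i" using xr[of s] \<open>s \<in> {0..<1}\<close> that by auto
  qed
  have n1: "x s1 \<notin> existing (\<sigma> (i + 1))" "x s2 \<notin> existing (\<sigma> (i + 1))"
    by (rule nonex; use s1 s2 s12 s21 \<delta>_pos in auto)+
  have sub: "x ` {a..b} \<subseteq> existing (\<tau> i)" if "0 \<le> a" "b \<le> 1" for a b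
    using xr that by auto
  \<comment> \<open>One gate is sought from \<open>x s1\<close> back to the dead datum
    \<open>x 0\<close>, the other from \<open>x s2\<close> on to \<open>x 1\<close>; disjoint
    parameter ranges and injectivity of the path separate them.\<close>
  have seg1: "closed_segment (x s1) (x 0) = x ` {0..s1}"
    using lin[of 0 s1] s1 by (simp add: closed_segment_commute)
  have seg2: "closed_segment (x s2) (x 1) = x ` {s2..1}"
    using lin[of s2 1] s1 s2 by simp
  have dead0: "x 0 \<in> existing (\<sigma> (i + 1))" "U (x 0) (\<sigma> (i + 1)) \<le> 0"
    using dead_after_hump[OF i _ _ _ d0] xr[of 0] of by auto
  have dead1: "x 1 \<in> existing (\<sigma> (i + 1))" "U (x 1) (\<sigma> (i + 1)) \<le> 0"
    using dead_after_hump[OF i _ _ _ d1] xr[of 1] of by auto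
  obtain p1 e1 where g1: "gate i p1 e1" "p1 \<in> x ` {0..s1}" "e1 \<in> x ` {0..s1}"
    using gate_exists[OF i n1(1) dead0] seg1 sub[of 0 s1] s1 by auto
  obtain p2 e2 where g2: "gate i p2 e2" "p2 \<in> x ` {s2..1}" "e2 \<in> x ` {s2..1}"
    using gate_exists[OF i n1(2) dead1] seg2 sub[of s2 1] s1 s2 by auto
  have "closed_segment p1 e1 \<subseteq> closed_segment (x s1) (x 0)"
    by (rule closed_segment_subset) (use g1(2,3) in \<open>simp_all only: seg1[symmetric] convex_closed_segment\<close>)
  then have c1: "closed_segment p1 e1 \<subseteq> x ` {0..s1}" by (simp only: seg1)
  have "closed_segment p2 e2 \<subseteq> closed_segment (x s2) (x 1)"
    by (rule closed_segment_subset) (use g2(2,3) in \<open>simp_all only: seg2[symmetric] convex_closed_segment\<close>)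
  then have c2: "closed_segment p2 e2 \<subseteq> x ` {s2..1}" by (simp only: seg2)
  have "x ` {0..s1} \<inter> x ` {s2..1} = {}"
    using inj_on_image_Int[OF inj, of "{0..s1}" "{s2..1}"] s12 s1 s2 by auto
  moreover have "x ` {0..s1} \<subseteq> x ` {0..1}" "x ` {s2..1} \<subseteq> x ` {0..1}" using s1 s2 by auto
  ultimately have "closed_segment p1 e1 \<subseteq> x ` {0..1}" "closed_segment p2 e2 \<subseteq> x ` {0..1}"
    "closed_segment p1 e1 \<inter> closed_segment p2 e2 = {}"
    using c1 c2 by (meson disjoint_iff subset_iff)+
  then show ?thesis using g1(1) g2(1) by metis
qed

lemma affine_path:
  fixes p e :: real
  assumes "p \<noteq> e" and x: "\<And>s. x s = p + s * (e - p)"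
  shows "continuous_on S x" "inj_on x S" "a \<le> b \<Longrightarrow> closed_segment (x a) (x b) = x ` {a..b}"
proof -
  show "continuous_on S x" unfolding x by (intro continuous_intros)
  show "inj_on x S" using assms by (auto simp: inj_on_def x)
  assume ab: "a \<le> b"
  have xf: "x = (\<lambda>s. (e - p) * s + p)" by (auto simp: x mult.commute)
  show "closed_segment (x a) (x b) = x ` {a..b}"
    using closed_segment_linear_image[of "\<lambda>s. (e - p) * s" a b] closed_segment_translation[of p "(e - p) * a" "(e - p) * b"] ab
    unfolding xf by (simp add: image_image closed_segment_eq_real_ivl linear_times add.commute)
qed

text \<open>A datum \<open>p'\<close> of the gate close to \<open>p\<close> enters the next hump
  higher than any survivor may be, so it dies on the hump; the datum \<open>e\<close> enters with
  value 0 and is dead as well. All data in between enter positive, as \<open>two_gates\<close>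
  requires.\<close>

lemma gate_splits:
  assumes i: "i + 1 \<in> {2..m}" and g: "gate i p e" and seg: "closed_segment p e \<subseteq> {0..D}"
  shows "\<exists>p1 e1 p2 e2. gate (i + 1) p1 e1 \<and> gate (i + 1) p2 e2 \<and> closed_segment p1 e1 \<subseteq> closed_segment p e \<and>
    closed_segment p2 e2 \<subseteq> closed_segment p e \<and> closed_segment p1 e1 \<inter> closed_segment p2 e2 = {}"
proof -
  have i1: "i \<in> {1..m}" and j: "i + 1 \<in> {1..m}" using i by auto
  note ofi = order_facts[OF i1] and ofj = order_facts[OF j]
  have pe: "p \<noteq> e" using g by (auto simp: gate_def)
  have p: "p \<in> existing (\<tau> i)" "p \<notin> existing (\<sigma> (i + 1))" using g by (auto simp: gate_def)
  \<comment> \<open>\<open>M + 1\<close> contradicts the a priori bound for survivors, and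
    \<open>\<delta> + 1\<close> puts the hump of \<open>p'\<close> above \<delta>.\<close>
  obtain h where h: "h > 0" "\<And>d. \<bar>d - p\<bar> < h \<Longrightarrow> d \<in> existing (\<sigma> (i + 1)) \<Longrightarrow> U d (\<sigma> (i + 1)) \<ge> max (\<delta> + 1) (M + 1)"
    using large_near_blowup[OF i1 p, of "max (\<delta> + 1) (M + 1)"] ofi by auto
  obtain p' where p'o: "p' \<in> open_segment p e" and p'p: "\<bar>p' - p\<bar> < h"
    using open_segment_near[OF pe h(1)] by blast
  have p'e: "p' \<noteq> e" using p'o by (auto simp: open_segment_def)
  define x where "x s = p' + s * (e - p')" for s
  have x01: "x 0 = p'" "x 1 = e" by (auto simp: x_def)
  note aff = affine_path[OF p'e x_def]
  have img: "x ` {0..1} = closed_segment p' e" using aff(3)[of 0 1] x01 by simp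
  have sub: "closed_segment p' e \<subseteq> closed_segment p e"
    using p'o by (intro closed_segment_subset) (auto simp: open_segment_def)
  have notp: "p \<notin> closed_segment p' e"
    using p'o by (auto simp: open_segment_def closed_segment_eq_real_ivl split: if_splits)
  have xs: "x s \<in> closed_segment p e" "x s \<noteq> p" if "s \<in> {0..1}" for s
    using img sub notp that by auto
  have xe: "x s \<noteq> e" if "s < 1" for s
  proof
    assume "x s = e"
    then have "(1 - s) * (e - p') = 0" by (simp add: x_def algebra_simps)
    then show False using that p'e by auto
  qed
  have ex: "x s \<in> existing (\<sigma> (i + 1))" if "s \<in> {0..1}" for s
    using existing_gate[OF i1 g xs[OF that]] .
  have ex\<tau>: "x s \<in> existing (\<tau> (i + 1))" if "s \<in> {0..1}" for s
    using extend_hump[OF j ex[OF that]] .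
  have big: "U p' (\<sigma> (i + 1)) \<ge> max (\<delta> + 1) (M + 1)" using h(2)[OF p'p] ex[of 0] x01 by auto
  have range: "0 \<le> x s" "x s \<le> D" if "s \<in> {0..1}" for s using xs(1)[OF that] seg by auto
  have p'0: "p' > 0"
  proof -
    have "p' \<noteq> 0" using big zero_solution(2)[of "\<sigma> (i + 1)"] \<delta>_pos ofi by auto
    then show ?thesis using range[of 0] x01 by auto
  qed
  have dead: "U p' (\<tau> (i + 1)) \<le> 0"
  proof (rule ccontr)
    assume "\<not> ?thesis"
    then have al: "U p' (\<tau> (i + 1)) > 0" by simp
    have e\<tau>: "p' \<in> existing (\<tau> (i + 1))" using ex\<tau>[of 0] x01 by simp
    have "ode_on n q f (\<sigma> (i + 1)) (\<tau> (i + 1)) (U p') (Y p')"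
      by (rule ode_on_subset[OF existing_ode[OF e\<tau>]]) (use ofj in auto)
    then have "U p' (\<sigma> (i + 1)) \<le> M"
      by (rule bound[OF i]) (use positive_before[OF p'0 e\<tau> _ al] ofj in auto)
    then show False using big by simp
  qed
  have e0: "e \<ge> 0" "e \<in> existing (\<tau> (i + 1))" "U e (\<sigma> (i + 1)) = 0"
    using range[of 1] ex\<tau>[of 1] x01 g by (auto simp: gate_def)
  have eneg: "U e r \<le> 0" if "r \<in> {\<sigma> (i + 1)..\<tau> (i + 1)}" for r
  proof (cases "e = 0 \<or> r = \<sigma> (i + 1)")
    case True
    then show ?thesis using zero_solution(2)[of r] that ofj e0 by auto
  next
    case False
    then show ?thesis
      using negative_afterwards[OF _ e0(2), of "\<sigma> (i + 1)" r] e0 that ofj by (auto simp: less_imp_le)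
  qed
  obtain r where r: "r \<in> {\<sigma> (i + 1)..\<tau> (i + 1)}" "hump (\<sigma> (i + 1)) (\<tau> (i + 1)) (x 1) = U (x 1) r"
    using hump_attained[OF ex\<tau>[of 1], of "\<sigma> (i + 1)"] ofj by auto
  obtain r' where r': "r' \<in> {\<sigma> (i + 1)..\<tau> (i + 1)}" "hump (\<sigma> (i + 1)) (\<tau> (i + 1)) (x 0) = U (x 0) r'"
    "\<And>s. s \<in> {\<sigma> (i + 1)..\<tau> (i + 1)} \<Longrightarrow> U (x 0) s \<le> U (x 0) r'"
    using hump_attained[OF ex\<tau>[of 0], of "\<sigma> (i + 1)"] ofj by auto
  have "\<exists>p1 e1 p2 e2. gate (i + 1) p1 e1 \<and> gate (i + 1) p2 e2 \<and> closed_segment p1 e1 \<subseteq> x ` {0..1} \<and>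
    closed_segment p2 e2 \<subseteq> x ` {0..1} \<and> closed_segment p1 e1 \<inter> closed_segment p2 e2 = {}"
  proof (rule two_gates[OF j aff(1) aff(3) aff(2)])
    fix s :: real assume s: "s \<in> {0..1}"
    have "U (x s) (\<sigma> (i + 1)) > 0" if "s < 1"
      using g xs[OF s] xe[OF that] by (auto simp: gate_def open_segment_def)
    then show "0 \<le> x s \<and> x s \<le> D \<and> x s \<in> existing (\<tau> (i + 1)) \<and>
       (i + 1 \<ge> 2 \<longrightarrow> s < 1 \<longrightarrow> U (x s) (\<sigma> (i + 1)) > 0)"
      using range[OF s] ex\<tau>[OF s] by auto
  next
    have "U (x 0) (\<sigma> (i + 1)) \<le> U (x 0) r'" by (rule r'(3)) (use ofj in auto)
    then show "hump (\<sigma> (i + 1)) (\<tau> (i + 1)) (x 0) > \<delta>" using r'(2) big x01 by simp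
    show "hump (\<sigma> (i + 1)) (\<tau> (i + 1)) (x 1) \<le> 0" using r eneg x01 by auto
    show "U (x 0) (\<tau> (i + 1)) \<le> 0" using dead x01 by simp
    show "U (x 1) (\<tau> (i + 1)) \<le> 0" using eneg[of "\<tau> (i + 1)"] x01 ofj by auto
  qed auto
  then show ?thesis unfolding img using sub by blast
qed

text \<open>The path runs from \<open>D\<close>, whose solution is zero at the end of the first hump
  by the Dirichlet hypothesis, down to the zero solution. On the first hump the height of a solution
  is its datum.\<close>

lemma first_gates:
  "\<exists>p1 e1 p2 e2. gate 1 p1 e1 \<and> gate 1 p2 e2 \<and> closed_segment p1 e1 \<subseteq> {0..D} \<and>
    closed_segment p2 e2 \<subseteq> {0..D} \<and> closed_segment p1 e1 \<inter> closed_segment p2 e2 = {}"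
proof -
  define x where "x s = D + s * (0 - D)" for s
  have D0: "D \<noteq> 0" using D_pos by simp
  note aff = affine_path[OF D0 x_def]
  have x01: "x 0 = D" "x 1 = 0" by (auto simp: x_def)
  have img: "x ` {0..1} = {0..D}"
    using aff(3)[of 0 1] x01 D_pos by (simp add: closed_segment_eq_real_ivl)
  have one: "1 \<in> {1..m}" using m_ge by auto
  note of = order_facts[OF one]
  have hump1: "hump (\<sigma> 1) (\<tau> 1) d = d" for d
  proof -
    obtain r where r: "r \<in> {\<sigma> 1..\<tau> 1}" "hump (\<sigma> 1) (\<tau> 1) d = U d r"
      "\<And>s. s \<in> {\<sigma> 1..\<tau> 1} \<Longrightarrow> U d s \<le> U d r"
      using hump_attained[OF existing_first[of d], of "\<sigma> 1"] of by auto
    show ?thesis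
      using r(3)[of 0] r(1,2) first_hump_le[OF existing_first[of d], of r] U_0[OF existing_first[of d]] of sigma_first
      by auto
  qed
  have "\<exists>p1 e1 p2 e2. gate 1 p1 e1 \<and> gate 1 p2 e2 \<and> closed_segment p1 e1 \<subseteq> x ` {0..1} \<and>
    closed_segment p2 e2 \<subseteq> x ` {0..1} \<and> closed_segment p1 e1 \<inter> closed_segment p2 e2 = {}"
  proof (rule two_gates[OF one aff(1) aff(3) aff(2)])
    fix s :: real assume "s \<in> {0..1}"
    then have "x s \<in> {0..D}" using img by blast
    then show "0 \<le> x s \<and> x s \<le> D \<and> x s \<in> existing (\<tau> 1) \<and> (1 \<ge> (2::nat) \<longrightarrow> s < 1 \<longrightarrow> U (x s) (\<sigma> 1) > 0)"
      using existing_first by auto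
  next
    show "U (x 1) (\<tau> 1) \<le> 0" using zero_solution(2)[of "\<tau> 1"] x01 of by simp
  qed (use hump1 x01 \<delta>_pos dirichlet existing_first in auto)
  then show ?thesis unfolding img .
qed

lemma card_final:
  assumes "i \<in> {1..m}" "gate i p e" "closed_segment p e \<subseteq> {0..D}" "i + k = m"
  shows "\<exists>S. finite S \<and> card S = 2 ^ k \<and> S \<subseteq> closed_segment p e \<and> (\<forall>d\<in>S. final d)"
  using assms
proof (induction k arbitrary: i p e)
  case 0
  then have "final p" using gate_last_final by simp
  then show ?case by (intro exI[of _ "{p}"]) auto
next
  case (Suc k)
  have i2: "i + 1 \<in> {2..m}" "i + 1 \<in> {1..m}" using Suc.prems by auto
  from gate_splits[OF i2(1) Suc.prems(2,3)] obtain p1 e1 p2 e2 where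
    g: "gate (i + 1) p1 e1" "gate (i + 1) p2 e2" and
    sub: "closed_segment p1 e1 \<subseteq> closed_segment p e" "closed_segment p2 e2 \<subseteq> closed_segment p e" and
    disj: "closed_segment p1 e1 \<inter> closed_segment p2 e2 = {}" by blast
  obtain S1 where S1: "finite S1" "card S1 = 2 ^ k" "S1 \<subseteq> closed_segment p1 e1" "\<forall>d\<in>S1. final d"
    using Suc.IH[OF i2(2) g(1)] sub Suc.prems by auto
  obtain S2 where S2: "finite S2" "card S2 = 2 ^ k" "S2 \<subseteq> closed_segment p2 e2" "\<forall>d\<in>S2. final d"
    using Suc.IH[OF i2(2) g(2)] sub Suc.prems by auto
  have "S1 \<inter> S2 = {}" using S1 S2 disj by blast
  then have "card (S1 \<union> S2) = 2 ^ Suc k" using S1 S2 by (simp add: card_Un_disjoint)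
  then show ?case using S1 S2 sub by (intro exI[of _ "S1 \<union> S2"]) auto
qed

section \<open>The data that blow up exactly at 1\<close>

lemma final_solutions:
  "\<exists>S. finite S \<and> card S = 2 ^ m \<and> S \<subseteq> {0..D} \<and> (\<forall>d\<in>S. final d)"
proof -
  from first_gates obtain p1 e1 p2 e2 where
    g: "gate 1 p1 e1" "gate 1 p2 e2" and
    sub: "closed_segment p1 e1 \<subseteq> {0..D}" "closed_segment p2 e2 \<subseteq> {0..D}" and
    disj: "closed_segment p1 e1 \<inter> closed_segment p2 e2 = {}" by blast
  have one: "1 \<in> {1..m}" "1 + (m - 1) = m" using m_ge by auto
  obtain S1 where S1: "finite S1" "card S1 = 2 ^ (m - 1)" "S1 \<subseteq> closed_segment p1 e1" "\<forall>d\<in>S1. final d"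
    using card_final[OF one(1) g(1) sub(1) one(2)] by blast
  obtain S2 where S2: "finite S2" "card S2 = 2 ^ (m - 1)" "S2 \<subseteq> closed_segment p2 e2" "\<forall>d\<in>S2. final d"
    using card_final[OF one(1) g(2) sub(2) one(2)] by blast
  have "S1 \<inter> S2 = {}" using S1 S2 disj by blast
  then have "card (S1 \<union> S2) = 2 ^ (m - 1) + 2 ^ (m - 1)" using S1 S2 by (simp add: card_Un_disjoint)
  also have "\<dots> = 2 ^ m" using m_ge by (cases m) auto
  finally show ?thesis using S1 S2 sub by (intro exI[of _ "S1 \<union> S2"]) auto
qed

lemma final_positive:
  assumes d: "final d" "0 \<le> d" and t: "t \<in> {0..<1}"
  shows "U d t > 0"
proof (rule ccontr)
  assume "\<not> U d t > 0"
  have "d \<noteq> 0" using zero_solution(1)[of 1] d by (auto simp: final_def)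
  moreover have "d \<in> existing t" using d t by (auto simp: final_def)
  ultimately have "d \<in> existing 1"
    using extend_dead[of d t 1] d t \<open>\<not> U d t > 0\<close> by auto
  then show False using d by (simp add: final_def)
qed

text \<open>Nonexistence up to 1 only says that arbitrarily high levels are reached. A level above
  all values up to the end of the last hump is never undercut again, by \<open>rising\<close>; this
  turns reaching into convergence.\<close>

lemma final_blowup:
  assumes d: "final d"
  shows "filterlim (U d) at_top (at_left 1)"
  unfolding filterlim_at_top
proof
  fix K :: real
  have m: "m \<in> {1..m}" using m_ge by auto
  note of = order_facts[OF m]
  have d1: "d \<notin> existing 1" "\<And>t. t < 1 \<Longrightarrow> d \<in> existing t" using d by (auto simp: final_def)
  obtain B where B: "B > 0" "\<And>x. x \<in> {0..\<tau> m} \<Longrightarrow> \<bar>U d x\<bar> \<le> B"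
    using continuous_on_bounded_Icc[OF U_continuous[OF d1(2)[OF of(6)]]] of by auto
  define K' where "K' = max K B + \<bar>d\<bar> + 1"
  have "d < K'" using B(1) unfolding K'_def by linarith
  then obtain s where s: "s \<in> {0..1}" "d \<in> existing s" "U d s = K'"
    using blowup_reaches[OF d1(1), of K'] by auto
  have s1: "s < 1" using d1(1) s by (cases "s = 1") auto
  have s\<tau>: "\<tau> m < s" using B(2)[of s] s by (cases "s \<le> \<tau> m") (auto simp: K'_def)
  have less: "U d (\<tau> m) < U d s" using B(2)[of "\<tau> m"] s of by (auto simp: K'_def)
  have "K \<le> U d t" if "s < t" "t < 1" for t
  proof -
    have "U d s \<le> U d t"
      by (rule rising(1)[OF m d1(2) _ _ _ less]) (use that s\<tau> sigma_last in auto)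
    then show ?thesis using s by (simp add: K'_def)
  qed
  then show "\<forall>\<^sub>F t in at_left 1. K \<le> U d t"
    unfolding eventually_at_left_field using s1 by blast
qed

end

section \<open>Radial functions\<close>

lemma norm_line_deriv:
  fixes x b :: "'a::euclidean_space"
  assumes "x \<noteq> 0"
  shows "((\<lambda>t. norm (x + t *\<^sub>R b)) has_real_derivative (x \<bullet> b) / norm x) (at 0)"
proof -
  have d: "((\<lambda>t. x \<bullet> x + 2 * t * (x \<bullet> b) + t * t * (b \<bullet> b)) has_real_derivative 2 * (x \<bullet> b)) (at 0)"
    by (auto intro!: derivative_eq_intros)
  have "(sqrt has_real_derivative inverse (sqrt (x \<bullet> x)) / 2) (at (x \<bullet> x + 2 * 0 * (x \<bullet> b) + 0 * 0 * (b \<bullet> b)))"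
    using DERIV_real_sqrt[of "x \<bullet> x"] assms by simp
  from DERIV_chain2[OF this d]
  have "((\<lambda>t. sqrt (x \<bullet> x + 2 * t * (x \<bullet> b) + t * t * (b \<bullet> b))) has_real_derivative
     inverse (sqrt (x \<bullet> x)) / 2 * (2 * (x \<bullet> b))) (at 0)" .
  moreover have "norm (x + t *\<^sub>R b) = sqrt (x \<bullet> x + 2 * t * (x \<bullet> b) + t * t * (b \<bullet> b))" for t
    by (simp add: norm_eq_sqrt_inner inner_add_left inner_add_right inner_commute algebra_simps)
  ultimately show ?thesis by (simp add: norm_eq_sqrt_inner field_simps)
qed

lemma line_in_ball:
  fixes x b :: "'a::euclidean_space"
  assumes "x \<in> ball 0 R"
  shows "\<forall>\<^sub>F t in nhds 0. x + t *\<^sub>R b \<in> ball 0 R"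
proof -
  have "((\<lambda>t. x + t *\<^sub>R b) \<longlongrightarrow> x + 0 *\<^sub>R b) (nhds 0)" by (intro tendsto_intros filterlim_ident)
  then show ?thesis using topological_tendstoD[of _ "x + 0 *\<^sub>R b" _ "ball 0 R"] assms by auto
qed

lemma line_nonzero:
  fixes x b :: "'a::euclidean_space"
  assumes "x \<noteq> 0"
  shows "\<forall>\<^sub>F t in nhds 0. x + t *\<^sub>R b \<noteq> 0"
proof -
  have "((\<lambda>t. x + t *\<^sub>R b) \<longlongrightarrow> x + 0 *\<^sub>R b) (nhds 0)" by (intro tendsto_intros filterlim_ident)
  then show ?thesis using topological_tendstoD[of _ "x + 0 *\<^sub>R b" _ "- {0}"] assms by auto
qed

text \<open>\<open>p\<close> and \<open>pp\<close> stand for the first two derivatives of the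
  profile. They are parameters because they come from partial derivatives for the Dirichlet solution
  and from the flux for the blow-up solutions.\<close>

locale radial_function =
  fixes R :: real and u :: "'a::euclidean_space \<Rightarrow> real" and v p pp :: "real \<Rightarrow> real" and n :: nat
  assumes R_pos: "R > 0" and dim: "DIM('a) = n + 1"
    and u_eq: "\<And>x. x \<in> ball 0 R \<Longrightarrow> u x = v (norm x)"
    and v_deriv: "\<And>r. r \<in> {0<..<R} \<Longrightarrow> (v has_real_derivative p r) (at r)"
    and p_deriv: "\<And>r. r \<in> {0<..<R} \<Longrightarrow> (p has_real_derivative pp r) (at r)"
begin

lemma u_line_deriv:
  assumes x: "x \<in> ball 0 R" "x \<noteq> 0"
  shows "((\<lambda>t. u (x + t *\<^sub>R b)) has_real_derivative p (norm x) / norm x * (x \<bullet> b)) (at 0)"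
proof -
  have "((\<lambda>t. v (norm (x + t *\<^sub>R b))) has_real_derivative p (norm x) * ((x \<bullet> b) / norm x)) (at 0)"
    by (rule DERIV_chain2[OF _ norm_line_deriv[OF x(2)]]) (use v_deriv x in simp)
  then have "((\<lambda>t. u (x + t *\<^sub>R b)) has_real_derivative p (norm x) * ((x \<bullet> b) / norm x)) (at 0)"
    by (rule DERIV_cong_ev[THEN iffD1, rotated 3])
       (use eventually_mono[OF line_in_ball[OF x(1), of b]] u_eq in auto)
  then show ?thesis by (simp add: mult.commute)
qed

lemma partial_u:
  assumes x: "x \<in> ball 0 R" "x \<noteq> 0"
  shows "partial_deriv b u x = p (norm x) / norm x * (x \<bullet> b)"
  unfolding partial_deriv_def by (rule DERIV_imp_deriv[OF u_line_deriv[OF x]])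

text \<open>The Hessian of a radial function: \<open>v' / r\<close> times the identity, plus a
  radial term with coefficient \<open>v'' - v' / r\<close>.\<close>

lemma partial_u_line_deriv:
  assumes x: "x \<in> ball 0 R" "x \<noteq> 0"
  shows "((\<lambda>t. partial_deriv b u (x + t *\<^sub>R c)) has_real_derivative
    (pp (norm x) - p (norm x) / norm x) / (norm x)\<^sup>2 * (x \<bullet> c) * (x \<bullet> b) + p (norm x) / norm x * (b \<bullet> c)) (at 0)"
proof -
  have nx: "norm x > 0" using x by simp
  have d: "((\<lambda>r. p r / r) has_real_derivative (pp (norm x) - p (norm x) / norm x) / norm x) (at (norm (x + 0 *\<^sub>R c)))"
    using DERIV_divide[OF p_deriv[of "norm x"] DERIV_ident] x nx by (simp add: field_simps power2_eq_square)
  have l: "((\<lambda>t. (x + t *\<^sub>R c) \<bullet> b) has_real_derivative c \<bullet> b) (at 0)"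
    by (auto simp: inner_add_left intro!: derivative_eq_intros)
  have "((\<lambda>t. p (norm (x + t *\<^sub>R c)) / norm (x + t *\<^sub>R c) * ((x + t *\<^sub>R c) \<bullet> b)) has_real_derivative
     (pp (norm x) - p (norm x) / norm x) / norm x * ((x \<bullet> c) / norm x) * ((x + 0 *\<^sub>R c) \<bullet> b) +
     (c \<bullet> b) * (p (norm (x + 0 *\<^sub>R c)) / norm (x + 0 *\<^sub>R c))) (at 0)"
    by (rule DERIV_mult[OF DERIV_chain2[OF d norm_line_deriv[OF x(2)]] l])
  then have "((\<lambda>t. partial_deriv b u (x + t *\<^sub>R c)) has_real_derivative
     (pp (norm x) - p (norm x) / norm x) / norm x * ((x \<bullet> c) / norm x) * ((x + 0 *\<^sub>R c) \<bullet> b) +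
     (c \<bullet> b) * (p (norm (x + 0 *\<^sub>R c)) / norm (x + 0 *\<^sub>R c))) (at 0)"
    by (rule DERIV_cong_ev[THEN iffD1, rotated 3])
       (use eventually_mono[OF eventually_conj[OF line_in_ball[OF x(1), of c] line_nonzero[OF x(2), of c]]]
         partial_u in auto)
  then show ?thesis by (simp add: power2_eq_square inner_commute mult_ac)
qed

lemma laplacian_u:
  assumes x: "x \<in> ball 0 R" "x \<noteq> 0"
  shows "laplacian u x = pp (norm x) + real n * (p (norm x) / norm x)"
proof -
  define w where "w = p (norm x) / norm x"
  define z where "z = (pp (norm x) - w) / (norm x)\<^sup>2"
  have "laplacian u x = (\<Sum>b\<in>Basis. z * ((x \<bullet> b) * (x \<bullet> b)) + w)"
    unfolding laplacian_def
  proof (rule sum.cong[OF refl])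
    fix b :: 'a assume "b \<in> Basis"
    then show "partial_deriv b (partial_deriv b u) x = z * ((x \<bullet> b) * (x \<bullet> b)) + w"
      unfolding partial_deriv_def[of b "partial_deriv b u" x]
      by (intro DERIV_imp_deriv)
         (use partial_u_line_deriv[OF x, of b b] in \<open>simp add: mult.assoc z_def w_def\<close>)
  qed
  also have "\<dots> = z * (\<Sum>b\<in>Basis. (x \<bullet> b) * (x \<bullet> b)) + w * real DIM('a)"
    by (simp add: sum.distrib sum_distrib_left[symmetric])
  also have "(\<Sum>b\<in>Basis. (x \<bullet> b) * (x \<bullet> b)) = (norm x)\<^sup>2"
    by (simp add: power2_norm_eq_inner euclidean_inner[symmetric])
  also have "z * (norm x)\<^sup>2 = pp (norm x) - w" using x by (simp add: z_def)
  finally show ?thesis using dim unfolding w_def[symmetric] by (simp add: algebra_simps)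
qed

end

lemma filterlim_norm_at_right_0: "filterlim norm (at_right 0) (at (0::'a::real_normed_vector))"
  unfolding filterlim_at
  by (auto intro!: tendsto_norm_zero tendsto_ident_at simp: eventually_at_filter)

lemma continuous_on_ball_puncture:
  fixes F :: "'a::euclidean_space \<Rightarrow> real"
  assumes "continuous_on (ball 0 R - {0}) F" "(F \<longlongrightarrow> F 0) (at 0)"
  shows "continuous_on (ball 0 R) F"
proof -
  have "isCont F x" if "x \<in> ball 0 R" for x
  proof (cases "x = 0")
    case True
    then show ?thesis using assms(2) by (simp add: isCont_def)
  next
    case False
    then show ?thesis using assms(1) that
      by (subst (asm) continuous_on_eq_continuous_at) (auto intro!: open_Diff)
  qed
  then show ?thesis by (simp add: continuous_at_imp_continuous_on)
qed

text \<open>What the profile must satisfy for \<open>u\<close> to be twice continuously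
  differentiable at the origin: zero slope, and a common limit \<open>L\<close> of
  \<open>v' / r\<close> and \<open>v''\<close>. The two parts of the Hessian then extend by
  \<open>L\<close> and 0; these are \<open>W\<close> and \<open>Z\<close>.\<close>

locale smooth_radial_function = radial_function R u v p pp n
  for R and u :: "'a::euclidean_space \<Rightarrow> real" and v p pp n +
  fixes L :: real
  assumes v_0: "((\<lambda>t. (v t - v 0) / t) \<longlongrightarrow> 0) (at_right 0)"
    and w_0: "((\<lambda>r. p r / r) \<longlongrightarrow> L) (at_right 0)"
    and z_0: "((\<lambda>r. pp r - p r / r) \<longlongrightarrow> 0) (at_right 0)"
    and pp_cont: "continuous_on {0<..<R} pp"
begin

definition W :: "'a \<Rightarrow> real" where "W x = (if x = 0 then L else p (norm x) / norm x)"

definition Z :: "'a \<Rightarrow> 'a \<Rightarrow> 'a \<Rightarrow> real" where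
  "Z b c x = (if x = 0 then 0 else (pp (norm x) - p (norm x) / norm x) / (norm x)\<^sup>2 * (x \<bullet> c) * (x \<bullet> b))"

lemma p_cont: "continuous_on {0<..<R} p"
  using p_deriv DERIV_isCont by (blast intro: continuous_at_imp_continuous_on)

lemma norm_comp_continuous:
  assumes "continuous_on {0<..<R} k"
  shows "continuous_on (ball (0::'a) R - {0}) (\<lambda>x. k (norm x))"
  by (rule continuous_on_compose2[OF assms]) (auto intro!: continuous_intros)

lemma W_tendsto: "(W \<longlongrightarrow> L) (at 0)"
proof -
  have "((\<lambda>x::'a. p (norm x) / norm x) \<longlongrightarrow> L) (at 0)"
    using filterlim_compose[OF w_0 filterlim_norm_at_right_0] .
  then show ?thesis
    by (rule Lim_transform_eventually) (auto simp: W_def eventually_at_filter)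
qed

lemma W_cont: "continuous_on (ball 0 R) W"
proof (rule continuous_on_ball_puncture)
  have "continuous_on (ball (0::'a) R - {0}) (\<lambda>x. p (norm x) / norm x)"
    by (intro continuous_intros norm_comp_continuous p_cont) auto
  then show "continuous_on (ball 0 R - {0}) W"
    by (rule continuous_on_eq) (auto simp: W_def)
  show "(W \<longlongrightarrow> W 0) (at 0)" using W_tendsto by (simp add: W_def)
qed

text \<open>The factor \<open>(x \<bullet> c) * (x \<bullet> b) / (norm x)\<^sup>2\<close> has in
  general no limit at 0 but is bounded by 1, and its coefficient tends to 0.\<close>

lemma Z_cont:
  assumes "b \<in> Basis" "c \<in> Basis"
  shows "continuous_on (ball 0 R) (Z b c)"
proof (rule continuous_on_ball_puncture)
  have "continuous_on (ball (0::'a) R - {0})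
    (\<lambda>x. (pp (norm x) - p (norm x) / norm x) / (norm x)\<^sup>2 * (x \<bullet> c) * (x \<bullet> b))"
    by (intro continuous_intros norm_comp_continuous p_cont pp_cont) auto
  then show "continuous_on (ball 0 R - {0}) (Z b c)"
    by (rule continuous_on_eq) (auto simp: Z_def)
  have lim: "((\<lambda>x::'a. \<bar>pp (norm x) - p (norm x) / norm x\<bar>) \<longlongrightarrow> 0) (at 0)"
    using filterlim_compose[OF z_0 filterlim_norm_at_right_0] by (rule tendsto_rabs_zero)
  have "\<bar>Z b c x\<bar> \<le> \<bar>pp (norm x) - p (norm x) / norm x\<bar>" if "x \<noteq> 0" for x
  proof -
    have "\<bar>x \<bullet> c\<bar> * \<bar>x \<bullet> b\<bar> \<le> norm x * norm x"
      using Basis_le_norm[OF assms(1)] Basis_le_norm[OF assms(2)] by (intro mult_mono) auto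
    then have "\<bar>x \<bullet> c\<bar> * \<bar>x \<bullet> b\<bar> / (norm x)\<^sup>2 \<le> 1" using that by (simp add: power2_eq_square)
    then have "\<bar>pp (norm x) - p (norm x) / norm x\<bar> * (\<bar>x \<bullet> c\<bar> * \<bar>x \<bullet> b\<bar> / (norm x)\<^sup>2)
        \<le> \<bar>pp (norm x) - p (norm x) / norm x\<bar> * 1" by (rule mult_left_mono) auto
    then show ?thesis using that by (simp add: Z_def abs_mult mult.assoc)
  qed
  then have "(Z b c \<longlongrightarrow> 0) (at 0)"
    by (intro Lim_null_comparison[OF _ lim]) (auto simp: eventually_at_filter)
  then show "(Z b c \<longlongrightarrow> Z b c 0) (at 0)" by (simp add: Z_def)
qed

lemma u_deriv_all:
  assumes b: "b \<in> Basis" and x: "x \<in> ball 0 R"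
  shows "((\<lambda>t. u (x + t *\<^sub>R b)) has_real_derivative W x * (x \<bullet> b)) (at 0)"
proof (cases "x = 0")
  case False
  then show ?thesis using u_line_deriv[OF x] by (simp add: W_def)
next
  case True
  have "((\<lambda>t::real. (v (norm t) - v 0) / norm t) \<longlongrightarrow> 0) (at 0)"
    using filterlim_compose[OF v_0 filterlim_norm_at_right_0] .
  then have "((\<lambda>t::real. norm ((v \<bar>t\<bar> - v 0) / t)) \<longlongrightarrow> 0) (at 0)"
    by (auto dest: tendsto_rabs_zero)
  then have "((\<lambda>t::real. (v \<bar>t\<bar> - v 0) / t) \<longlongrightarrow> 0) (at 0)" by (rule tendsto_norm_zero_cancel)
  then have "((\<lambda>t. v \<bar>t\<bar>) has_real_derivative 0) (at 0)"
    by (simp add: has_field_derivative_iff)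
  then have "((\<lambda>t. u (x + t *\<^sub>R b)) has_real_derivative 0) (at 0)"
    by (rule DERIV_cong_ev[THEN iffD1, rotated 3])
       (use eventually_mono[OF line_in_ball[OF x, of b]] u_eq True b in auto)
  then show ?thesis using True by simp
qed

lemma partial_u_all:
  assumes "b \<in> Basis" "x \<in> ball 0 R"
  shows "partial_deriv b u x = W x * (x \<bullet> b)"
  unfolding partial_deriv_def by (rule DERIV_imp_deriv[OF u_deriv_all[OF assms]])

lemma partial_u_deriv_all:
  assumes b: "b \<in> Basis" and x: "x \<in> ball 0 R"
  shows "((\<lambda>t. partial_deriv b u (x + t *\<^sub>R c)) has_real_derivative Z b c x + W x * (b \<bullet> c)) (at 0)"
proof (cases "x = 0")
  case False
  then show ?thesis using partial_u_line_deriv[OF x] by (simp add: W_def Z_def)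
next
  case True
  have line: "((\<lambda>t. t *\<^sub>R c) \<longlongrightarrow> 0) (at (0::real))" by (auto intro!: tendsto_eq_intros)
  have "isCont W 0" using W_tendsto by (simp add: isCont_def W_def)
  from isCont_tendsto_compose[OF this line]
  have "((\<lambda>t. W (t *\<^sub>R c) * (b \<bullet> c)) \<longlongrightarrow> L * (b \<bullet> c)) (at 0)"
    by (intro tendsto_intros) (simp add: W_def)
  then have "((\<lambda>t. W (t *\<^sub>R c) * ((t *\<^sub>R c) \<bullet> b)) has_real_derivative L * (b \<bullet> c)) (at 0)"
    unfolding has_field_derivative_iff
    by (rule Lim_transform_eventually) (auto simp: eventually_at_filter inner_commute)
  then have "((\<lambda>t. partial_deriv b u (x + t *\<^sub>R c)) has_real_derivative L * (b \<bullet> c)) (at 0)"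
    by (rule DERIV_cong_ev[THEN iffD1, rotated 3])
       (use eventually_mono[OF line_in_ball[OF x, of c]] partial_u_all[OF b] True in auto)
  then show ?thesis using True by (simp add: W_def Z_def)
qed

lemma partial2_u:
  assumes "b \<in> Basis" "x \<in> ball 0 R"
  shows "partial_deriv c (partial_deriv b u) x = Z b c x + W x * (b \<bullet> c)"
  unfolding partial_deriv_def[of c] by (rule DERIV_imp_deriv[OF partial_u_deriv_all[OF assms]])

lemma C2_u: "C2_on (ball 0 R) u"
  unfolding C2_on_def C1_on_def
proof (intro conjI ballI)
  fix b :: 'a assume b: "b \<in> Basis"
  show "(\<lambda>t. u (x + t *\<^sub>R b)) differentiable at 0" if "x \<in> ball 0 R" for x
    using u_deriv_all[OF b that] real_differentiable_def by blast
  have "continuous_on (ball 0 R) (\<lambda>x. W x * (x \<bullet> b))" by (intro continuous_intros W_cont)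
  then show "continuous_on (ball 0 R) (partial_deriv b u)"
    by (rule continuous_on_eq) (use partial_u_all[OF b] in auto)
  fix c :: 'a assume c: "c \<in> Basis"
  show "(\<lambda>t. partial_deriv b u (x + t *\<^sub>R c)) differentiable at 0" if "x \<in> ball 0 R" for x
    using partial_u_deriv_all[OF b that] real_differentiable_def by blast
  have "continuous_on (ball 0 R) (\<lambda>x. Z b c x + W x * (b \<bullet> c))"
    by (intro continuous_intros W_cont Z_cont b c)
  then show "continuous_on (ball 0 R) (partial_deriv c (partial_deriv b u))"
    by (rule continuous_on_eq) (use partial2_u[OF b] in auto)
qed

lemma laplacian_u_0: "laplacian u 0 = real (n + 1) * L"
proof -
  have "laplacian u 0 = (\<Sum>b\<in>(Basis::'a set). L)"
    unfolding laplacian_def by (rule sum.cong) (use partial2_u[of _ 0] R_pos in \<open>auto simp: Z_def W_def\<close>)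
  then show ?thesis using dim by simp
qed

end

section \<open>From solutions on the ball to profiles and back\<close>

lemma radial_on_ray:
  fixes u :: "'a::euclidean_space \<Rightarrow> real"
  assumes "radial_on (ball 0 R) u" "e \<in> Basis" "x \<in> ball 0 R"
  shows "u x = u (norm x *\<^sub>R e)"
proof -
  obtain w where w: "\<And>x. x \<in> ball 0 R \<Longrightarrow> u x = w (norm x)" using assms(1) by (auto simp: radial_on_def)
  have "norm (norm x *\<^sub>R e) = norm x" using assms(2) by simp
  moreover from this have "norm x *\<^sub>R e \<in> ball 0 R" using assms(3) by (metis mem_ball_0)
  ultimately show ?thesis using w assms(3) by metis
qed

text \<open>Restricted to a ray, the equation multiplied by \<open>r^n\<close> is a total
  derivative. Two integrations give the integral equation that identifies the solution with
  \<open>U D\<close>. At the boundary radius only continuity is known, so the last integration uses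
  derivatives in the interior alone.\<close>

lemma Dirichlet_profile:
  fixes u :: "'a::euclidean_space \<Rightarrow> real"
  assumes sol: "positive_radial_Dirichlet_solution R a g u" and R: "R > 0"
    and a: "continuous_on {0..R} a" and g: "continuous_on {0..} g" and dim: "DIM('a) = n + 1"
  obtains v where "continuous_on {0..R} v" "\<And>s. s \<in> {0..<R} \<Longrightarrow> v s > 0" "v R = 0"
    "\<And>s. s \<in> {0..R} \<Longrightarrow> v s = v 0 - pot n (\<lambda>x. a x * g (v x)) s"
proof -
  have rad: "radial_on (ball 0 R) u" and C2: "C2_on (ball 0 R) u"
    and pos: "\<And>x. x \<in> ball 0 R \<Longrightarrow> u x > 0"
    and eq: "\<And>x. x \<in> ball 0 R \<Longrightarrow> laplacian u x + a (norm x) * g (u x) = 0"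
    and uc: "continuous_on (cball 0 R) u" and bd: "\<And>x. x \<in> sphere 0 R \<Longrightarrow> u x = 0"
    using sol by (auto simp: positive_radial_Dirichlet_solution_def positive_radial_solution_def)
  obtain e :: 'a where e: "e \<in> Basis" using nonempty_Basis by blast
  have e1: "norm e = 1" using e by simp
  then have ne: "norm (r *\<^sub>R e) = \<bar>r\<bar>" for r by simp
  have in_ball: "r *\<^sub>R e \<in> ball 0 R \<longleftrightarrow> \<bar>r\<bar> < R" for r by (simp only: mem_ball_0 ne)
  define v where "v r = u (r *\<^sub>R e)" for r
  define p where "p r = partial_deriv e u (r *\<^sub>R e)" for r
  define pp where "pp r = partial_deriv e (partial_deriv e u) (r *\<^sub>R e)" for r
  have C1: "C1_on (ball 0 R) u" "C1_on (ball 0 R) (partial_deriv e u)" using C2 e by (auto simp: C2_on_def)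
  have line: "(\<lambda>t. F (r *\<^sub>R e + t *\<^sub>R e)) = (\<lambda>t. F ((t + r) *\<^sub>R e))" for F :: "'a \<Rightarrow> real" and r
    by (simp add: algebra_simps)
  have ray_deriv: "((\<lambda>r. F (r *\<^sub>R e)) has_real_derivative partial_deriv e F (r *\<^sub>R e)) (at r)"
    if F: "C1_on (ball 0 R) F" and r: "\<bar>r\<bar> < R" for F r
  proof -
    have "r *\<^sub>R e \<in> ball 0 R" using r in_ball by blast
    then have "(\<lambda>t. F (r *\<^sub>R e + t *\<^sub>R e)) differentiable (at 0)" using F e by (auto simp: C1_on_def)
    then obtain D where D: "((\<lambda>t. F (r *\<^sub>R e + t *\<^sub>R e)) has_real_derivative D) (at 0)"
      by (auto simp: real_differentiable_def)
    then have "partial_deriv e F (r *\<^sub>R e) = D" unfolding partial_deriv_def by (rule DERIV_imp_deriv)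
    moreover have "((\<lambda>r. F (r *\<^sub>R e)) has_real_derivative D) (at (0 + r))"
      using D unfolding line by (subst DERIV_shift)
    ultimately show ?thesis by simp
  qed
  have vd: "(v has_real_derivative p r) (at r)" if "\<bar>r\<bar> < R" for r
    using ray_deriv[OF C1(1) that] by (simp add: v_def[abs_def] p_def)
  have pd: "(p has_real_derivative pp r) (at r)" if "\<bar>r\<bar> < R" for r
    using ray_deriv[OF C1(2) that] by (simp add: p_def[abs_def] pp_def)
  have ueq: "u x = v (norm x)" if "x \<in> ball 0 R" for x
    using radial_on_ray[OF rad e that] by (simp add: v_def)
  interpret radial_function R u v p pp n
    by unfold_locales (use R dim ueq vd pd in auto)
  have vc: "continuous_on {0..R} v"
    unfolding v_def by (rule continuous_on_compose2[OF uc]) (use e1 in \<open>auto intro!: continuous_intros\<close>)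
  have vpos: "v s > 0" if "s \<in> {0..<R}" for s unfolding v_def by (rule pos) (use that e1 in auto)
  have vR: "v R = 0" unfolding v_def by (rule bd) (use R e1 in auto)
  have even: "v (- t) = v t" if "\<bar>t\<bar> < R" for t
    using ueq[of "(- t) *\<^sub>R e"] ueq[of "t *\<^sub>R e"] that unfolding in_ball ne v_def by simp
  \<comment> \<open>By radial symmetry the profile is even. In dimension one, \<open>n = 0\<close>,
    the boundary term \<open>0 ^ n * p 0\<close> is \<open>p 0\<close> itself, so it has to be shown
    to vanish.\<close>
  have p0: "p 0 = 0"
  proof -
    have "((\<lambda>t. v (- t)) has_real_derivative - p 0) (at 0)"
      using DERIV_mirror[of v "p 0" 0] vd[of 0] R by simp
    then have "(v has_real_derivative - p 0) (at 0)"
      by (rule has_field_derivative_transform_within[where d=R]) (use even R in \<open>auto simp: dist_real_def\<close>)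
    then have "- p 0 = p 0" using vd[of 0] R DERIV_unique by fastforce
    then show ?thesis by simp
  qed
  define k where "k x = a x * g (v x)" for x
  have kc: "continuous_on {0..R} k"
    unfolding k_def using vpos vR R
    by (intro continuous_intros a continuous_on_compose2[OF g vc]) (force simp: le_less)
  have ode: "pp r + real n * (p r / r) = - k r" if r: "r \<in> {0<..<R}" for r
  proof -
    have x: "r *\<^sub>R e \<in> ball 0 R" "r *\<^sub>R e \<noteq> 0" using r in_ball e by auto
    show ?thesis using laplacian_u[OF x] eq[OF x(1)] ueq[OF x(1)] r unfolding ne by (simp add: k_def)
  qed
  have flux_p: "r ^ n * p r = - flux n k r" if r: "r \<in> {0..<R}" for r
  proof -
    have "((\<lambda>x. - (x ^ n * k x)) has_integral (r ^ n * p r - 0 ^ n * p 0)) {0..r}"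
    proof (rule fundamental_theorem_of_calculus_interior)
      have "isCont p x" if "x \<in> {0..r}" for x using pd[of x] that r DERIV_isCont by auto
      then show "continuous_on {0..r} (\<lambda>r. r ^ n * p r)"
        by (intro continuous_intros continuous_at_imp_continuous_on) auto
      fix x assume x: "x \<in> {0<..<r}"
      then have ppx: "pp x = - k x - real n * (p x / x)" using ode[of x] r by auto
      then have key: "x * pp x + real n * p x = - (x * k x)" using x by (simp add: field_simps)
      have *: "x ^ n * pp x + real n * x ^ (n - 1) * p x = - (x ^ n * k x)"
      proof (cases n)
        case 0
        then show ?thesis using ppx by simp
      next
        case (Suc l)
        have "x ^ n * pp x + real n * x ^ (n - 1) * p x = x ^ l * (x * pp x + real n * p x)"
          using Suc by (simp add: algebra_simps)
        then show ?thesis unfolding key using Suc by simp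
      qed
      have "((\<lambda>r. r ^ n * p r) has_real_derivative real n * x ^ (n - 1) * p x + pp x * x ^ n) (at x)"
        by (rule DERIV_mult[OF DERIV_pow[of n, folded One_nat_def] pd]) (use x r in auto)
      then have "((\<lambda>r. r ^ n * p r) has_real_derivative - (x ^ n * k x)) (at x)"
        using * by (simp add: add.commute mult.commute)
      then show "((\<lambda>r. r ^ n * p r) has_vector_derivative - (x ^ n * k x)) (at x)"
        by (simp add: has_real_derivative_iff_has_vector_derivative)
    qed (use r in auto)
    then have "integral {0..r} (\<lambda>x. - (x ^ n * k x)) = r ^ n * p r - 0 ^ n * p 0" by (rule integral_unique)
    then show ?thesis using p0 by (simp add: flux_def)
  qed
  have eqv: "v s = v 0 - pot n k s" if s: "s \<in> {0..R}" for s
  proof -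
    have "((\<lambda>x. - (flux n k x / x ^ n)) has_integral (v s - v 0)) {0..s}"
    proof (rule fundamental_theorem_of_calculus_interior)
      show "continuous_on {0..s} v" using vc s by (auto elim: continuous_on_subset)
      fix x assume x: "x \<in> {0<..<s}"
      then have "p x = - (flux n k x / x ^ n)" using flux_p[of x] s by (auto simp: field_simps)
      then show "(v has_vector_derivative - (flux n k x / x ^ n)) (at x)"
        using vd[of x] x s by (simp add: has_real_derivative_iff_has_vector_derivative)
    qed (use s in auto)
    then have "integral {0..s} (\<lambda>x. - (flux n k x / x ^ n)) = v s - v 0" by (rule integral_unique)
    then show ?thesis by (simp add: pot_def)
  qed
  have kk: "k = (\<lambda>x. a x * g (v x))" by (simp add: k_def fun_eq_iff)
  show ?thesis by (rule that[OF vc vpos vR eqv[unfolded kk]])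
qed

text \<open>Away from the origin the equation is the radial formula for the Laplacian. At the origin
  everything rests on the limit \<open>L\<close> of \<open>v' / r\<close>; the equation then gives
  \<open>v''\<close> the same limit.\<close>

lemma blowup_solution_of_profile:
  fixes v y :: "real \<Rightarrow> real"
  assumes dim: "DIM('a::euclidean_space) = n + 1" and q: "continuous_on {0..1} q"
    and g: "continuous_on {0..} g" and y0: "y 0 = 0"
    and pos: "\<And>r. r \<in> {0..<1} \<Longrightarrow> v r > 0"
    and ode: "\<And>t. t < 1 \<Longrightarrow> ode_on n q g 0 t v y"
    and lim: "filterlim v at_top (at_left 1)"
  shows "positive_radial_blowup_solution 1 q g (\<lambda>x::'a. v (norm x))"
proof -
  define p where "p r = y r / r ^ n" for r
  define pp where "pp r = - (q r * g (v r)) - real n * (p r / r)" for r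
  have d: "(v has_real_derivative p r) (at r)" "(y has_real_derivative - (r ^ n * (q r * g (v r)))) (at r)"
    if r: "r \<in> {0<..<1}" for r
  proof -
    \<comment> \<open>The system is given on closed intervals \<open>[0,t]\<close> with one-sided
      derivatives at the ends; with this \<open>t\<close> the point \<open>r\<close> is interior and
      the derivative two-sided.\<close>
    have t: "(r + 1) / 2 < 1" "r < (r + 1) / 2" using r by auto
    have "at r within {0..(r + 1) / 2} = at r" by (rule at_within_Icc_at) (use r t in auto)
    then show "(v has_real_derivative p r) (at r)" "(y has_real_derivative - (r ^ n * (q r * g (v r)))) (at r)"
      using ode[OF t(1), unfolded ode_on_def, rule_format, of r] r t by (simp_all add: p_def)
  qed
  have pd: "(p has_real_derivative pp r) (at r)" if r: "r \<in> {0<..<1}" for r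
  proof -
    have "(p has_real_derivative ((- (r ^ n * (q r * g (v r)))) * r ^ n - y r * (real n * r ^ (n - 1))) / (r ^ n * r ^ n)) (at r)"
      unfolding p_def by (rule DERIV_divide[OF d(2)[OF r]]) (use r in \<open>auto intro!: derivative_eq_intros\<close>)
    moreover have "((- (r ^ n * (q r * g (v r)))) * r ^ n - y r * (real n * r ^ (n - 1))) / (r ^ n * r ^ n) = pp r"
      using r by (cases n) (auto simp: pp_def p_def field_simps)
    ultimately show ?thesis by simp
  qed
  have "ode_on n q g 0 (1/2) v y" using ode[of "1/2"] by simp
  then have v0d: "(v has_real_derivative y 0 / 0 ^ n) (at 0 within {0..1/2})" and
    y0d: "(y has_real_derivative - (0 ^ n * (q 0 * g (v 0)))) (at 0 within {0..1/2})"
    by (auto simp: ode_on_def)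
  have at0: "at 0 within {0..1/2} = at_right (0::real)" by (rule at_within_Icc_at_right) simp
  have v0: "((\<lambda>t. (v t - v 0) / t) \<longlongrightarrow> 0) (at_right 0)"
    using v0d y0 unfolding has_field_derivative_iff at0 by simp
  have vlim: "(v \<longlongrightarrow> v 0) (at_right 0)" and ylim: "(y \<longlongrightarrow> 0) (at_right 0)"
    using DERIV_continuous[OF v0d] DERIV_continuous[OF y0d] y0 by (auto simp: continuous_within at0)
  have vc: "continuous_on {0..<1} v"
    unfolding continuous_on_eq_continuous_within
  proof
    fix r :: real assume r: "r \<in> {0..<1}"
    have t: "(r + 1) / 2 < 1" "r < (r + 1) / 2" using r by auto
    have "continuous (at r within {0..(r+1)/2}) v"
      using ode_on_continuous(1)[OF ode[OF t(1)]] r t by (auto simp: continuous_on_eq_continuous_within)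
    moreover have "at r within {0..(r+1)/2} = at r within {0..<1}"
      by (rule at_within_nhd[of _ "{..<(r+1)/2}"]) (use r t in auto)
    ultimately show "continuous (at r within {0..<1}) v" by (simp add: continuous_within)
  qed
  have gv: "continuous_on {0..<1} (\<lambda>r. q r * g (v r))"
    by (intro continuous_intros continuous_on_subset[OF q] continuous_on_compose2[OF g vc])
       (use pos in \<open>auto intro: less_imp_le\<close>)
  have gvlim: "((\<lambda>r. q r * g (v r)) \<longlongrightarrow> q 0 * g (v 0)) (at_right 0)"
  proof -
    have "continuous_on {0..1/2} (\<lambda>r. q r * g (v r))" using gv by (rule continuous_on_subset) auto
    then show ?thesis unfolding continuous_on_def at0[symmetric] by auto
  qed
  \<comment> \<open>By l'Hopital's rule, \<open>y / r ^ (n + 1)\<close> behaves like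
    \<open>y' / ((n + 1) * r ^ n)\<close>; \<open>n + 1\<close> is the dimension.\<close>
  define L where "L = - (q 0 * g (v 0)) / (real n + 1)"
  have wlim: "((\<lambda>r. p r / r) \<longlongrightarrow> L) (at_right 0)"
  proof -
    have "((\<lambda>r. y r / r ^ Suc n) \<longlongrightarrow> L) (at_right 0)"
    proof (rule lhopital_right_0[where f' = "\<lambda>r. - (r ^ n * (q r * g (v r)))" and g' = "\<lambda>r. real (Suc n) * r ^ n"])
      show "(y \<longlongrightarrow> 0) (at_right 0)" by (rule ylim)
      show "((\<lambda>r::real. r ^ Suc n) \<longlongrightarrow> 0) (at_right 0)" by (auto intro!: tendsto_eq_intros)
      have ev: "\<forall>\<^sub>F r::real in at_right 0. r \<in> {0<..<1}"
        unfolding eventually_at_right_field by (intro exI[of _ 1]) auto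
      show "\<forall>\<^sub>F r::real in at_right 0. r ^ Suc n \<noteq> 0" "\<forall>\<^sub>F r::real in at_right 0. real (Suc n) * r ^ n \<noteq> 0"
        by (rule eventually_mono[OF ev]; simp)+
      show "\<forall>\<^sub>F r in at_right 0. (y has_real_derivative - (r ^ n * (q r * g (v r)))) (at r)"
        by (rule eventually_mono[OF ev]) (rule d(2))
      show "\<forall>\<^sub>F r in at_right 0. ((\<lambda>r. r ^ Suc n) has_real_derivative real (Suc n) * r ^ n) (at r)"
        using DERIV_pow[of "Suc n"] by simp
      have "((\<lambda>r. - (q r * g (v r)) / (real n + 1)) \<longlongrightarrow> L) (at_right 0)"
        unfolding L_def by (intro tendsto_intros gvlim) auto
      then show "((\<lambda>r. - (r ^ n * (q r * g (v r))) / (real (Suc n) * r ^ n)) \<longlongrightarrow> L) (at_right 0)"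
      proof (rule Lim_transform_eventually)
        show "\<forall>\<^sub>F r in at_right 0. - (q r * g (v r)) / (real n + 1) = - (r ^ n * (q r * g (v r))) / (real (Suc n) * r ^ n)"
        proof (rule eventually_mono[OF ev])
          fix r :: real assume "r \<in> {0<..<1}"
          then have "r ^ n \<noteq> 0" by simp
          from mult_divide_mult_cancel_right[OF this, of "- (q r * g (v r))" "real n + 1"]
          show "- (q r * g (v r)) / (real n + 1) = - (r ^ n * (q r * g (v r))) / (real (Suc n) * r ^ n)"
            by (simp add: mult_ac add.commute)
        qed
      qed
    qed
    then show ?thesis by (simp add: p_def mult.commute)
  qed
  have zlim: "((\<lambda>r. pp r - p r / r) \<longlongrightarrow> 0) (at_right 0)"
  proof -
    have "((\<lambda>r. - (q r * g (v r)) - real n * (p r / r) - p r / r) \<longlongrightarrow> - (q 0 * g (v 0)) - real n * L - L) (at_right 0)"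
      by (intro tendsto_intros gvlim wlim)
    moreover have "- (q 0 * g (v 0)) - real n * L - L = 0" by (simp add: L_def field_simps)
    ultimately show ?thesis by (simp add: pp_def)
  qed
  have ppc: "continuous_on {0<..<1} pp"
  proof -
    have "continuous_on {0<..<1} p" using pd DERIV_isCont by (blast intro: continuous_at_imp_continuous_on)
    then show ?thesis unfolding pp_def
      by (intro continuous_intros continuous_on_subset[OF gv]) auto
  qed
  interpret smooth_radial_function 1 "\<lambda>x::'a. v (norm x)" v p pp n L
    by unfold_locales (use dim d(1) pd v0 wlim zlim ppc in auto)
  have lap: "laplacian (\<lambda>x::'a. v (norm x)) x + q (norm x) * g (v (norm x)) = 0" if x: "x \<in> ball 0 1" for x :: 'a
  proof (cases "x = 0")
    case True
    have "(real n + 1) * L = - (q 0 * g (v 0))" by (simp add: L_def)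
    then show ?thesis using laplacian_u_0 True by (simp add: add.commute)
  next
    case False
    then show ?thesis using laplacian_u[OF x False] by (simp add: pp_def)
  qed
  have blow: "filterlim (\<lambda>x::'a. v (norm x)) at_top (at z within ball 0 1)" if z: "z \<in> sphere 0 1" for z :: 'a
  proof (rule filterlim_compose[OF lim])
    show "filterlim norm (at_left 1) (at z within ball 0 1)"
      unfolding filterlim_at
    proof
      show "\<forall>\<^sub>F x in at z within ball 0 1. norm x \<in> {..<1} \<and> norm x \<noteq> 1"
        by (auto simp: eventually_at_filter)
      have "((\<lambda>x. norm x) \<longlongrightarrow> norm z) (at z within ball 0 1)" by (intro tendsto_intros)
      then show "(norm \<longlongrightarrow> 1) (at z within ball 0 1)" using z by simp
    qed
  qed
  show ?thesis
    unfolding positive_radial_blowup_solution_def positive_radial_solution_def radial_on_def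
    using C2_u lap blow pos by auto
qed

section \<open>Choice of the constants and conclusion\<close>

text \<open>A compactness statement, obtained from its version for time-dependent functions with the
  one-point time set \<open>{0}\<close>.\<close>

lemma locally_lipschitz_on_Icc:
  assumes "locally_lipschitz_on {0..} g"
  shows "\<exists>L. L-lipschitz_on {0..K} g"
proof -
  have "local_lipschitz {0::real} {0..K} (\<lambda>_. g)"
  proof (rule local_lipschitzI)
    fix t x :: real assume "x \<in> {0..K}"
    then obtain e L where eL: "e > 0" "L-lipschitz_on (cball x e \<inter> {0..}) g"
      using assms unfolding locally_lipschitz_on_def by (metis atLeastAtMost_iff atLeast_iff)
    have "L-lipschitz_on (cball x e \<inter> {0..K}) g" by (rule lipschitz_on_subset[OF eL(2)]) auto
    then show "\<exists>u>0. \<exists>L. \<forall>t\<in>cball t u \<inter> {0}. L-lipschitz_on (cball x u \<inter> {0..K}) g"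
      using eL(1) by blast
  qed
  from local_lipschitz_compact_implies_lipschitz[OF this] show ?thesis by force
qed

lemma uniform_threshold:
  fixes P :: "'i \<Rightarrow> real \<Rightarrow> bool"
  assumes "finite I" "\<And>i. i \<in> I \<Longrightarrow> \<exists>M. P i M" "\<And>i x y. P i x \<Longrightarrow> x \<le> y \<Longrightarrow> P i y"
  shows "\<exists>M\<ge>c. \<forall>i\<in>I. P i M"
proof -
  obtain F where F: "\<And>i. i \<in> I \<Longrightarrow> P i (F i)" using assms(2) by metis
  define M where "M = Max (insert c (F ` I))"
  have "F i \<le> M" if "i \<in> I" for i unfolding M_def by (rule Max_ge) (use assms(1) that in auto)
  moreover have "c \<le> M" unfolding M_def by (rule Max_ge) (use assms(1) in auto)
  ultimately show ?thesis using F assms(3) by blast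
qed

lemma ode_on_cong_nonlinearity:
  assumes "ode_on n q f a b u y" "\<And>r. r \<in> {a..b} \<Longrightarrow> f (u r) = g (u r)"
  shows "ode_on n q g a b u y"
  using assms by (simp add: ode_on_def)

theorem theorem3p2:
  fixes a g :: "real \<Rightarrow> real" and \<sigma> \<tau> :: "nat \<Rightarrow> real" and m :: nat
  assumes a_cont: "continuous_on {0..1} a"
    and a_1: "a 1 < 0"
    and m_ge: "m \<ge> 1"
    and sigma_first: "\<sigma> 1 = 0"
    and sigma_last: "\<sigma> (m + 1) = 1"
    and ordered: "\<And>i. i \<in> {1..m} \<Longrightarrow> \<sigma> i < \<tau> i \<and> \<tau> i < \<sigma> (i + 1)"
    and a_nonneg: "\<And>i. i \<in> {1..m} \<Longrightarrow>
      (\<forall>r\<in>{\<sigma> i..\<tau> i}. a r \<ge> 0) \<and> (\<exists>r\<in>{\<sigma> i..\<tau> i}. a r \<noteq> 0)"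
    and a_nonpos: "\<And>i. i \<in> {1..m} \<Longrightarrow>
      (\<forall>r\<in>{\<tau> i..\<sigma> (i + 1)}. a r \<le> 0) \<and> (\<exists>r\<in>{\<tau> i..\<sigma> (i + 1)}. a r \<noteq> 0)"
    and g_lipschitz: "locally_lipschitz_on {0..} g"
    and g_0: "g 0 = 0"
    and g_pos: "\<And>u. u > 0 \<Longrightarrow> g u > 0"
    and g_superlinear_0: "((\<lambda>u. g u / u) \<longlongrightarrow> 0) (at_right 0)"
    and g_superlinear_inf: "filterlim (\<lambda>u. g u / u) at_top at_top"
    and keller_osserman:
      "(\<integral>\<^sup>+ \<xi>\<in>{1..}. ennreal (1 / sqrt (primitive g \<xi>)) \<partial>lborel) < \<infinity>"
    and keller_osserman_lim:
      "((\<lambda>u. \<integral>\<^sup>+ \<xi>\<in>{u<..}. ennreal (1 / sqrt (primitive g \<xi> - primitive g u)) \<partial>lborel)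
         \<longlongrightarrow> 0) at_top"
    and dirichlet: "\<exists>u :: real^'n \<Rightarrow> real. positive_radial_Dirichlet_solution (\<tau> 1) a g u"
  shows "\<exists>\<mu>'>0. \<forall>\<mu>>\<mu>'. \<exists>U :: (real^'n \<Rightarrow> real) set.
           finite U \<and> card U = 2 ^ m \<and>
           (\<forall>u\<in>U. positive_radial_blowup_solution 1
                     (\<lambda>r. max (a r) 0 - \<mu> * max (- a r) 0) g u) \<and>
           (\<forall>u\<in>U. \<forall>w\<in>U. u \<noteq> w \<longrightarrow> (\<exists>x\<in>ball 0 1. u x \<noteq> w x))"
proof -
  define n where "n = CARD('n) - 1"
  have dim: "DIM(real^'n) = n + 1" by (simp add: n_def Suc_leI)
  define f where "f x = g (max x 0)" for x
  have fg: "f x = g x" if "x \<ge> 0" for x using that by (simp add: f_def max_absorb1)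
  have order: "0 \<le> \<sigma> i" "\<sigma> i < \<tau> i" "\<tau> i < \<sigma> (i + 1)" "\<sigma> (i + 1) \<le> 1" "0 < \<tau> i" "\<tau> i < 1"
    if "i \<in> {1..m}" for i
    using interlaced_mono[where \<sigma>=\<sigma> and \<tau>=\<tau> and m=m, OF ordered, of 1 i]
      interlaced_mono[where \<sigma>=\<sigma> and \<tau>=\<tau> and m=m, OF ordered, of "i + 1" "m + 1"]
      ordered[OF that] that sigma_first sigma_last by auto
  have sub: "{\<sigma> i..\<tau> i} \<subseteq> {0..1}" "{\<tau> i..\<sigma> (i + 1)} \<subseteq> {0..1}" if "i \<in> {1..m}" for i
    using order[OF that] by auto
  have f_lip: "\<exists>L. L-lipschitz_on {..K} f" for K
  proof -
    obtain L where L: "L-lipschitz_on {0..max K 0} g" using locally_lipschitz_on_Icc[OF g_lipschitz] by blast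
    have "L-lipschitz_on {..K} f"
    proof (rule lipschitz_onI)
      fix x y assume xy: "x \<in> {..K}" "y \<in> {..K}"
      have "dist (f x) (f y) \<le> L * dist (max x 0) (max y 0)"
        unfolding f_def by (rule lipschitz_onD[OF L]) (use xy in auto)
      also have "\<dots> \<le> L * dist x y"
        using lipschitz_on_nonneg[OF L] by (intro mult_left_mono) (auto simp: dist_real_def)
      finally show "dist (f x) (f y) \<le> L * dist x y" .
    qed (rule lipschitz_on_nonneg[OF L])
    then show ?thesis by blast
  qed
  have gc: "continuous_on {0..} g"
    unfolding continuous_on_eq_continuous_within
  proof
    fix x :: real assume x: "x \<in> {0..}"
    obtain L where "L-lipschitz_on {0..x+1} g" using locally_lipschitz_on_Icc[OF g_lipschitz] by blast
    then have "continuous (at x within {0..x+1}) g"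
      using lipschitz_on_continuous_on x unfolding continuous_on_eq_continuous_within by fastforce
    moreover have "at x within {0..x+1} = at x within {0..}"
      by (rule at_within_nhd[of _ "{..<x+1}"]) auto
    ultimately show "continuous (at x within {0..}) g" by (simp add: continuous_within)
  qed
  have fc: "continuous_on UNIV f"
    unfolding f_def by (rule continuous_on_compose2[OF gc]) (auto intro!: continuous_intros)
  have prim: "integral {0..\<xi>} f = primitive g \<xi>" for \<xi>
    unfolding primitive_def by (rule integral_cong) (simp add: fg)
  interpret superlinear n f
  proof
    show "f x = 0" if "x \<le> 0" for x using that g_0 by (simp add: f_def max_absorb2)
    show "f x > 0" if "x > 0" for x using that g_pos by (simp add: fg)
    show "((\<lambda>u. f u / u) \<longlongrightarrow> 0) (at_right 0)"
      by (rule Lim_transform_eventually[OF g_superlinear_0])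
         (auto simp: eventually_at_filter fg)
    show "filterlim (\<lambda>u. f u / u) at_top at_top"
      by (rule filterlim_mono_eventually[OF g_superlinear_inf order.refl order.refl])
         (auto simp: eventually_at_top_linorder fg intro!: exI[of _ 0])
  qed (use fc keller_osserman_lim in \<open>simp_all add: prim\<close>)
  have one: "1 \<in> {1..m}" using m_ge by auto
  obtain u0 :: "real^'n \<Rightarrow> real" where u0: "positive_radial_Dirichlet_solution (\<tau> 1) a g u0"
    using dirichlet by blast
  have a_cont1: "continuous_on {0..\<tau> 1} a"
    by (rule continuous_on_subset[OF a_cont]) (use order[OF one] in auto)
  obtain v where v: "continuous_on {0..\<tau> 1} v" "\<And>s. s \<in> {0..<\<tau> 1} \<Longrightarrow> v s > 0" "v (\<tau> 1) = 0"
    "\<And>s. s \<in> {0..\<tau> 1} \<Longrightarrow> v s = v 0 - pot n (\<lambda>x. a x * g (v x)) s"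
    using that by (rule Dirichlet_profile[OF u0 order(5)[OF one] a_cont1 gc dim])
  define D where "D = v 0"
  have D: "D > 0" unfolding D_def by (rule v(2)) (use order[OF one] in auto)
  obtain A where A: "A > 0" "\<And>r. r \<in> {0..1} \<Longrightarrow> \<bar>a r\<bar> \<le> A"
    using continuous_on_bounded_Icc[OF a_cont] by metis
  \<comment> \<open>A lower bound for \<open>x ^ n\<close> at the end of the first hump and
    everywhere beyond it.\<close>
  define \<rho> where "\<rho> = \<tau> 1 ^ n"
  have \<rho>: "\<rho> > 0" using order[OF one] by (simp add: \<rho>_def)
  obtain \<delta>1 where \<delta>1: "\<delta>1 > 0" "\<And>x. 0 \<le> x \<Longrightarrow> x \<le> \<delta>1 \<Longrightarrow> f x \<le> \<rho> / (4 * A) * x"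
    using f_small[of "\<rho> / (4 * A)"] \<rho> A by auto
  define \<delta> where "\<delta> = min \<delta>1 (D / 2)"
  have \<delta>: "\<delta> > 0" "\<delta> \<le> \<delta>1" "\<delta> < D" using \<delta>1 D by (auto simp: \<delta>_def)
  have small: "A * f x \<le> \<rho> * e / 4" if "x \<le> e" "0 < e" "e \<le> \<delta>" for x e
  proof (cases "x \<le> 0")
    case True
    then show ?thesis using f_nonpos \<rho> that by simp
  next
    case False
    then have "f x \<le> \<rho> / (4 * A) * x" using \<delta>1(2)[of x] that \<delta> by auto
    also have "\<dots> \<le> \<rho> / (4 * A) * e" using that \<rho> A by (intro mult_left_mono) auto
    finally show ?thesis using A by (simp add: field_simps)
  qed
  \<comment> \<open>The weight here is \<open>a\<close>: on a hump the final weight equals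
    \<open>a\<close> for every \<mu>, so the bound \<open>M\<close> can be fixed before \<mu>. The
    demand \<open>M \<ge> D\<close> covers the first hump.\<close>
  define bounding where "bounding i M \<longleftrightarrow> (\<forall>u y. ode_on n a f (\<sigma> i) (\<tau> i) u y \<longrightarrow>
      (\<forall>r\<in>{\<sigma> i..\<tau> i}. u r > 0) \<longrightarrow> (\<forall>r\<in>{\<sigma> i..\<tau> i}. u r \<le> M))" for i M
  have "\<exists>M\<ge>D. \<forall>i\<in>{2..m}. bounding i M"
  proof (rule uniform_threshold)
    fix i assume i: "i \<in> {2..m}"
    then have i1: "i \<in> {1..m}" by auto
    have "\<tau> 1 < \<sigma> (1 + 1)" "\<sigma> 2 \<le> \<sigma> i"
      using order[OF one] interlaced_mono[where \<sigma>=\<sigma> and \<tau>=\<tau> and m=m, OF ordered, of 2 i] i by auto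
    then have "\<sigma> i > 0" using order[OF one] by (simp add: numeral_2_eq_2)
    from a_priori_bound[OF this order(2)[OF i1] less_imp_le[OF order(6)[OF i1]]
        continuous_on_subset[OF a_cont sub(1)[OF i1]]] a_nonneg[OF i1]
    show "\<exists>M. bounding i M" unfolding bounding_def by auto
  next
    fix i x y assume "bounding i x" "x \<le> y"
    then show "bounding i y" unfolding bounding_def by (meson order_trans)
  qed simp
  then obtain M where M: "D \<le> M" "\<And>i u y r. i \<in> {2..m} \<Longrightarrow> ode_on n a f (\<sigma> i) (\<tau> i) u y \<Longrightarrow>
      (\<And>r. r \<in> {\<sigma> i..\<tau> i} \<Longrightarrow> u r > 0) \<Longrightarrow> r \<in> {\<sigma> i..\<tau> i} \<Longrightarrow> u r \<le> M"
    unfolding bounding_def by metis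
  obtain c where c: "c > 0" "\<And>x. x \<le> M \<Longrightarrow> f x \<le> c" using f_upper_bound[of M] by blast
  \<comment> \<open>The first summand bounds the loss of flux over all humps; adding \<delta> yields
    \<open>\<delta> \<le> C\<close>, needed for the flux after a small hump.\<close>
  define C where "C = real m * (A * c) + \<delta>"
  have C: "C \<ge> 0" "\<delta> \<le> C" "\<And>x. x \<le> M \<Longrightarrow> real m * (A * f x) \<le> C"
  proof -
    have "real m * (A * c) \<ge> 0" using A c by simp
    then show "C \<ge> 0" "\<delta> \<le> C" using \<delta> by (auto simp: C_def)
    fix x assume "x \<le> M"
    then have "real m * (A * f x) \<le> real m * (A * c)" using c A by (intro mult_left_mono) auto
    then show "real m * (A * f x) \<le> C" using \<delta> by (simp add: C_def)
  qed
  define absorbing where "absorbing i \<mu>0 \<longleftrightarrow> (\<forall>\<mu>\<ge>\<mu>0. \<forall>u y. ode_on n (\<lambda>r. \<mu> * a r) f (\<tau> i) (\<sigma> (i + 1)) u y \<longrightarrow>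
      y (\<tau> i) \<ge> - C \<longrightarrow> (\<exists>r\<in>{\<tau> i..\<sigma> (i + 1)}. u r < \<delta> / 4) \<and> (y (\<sigma> (i + 1)) \<le> 0 \<longrightarrow> u (\<sigma> (i + 1)) < \<delta> / 2))"
    for i and \<mu>0 :: real
  have "\<exists>\<mu>0\<ge>1. \<forall>i\<in>{1..m}. absorbing i \<mu>0"
  proof (rule uniform_threshold)
    fix i assume i: "i \<in> {1..m}"
    note o = order[OF i]
    have ac: "continuous_on {\<tau> i..\<sigma> (i + 1)} a" by (rule continuous_on_subset[OF a_cont sub(2)[OF i]])
    have an: "\<And>r. r \<in> {\<tau> i..\<sigma> (i + 1)} \<Longrightarrow> a r \<le> 0" "\<exists>r\<in>{\<tau> i..\<sigma> (i + 1)}. a r \<noteq> 0"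
      using a_nonpos[OF i] by auto
    have d: "\<delta> / 4 > 0" "\<delta> / 2 > 0" using \<delta> by auto
    obtain \<mu>1 where \<mu>1: "\<And>\<mu> u y. \<mu> \<ge> \<mu>1 \<Longrightarrow> ode_on n (\<lambda>r. \<mu> * a r) f (\<tau> i) (\<sigma> (i + 1)) u y \<Longrightarrow>
      y (\<tau> i) \<ge> - C \<Longrightarrow> \<exists>r\<in>{\<tau> i..\<sigma> (i + 1)}. u r < \<delta> / 4"
      using absorption_blowup[OF o(5,3,4) ac an d(1) C(1)] by blast
    obtain \<mu>2 where \<mu>2: "\<And>\<mu> u y. \<mu> \<ge> \<mu>2 \<Longrightarrow> ode_on n (\<lambda>r. \<mu> * a r) f (\<tau> i) (\<sigma> (i + 1)) u y \<Longrightarrow>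
      y (\<tau> i) \<ge> - C \<Longrightarrow> y (\<sigma> (i + 1)) \<le> 0 \<Longrightarrow> u (\<sigma> (i + 1)) < \<delta> / 2"
      using absorption_small[OF o(5,3,4) ac an d(2) C(1)] by blast
    have "absorbing i (max \<mu>1 \<mu>2)" unfolding absorbing_def using \<mu>1 \<mu>2 by (meson max.bounded_iff)
    then show "\<exists>\<mu>0. absorbing i \<mu>0" by blast
  next
    fix i x y assume "absorbing i x" "x \<le> y"
    then show "absorbing i y" unfolding absorbing_def by (meson order_trans)
  qed simp
  then obtain \<mu>0 where \<mu>0: "\<mu>0 \<ge> 1" "\<And>i. i \<in> {1..m} \<Longrightarrow> absorbing i \<mu>0" by blast
  show ?thesis
  proof (intro exI[of _ \<mu>0] conjI allI impI)
    show "\<mu>0 > 0" using \<mu>0 by simp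
    fix \<mu> :: real assume \<mu>: "\<mu>0 < \<mu>"
    define q where "q r = max (a r) 0 - \<mu> * max (- a r) 0" for r
    have qc: "continuous_on {0..1} q" unfolding q_def by (intro continuous_intros a_cont)
    have q_pos: "q r = a r" if "a r \<ge> 0" for r using that by (simp add: q_def)
    have q_neg: "q r = \<mu> * a r" if "a r \<le> 0" for r using that by (simp add: q_def)
    interpret radial_ode n q f by unfold_locales (use qc f_lip in auto)
    have q_on_neg: "ode_on n (\<lambda>r. \<mu> * a r) f (\<tau> i) (\<sigma> (i + 1)) u y"
      if "i \<in> {1..m}" "ode_on n q f (\<tau> i) (\<sigma> (i + 1)) u y" for i u y
      by (rule ode_on_cong[OF that(2)]) (use a_nonpos[OF that(1)] q_neg in auto)
    interpret shooting n q f \<sigma> \<tau> m A M C \<rho> \<delta> D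
    proof
      fix i r assume i: "i \<in> {1..m}"
      show "r \<in> {\<sigma> i..\<tau> i} \<Longrightarrow> 0 \<le> q r \<and> q r \<le> A"
      proof -
        assume r: "r \<in> {\<sigma> i..\<tau> i}"
        then have "a r \<ge> 0" "\<bar>a r\<bar> \<le> A" using a_nonneg[OF i] A(2)[of r] sub(1)[OF i] by auto
        then show "0 \<le> q r \<and> q r \<le> A" using q_pos by auto
      qed
      show "r \<in> {\<tau> i..\<sigma> (i + 1)} \<Longrightarrow> q r \<le> 0"
      proof -
        assume r: "r \<in> {\<tau> i..\<sigma> (i + 1)}"
        then have "a r \<le> 0" using a_nonpos[OF i] by auto
        then show "q r \<le> 0" using q_neg \<mu> \<mu>0 by (auto simp: mult_nonneg_nonpos)
      qed
    next
      fix i u y r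
      assume i: "i \<in> {2..m}" and o: "ode_on n q f (\<sigma> i) (\<tau> i) u y"
        and pos: "\<And>r. r \<in> {\<sigma> i..\<tau> i} \<Longrightarrow> u r > 0" and r: "r \<in> {\<sigma> i..\<tau> i}"
      have "ode_on n a f (\<sigma> i) (\<tau> i) u y"
        by (rule ode_on_cong[OF o]) (use a_nonneg[of i] i q_pos in auto)
      then show "u r \<le> M" by (rule M(2)[OF i _ _ r, where u = u]) (rule pos)
    next
      fix i u y
      assume i: "i \<in> {1..m}" and o: "ode_on n q f (\<tau> i) (\<sigma> (i + 1)) u y" and y: "y (\<tau> i) \<ge> - C"
      have *: "(\<exists>r\<in>{\<tau> i..\<sigma> (i + 1)}. u r < \<delta> / 4) \<and> (y (\<sigma> (i + 1)) \<le> 0 \<longrightarrow> u (\<sigma> (i + 1)) < \<delta> / 2)"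
        using \<mu>0(2)[OF i] q_on_neg[OF i o] y \<mu> unfolding absorbing_def by (meson less_imp_le)
      then show "\<exists>r\<in>{\<tau> i..\<sigma> (i + 1)}. u r < \<delta> / 4" by blast
      show "y (\<sigma> (i + 1)) \<le> 0 \<Longrightarrow> u (\<sigma> (i + 1)) < \<delta> / 2" using * by blast
    next
      fix t :: real assume t: "t < 1"
      have "- a 1 / 2 > 0" using a_1 by simp
      with a_cont obtain e where e: "e > 0" "\<And>x. x \<in> {0..1} \<Longrightarrow> dist x 1 < e \<Longrightarrow> dist (a x) (a 1) < - a 1 / 2"
        unfolding continuous_on_iff by (metis atLeastAtMost_iff order.refl zero_le_one)
      \<comment> \<open>Late enough to lie beyond \<open>t\<close> and away from 0, and so close to
        1 that \<open>a \<le> a 1 / 2\<close> on \<open>[p,1]\<close>.\<close>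
      define p where "p = max (max ((t + 1) / 2) (1 / 2)) (1 - e / 2)"
      have "1 / 2 \<le> p" "(t + 1) / 2 \<le> p" "1 - e / 2 \<le> p"
        unfolding p_def by (simp_all only: le_max_iff_disj) simp_all
      moreover have "p < 1" using t e by (auto simp: p_def)
      ultimately have p: "t < p" "0 < p" "p < 1" "1 - p < e" using t e by (auto simp: field_simps)
      have qp: "q r \<le> - (- a 1 / 2)" if r: "r \<in> {p..1}" for r
      proof -
        have "dist (a r) (a 1) < - a 1 / 2" by (rule e(2)) (use r p in \<open>auto simp: dist_real_def\<close>)
        then have ar: "a r \<le> a 1 / 2" unfolding dist_real_def by linarith
        then have "\<mu> * a r \<le> 1 * a r" using a_1 \<mu> \<mu>0 by (intro mult_right_mono_neg) auto
        moreover have "q r = \<mu> * a r" using q_neg[of r] ar a_1 by simp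
        ultimately show ?thesis using ar by linarith
      qed
      obtain K where K: "\<And>q u y. ode_on n q f p 1 u y \<Longrightarrow> (\<And>r. r \<in> {p..1} \<Longrightarrow> q r \<le> - (- a 1 / 2)) \<Longrightarrow>
          u p \<ge> K \<Longrightarrow> y p < 0"
        using keller_osserman_blowup[OF p(2,3) order.refl \<open>- a 1 / 2 > 0\<close>] by blast
      show "\<exists>p K. t < p \<and> 0 < p \<and> p < 1 \<and> (\<forall>u y. ode_on n q f p 1 u y \<longrightarrow> u p \<ge> K \<longrightarrow> y p < 0)"
        using p K[where q = q, OF _ qp] by blast
    next
      \<comment> \<open>Up to the end of the first hump the weight is \<open>a\<close> and the
        profile is nonnegative, so the Dirichlet profile solves the modified problem; uniqueness
        then identifies it with \<open>U D\<close>.\<close>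
      have eq: "v s = D - pot n (\<lambda>x. q x * f (v x)) s" if s: "s \<in> {0..\<tau> 1}" for s
      proof -
        have "pot n (\<lambda>x. a x * g (v x)) s = pot n (\<lambda>x. q x * f (v x)) s"
        proof (rule pot_cong)
          fix x assume x: "x \<in> {0..s}"
          have "v x \<ge> 0" using v(2)[of x] v(3) x s by (cases "x = \<tau> 1") auto
          moreover have "a x \<ge> 0" using a_nonneg[OF one] x s sigma_first by auto
          ultimately show "a x * g (v x) = q x * f (v x)" using fg q_pos by simp
        qed
        then show ?thesis using v(4)[OF s] by (simp add: D_def)
      qed
      have "U D (\<tau> 1) = v (\<tau> 1)"
        by (rule existingI(2)[OF v(1) eq]) (use order[OF one] in auto)
      then show "U D (\<tau> 1) \<le> 0" using v(3) by simp
    qed (use m_ge sigma_first sigma_last ordered C A D M(1) \<delta> \<rho> small in \<open>auto simp: \<rho>_def\<close>)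
    obtain S where S: "finite S" "card S = 2 ^ m" "S \<subseteq> {0..D}" "\<And>d. d \<in> S \<Longrightarrow> final d"
      using final_solutions by blast
    define sol where "sol d x = U d (norm x)" for d and x :: "real^'n"
    have ex: "d \<in> existing t" if "d \<in> S" "t < 1" for d t using S(4)[OF that(1)] that(2) by (simp add: final_def)
    have sol0: "sol d 0 = d" if "d \<in> S" for d
      using U_0[OF ex[OF that, of 0]] by (simp add: sol_def)
    have inj: "inj_on sol S" using sol0 by (metis inj_onI)
    have blow: "positive_radial_blowup_solution 1 q g (sol d)" if d: "d \<in> S" for d
      unfolding sol_def
    proof (rule blowup_solution_of_profile[where y = "Y d", OF dim qc gc Y_0])
      have d0: "0 \<le> d" using S(3) d by auto
      show pos: "U d r > 0" if "r \<in> {0..<1}" for r by (rule final_positive[OF S(4)[OF d] d0 that])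
      show "ode_on n q g 0 t (U d) (Y d)" if "t < 1" for t
        by (rule ode_on_cong_nonlinearity[OF existing_ode[OF ex[OF d that] less_imp_le[OF that]]])
           (rule fg, rule less_imp_le, rule pos, use that in auto)
      show "filterlim (U d) at_top (at_left 1)" by (rule final_blowup[OF S(4)[OF d]])
    qed
    show "\<exists>U :: (real^'n \<Rightarrow> real) set. finite U \<and> card U = 2 ^ m \<and>
           (\<forall>u\<in>U. positive_radial_blowup_solution 1 (\<lambda>r. max (a r) 0 - \<mu> * max (- a r) 0) g u) \<and>
           (\<forall>u\<in>U. \<forall>w\<in>U. u \<noteq> w \<longrightarrow> (\<exists>x\<in>ball 0 1. u x \<noteq> w x))"
    proof (intro exI[of _ "sol ` S"] conjI ballI impI)
      show "finite (sol ` S)" "card (sol ` S) = 2 ^ m" using S inj by (simp_all add: card_image)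
      show "positive_radial_blowup_solution 1 (\<lambda>r. max (a r) 0 - \<mu> * max (- a r) 0) g u" if "u \<in> sol ` S" for u
        using blow that by (auto simp: q_def[abs_def])
      fix u w assume "u \<in> sol ` S" "w \<in> sol ` S" "u \<noteq> w"
      then have "u 0 \<noteq> w 0" using sol0 by auto
      then show "\<exists>x\<in>ball 0 1. u x \<noteq> w x" by (intro bexI[of _ 0]) auto
    qed
  qed
qed

end
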